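(* Let $C\{M_n\}$ be a non-quasianalytic Denjoy--Carleman class with Ostrowski function $T(r)=\sup_{n\ge0}r^n/M_n$. If $\varphi(r)=\log T(r)$ satisfies $$\lim_{t\to\infty}\frac{t\varphi'(t)}{\left(t^3\int_t^\infty\frac{\varphi(\xi)}{\xi^4}\,d\xi\right)^{2/3}}=+\infty,$$ then $$\log\delta_{\{M_n\}}(s)=-(1+o(1))\,Q(s),\qquad s\to0\ (s>0).$$ If $\varphi$ also satisfies $\liminf_{t\to\infty}\frac{\log\varphi(t)}{\log t}>0$, then the sharper asymptotic relation $$\log\delta_{\{M_n\}}(s)=-Q(s)+O(\log Q(s)),\qquad s\to0\ (s>0),$$ holds.
   Context: For a sequence $\{M_n\}_{n\ge0}$ of positive numbers, $C\{M_n\}$ is the class of $C^\infty$-functions $g$ on $\mathbb R$ with $\sup_{\mathbb R}|g^{(n)}|\le M_n$ for $n=0,1,2,\dots$. It is non-quasianalytic if it contains a not identically zero function vanishing together with all its derivatives at a point (equivalently, $\int_{\mathbb R}\frac{\log T(|t|)}{1+t^2}\,dt<\infty$). Set $$\delta_{\{M_n\}}(s)=\sup\{|g(s)|:\ g\in C\{M_n\},\ g^{(n)}(0)=0,\ n=0,1,2,\dots\}.$$ Put $\varphi(t)=\log T(|t|)=\sup_{n\ge0}[n\log|t|-\log M_n]$ for $t\in\mathbb R$; where $\varphi$ is not differentiable, $\varphi'$ denotes the right derivative. For $s>0$, $$Q(s)=\sup_{y>0}\left[\frac{2y}{\pi}\int_0^\infty\frac{\varphi(t)\,dt}{t^2+y^2}-ys\right].$$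 *)

theory Defs
  imports "HOL-Analysis.Analysis" "HOL-Library.Landau_Symbols"
begin

definition nth_vderiv :: "nat \<Rightarrow> (real \<Rightarrow> complex) \<Rightarrow> real \<Rightarrow> complex" where
  "nth_vderiv n g = ((\<lambda>h t. vector_derivative h (at t)) ^^ n) g"

definition smooth_fun :: "(real \<Rightarrow> complex) \<Rightarrow> bool" where
  "smooth_fun g \<longleftrightarrow> (\<forall>n x. nth_vderiv n g differentiable (at x))"

definition flat_at :: "(real \<Rightarrow> complex) \<Rightarrow> real \<Rightarrow> bool" where
  "flat_at g x \<longleftrightarrow> (\<forall>n. nth_vderiv n g x = 0)"

text \<open>The class is normalised exactly by the sequence: there are no constants
  \<open>C K^n\<close> in front of \<open>M n\<close>.\<close>

definition DC_class :: "(nat \<Rightarrow> real) \<Rightarrow> (real \<Rightarrow> complex) set" where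
  "DC_class M = {g. smooth_fun g \<and> (\<forall>n x. norm (nth_vderiv n g x) \<le> M n)}"

definition non_quasianalytic :: "(nat \<Rightarrow> real) \<Rightarrow> bool" where
  "non_quasianalytic M \<longleftrightarrow> (\<exists>g\<in>DC_class M. (\<exists>x. g x \<noteq> 0) \<and> (\<exists>x. flat_at g x))"

text \<open>For positive \<open>M\<close> this is a supremum of a nonempty set (it contains \<open>0\<close>)
  bounded by \<open>M 0\<close>.\<close>

definition flat_extremal :: "(nat \<Rightarrow> real) \<Rightarrow> real \<Rightarrow> real" where
  "flat_extremal M s = (SUP g\<in>{g\<in>DC_class M. flat_at g 0}. norm (g s))"

text \<open>The real supremum is a genuine one in the non-quasianalytic case: Taylor's formula at a
  flat point of a nonzero function in the class gives \<open>M n \<ge> c * fact n / R ^ n\<close> for some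
  \<open>c, R > 0\<close>, so \<open>r ^ n / M n\<close> is bounded in \<open>n\<close>.\<close>

definition Ostrowski :: "(nat \<Rightarrow> real) \<Rightarrow> real \<Rightarrow> real" where
  "Ostrowski M r = (SUP n. r ^ n / M n)"

text \<open>Taking the logarithm outside the supremum avoids \<open>ln 0 = 0\<close>; at \<open>t = 0\<close> the value is
  \<open>- ln (M 0)\<close>, as for \<open>n log |t| - log M n\<close> with \<open>0 log 0 = 0\<close> and \<open>log 0 = -\<infinity>\<close>.\<close>

definition log_Ostrowski :: "(nat \<Rightarrow> real) \<Rightarrow> real \<Rightarrow> real" where
  "log_Ostrowski M t = ln (Ostrowski M \<bar>t\<bar>)"

definition right_deriv :: "(real \<Rightarrow> real) \<Rightarrow> real \<Rightarrow> real" where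
  "right_deriv f t = vector_derivative f (at_right t)"

text \<open>For non-quasianalytic \<open>M\<close>, the integral converges absolutely and the Poisson integral
  is \<open>o(y)\<close> as \<open>y \<rightarrow> \<infinity>\<close>, so for \<open>s > 0\<close> the supremum is finite.\<close>

definition Q_fun :: "(nat \<Rightarrow> real) \<Rightarrow> real \<Rightarrow> real" where
  "Q_fun M s = (SUP y\<in>{0<..}. 2 * y / pi *
      (LINT t:{0..}|lborel. log_Ostrowski M t / (t\<^sup>2 + y\<^sup>2)) - y * s)"

end

theory Submission
  imports Defs
    "HOL-Complex_Analysis.Conformal_Mappings"
    "HOL-Probability.Characteristic_Functions"
    "HOL-Real_Asymp.Real_Asymp"
begin

text \<open>Let \<open>\<phi> = log_Ostrowski M\<close>, let \<open>P = poisson \<phi>\<close> be its Poisson integral in the upper half-plane, \<open>p y = P 0 y\<close>,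
and let \<open>F = schwarz \<phi>\<close> be the analytic function with real part \<open>P\<close> that is real on the imaginary axis.
Then \<open>Q_fun M s\<close> is the supremum of \<open>p y - y * s\<close> over \<open>y > 0\<close>.

Upper bound. If \<open>g\<close> in the class is flat at \<open>0\<close>, the Laplace transform \<open>L\<close> of its restriction to the positive
half-line is analytic in the upper half-plane, and \<open>n\<close> integrations by parts give
\<open>\<bar>z\<bar> ^ n * \<bar>L z\<bar> \<le> M n / Im z\<close>. Hence \<open>\<bar>L\<bar> \<le> exp (- \<phi>)\<close> on the line \<open>Im z = 1\<close> and above it, and the maximum
principle improves this to \<open>\<bar>L (x + \<i> * (y + 1))\<bar> \<le> exp (- P x y)\<close> (\<open>majorization\<close>). As \<open>\<phi>\<close> is even and increasing,
\<open>P x y \<ge> p y\<close>. Fourier inversion along the line turns this into \<open>ln \<bar>g s\<bar> \<le> - (p y - y * s) + O(ln y)\<close> for every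
\<open>y\<close> (\<open>flat_function_upper_bound\<close>). The majorization also yields the integrability of \<open>\<phi> t / (1 + t\<^sup>2)\<close>: otherwise
every such \<open>L\<close>, and with it every \<open>g\<close>, would vanish.

Lower bound. A single function serves for all \<open>s\<close>: the one whose Laplace transform is a constant multiple of
\<open>exp (- F (z + \<i>)) / (z + 2 * \<i>)\<^sup>2\<close>. Since \<open>\<bar>z\<bar> ^ n \<le> M n * exp (P (Re z) (Im z))\<close> (\<open>power_le_exp_poisson\<close>), it lies in the
class; moving the line of integration up to infinity shows that it is flat at \<open>0\<close> (\<open>near_extremal_in_class\<close>).
Its value at \<open>s\<close> is found by the saddle point method. Let \<open>\<eta>\<close> maximise \<open>p y - y * s\<close>, so that \<open>s\<close> is the derivative of
\<open>p\<close> at \<open>\<eta>\<close>, and let \<open>A > 0\<close> be minus the second derivative. Then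
\<open>F (x + \<i> * \<eta>) = p \<eta> - \<i> * x * s + A * x\<^sup>2 / 2 + O(B * \<bar>x\<bar>\<^sup>3)\<close>, where \<open>B\<close> is the integral of
\<open>\<bar>\<phi> t\<bar> / (t\<^sup>2 + \<eta>\<^sup>2)\<^sup>2\<close>. Up to constants, \<open>A * \<eta>\<^sup>2\<close> is at least \<open>\<eta>\<close> times the right derivative of \<open>\<phi>\<close> at \<open>\<eta>\<close>
(\<open>curvature_lower_bound\<close>) and \<open>B\<close> is at most the integral of \<open>\<phi> \<xi> / \<xi>\<^sup>4\<close> over \<open>\<xi> \<ge> \<eta>\<close>
(\<open>remainder_le_quartic_tail\<close>). So the growth hypothesis makes the cubic term negligible on an interval of many widths
\<open>1 / sqrt A\<close> (\<open>growth_gives_saddle\<close>). Outside this interval the inequality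
\<open>P x \<eta> - p \<eta> \<ge> A * (min \<bar>x\<bar> \<eta>)\<^sup>2 / 12\<close> (\<open>poisson_quadratic_growth\<close>) keeps the rest of the integral small, and
\<open>ln \<bar>g s\<bar> \<ge> - Q_fun M s - O(ln \<eta>)\<close> follows (\<open>near_extremal_lower_bound\<close>).

Conclusion. Both errors are \<open>O(ln \<eta>)\<close>. At the maximum, \<open>Q_fun M s = p \<eta> - \<eta> * s \<ge> \<phi> \<eta> / 50 - O(1)\<close>
(\<open>legendre_value_lower\<close>), and \<open>\<eta>\<close> tends to infinity as \<open>s\<close> tends to \<open>0\<close>. Since \<open>\<phi> t / ln t\<close> tends to infinity,
\<open>ln \<eta> = o(Q_fun M s)\<close>; and if \<open>\<phi> t \<ge> t powr a\<close> for large \<open>t\<close> with some \<open>a > 0\<close>, then \<open>ln \<eta> = O(ln (Q_fun M s))\<close>.\<close>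

section \<open>Bounded holomorphic functions and parameter integrals\<close>

text \<open>Dividing by \<open>1 - \<i> * k * (z - \<i> * e)\<close>, whose modulus is at least \<open>1\<close> above the line \<open>Im z = e\<close> and tends to
infinity, makes a bounded function small on large half-circles; the maximum principle for a half-disc applies, and then
\<open>k\<close> tends to \<open>0\<close>.\<close>

lemma half_plane_maximum_principle:
  fixes f :: "complex \<Rightarrow> complex"
  assumes hol: "f holomorphic_on {z. Im z > 0}" and e: "e > 0"
    and bdd: "\<And>z. Im z > 0 \<Longrightarrow> norm (f z) \<le> B"
    and line: "\<And>x. norm (f (Complex x e)) \<le> m" and m: "m > 0"
    and z: "Im z \<ge> e"
  shows "norm (f z) \<le> m"
proof -
  have damped: "norm (f z) \<le> m * norm (1 - \<i> * of_real k * (z - \<i> * of_real e))" if k: "k > 0" for k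
  proof -
    let ?d = "\<lambda>z. 1 - \<i> * of_real k * (z - \<i> * of_real e)"
    have re: "Re (?d w) = 1 + k * (Im w - e)" for w by (simp add: algebra_simps)
    have nz: "?d w \<noteq> 0" if "Im w \<ge> e" for w
      using re[of w] that k by (metis add_nonneg_pos add.commute diff_ge_0_iff_ge less_irrefl mult_nonneg_nonneg less_imp_le zero_complex.sel(1) zero_less_one)
    have d1: "norm (?d w) \<ge> 1" if "Im w \<ge> e" for w
    proof -
      have "1 \<le> Re (?d w)" using re[of w] that k by simp
      then show ?thesis using complex_Re_le_cmod[of "?d w"] by linarith
    qed
    have bdd0: "B \<ge> 0" using bdd[of "\<i>"] norm_ge_zero[of "f \<i>"] by (simp add: order_trans del: norm_ge_zero)
    \<comment> \<open>The radius is large enough for the half-disc to contain \<open>z\<close> and for the damping to beat the bound \<open>B\<close> on its arc.\<close>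
    define R where "R = max (norm (z - \<i> * of_real e) + 1) ((B / m + 1) / k)"
    have R: "R > 0" "k * R \<ge> B / m + 1" "norm (z - \<i> * of_real e) < R"
    proof -
      show R3: "norm (z - \<i> * of_real e) < R" unfolding R_def by linarith
      show "R > 0" using R3 norm_ge_zero[of "z - \<i> * of_real e"] by linarith
      have "(B / m + 1) / k \<le> R" by (simp add: R_def)
      then show "k * R \<ge> B / m + 1" using k by (simp add: pos_divide_le_eq mult.commute)
    qed
    define S where "S = {w. Im w > e} \<inter> ball (\<i> * of_real e) R"
    have oS: "open S" unfolding S_def by (intro open_Int open_halfspace_Im_gt open_ball)
    have sub: "closure S \<subseteq> {w. Im w \<ge> e} \<inter> cball (\<i> * of_real e) R"
      unfolding S_def by (rule closure_minimal) (auto intro!: closed_Int closed_halfspace_Im_ge)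
    have fr: "frontier S \<subseteq> {w. Im w = e} \<union> {w. Im w \<ge> e \<and> norm (w - \<i> * of_real e) = R}"
      using sub oS unfolding frontier_def interior_open[OF oS] 
      by (auto simp: S_def dist_norm norm_minus_commute)
    let ?g = "\<lambda>w. f w / ?d w"
    have holg: "?g holomorphic_on {w. Im w \<ge> e}"
    proof (intro holomorphic_on_divide holomorphic_intros)
      show "f holomorphic_on {w. Im w \<ge> e}" by (rule holomorphic_on_subset[OF hol]) (use e in auto)
    qed (use nz in auto)
    have bound: "norm (?g w) \<le> m" if wS: "w \<in> frontier S" for w
    proof -
      consider "Im w = e" | "Im w \<ge> e" "norm (w - \<i> * of_real e) = R" using fr wS by blast
      then show ?thesis
      proof cases
        case 1
        have w: "w = Complex (Re w) e" using 1 by (simp add: complex_eq_iff)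
        have "norm (f w) \<le> m" using line[of "Re w"] w by metis
        also have "m \<le> m * norm (?d w)" using d1[of w] 1 m by simp
        finally show ?thesis using d1[of w] 1 by (subst norm_divide, subst pos_divide_le_eq) auto
      next
        case 2
        have "norm (?d w) \<ge> norm (\<i> * of_real k * (w - \<i> * of_real e)) - 1"
          by (metis norm_minus_commute norm_one norm_triangle_ineq2)
        then have "norm (?d w) \<ge> k * R - 1" using 2 k by (simp add: norm_mult)
        then have "norm (?d w) \<ge> B / m" using R by linarith
        then have "B \<le> m * norm (?d w)" using m by (simp add: field_simps)
        then have "norm (f w) \<le> m * norm (?d w)" using bdd[of w] 2 e by force
        then show ?thesis using d1[of w] 2 by (subst norm_divide, subst pos_divide_le_eq) auto
      qed
    qed
    have "norm (?g z) \<le> m"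
    proof (cases "Im z = e")
      case True
      have w: "z = Complex (Re z) e" using True by (simp add: complex_eq_iff)
      have "norm (f z) \<le> m" using line[of "Re z"] w by metis
      also have "m \<le> m * norm (?d z)" using d1[of z] True m by simp
      finally show ?thesis using d1[of z] True by (subst norm_divide, subst pos_divide_le_eq) auto
    next
      case False
      show ?thesis
      proof (rule maximum_modulus_frontier[of ?g S])
        show "?g holomorphic_on interior S"
          by (rule holomorphic_on_subset[OF holg]) (use interior_subset[of S] in \<open>auto simp: S_def\<close>)
        show "continuous_on (closure S) ?g"
          by (rule holomorphic_on_imp_continuous_on, rule holomorphic_on_subset[OF holg]) (use sub in auto)
        show "bounded S" unfolding S_def by (rule bounded_subset[OF bounded_ball]) auto
        show "z \<in> S" using False z R by (auto simp: S_def dist_norm norm_minus_commute)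
      qed (use bound in auto)
    qed
    then show ?thesis using d1[OF z] by (subst (asm) norm_divide, subst (asm) pos_divide_le_eq) auto
  qed
  have "((\<lambda>k. m * norm (1 - \<i> * of_real k * (z - \<i> * of_real e))) \<longlongrightarrow> m * norm (1 - \<i> * of_real 0 * (z - \<i> * of_real e))) (at_right 0)"
    by (intro tendsto_intros)
  then have "((\<lambda>k. m * norm (1 - \<i> * of_real k * (z - \<i> * of_real e))) \<longlongrightarrow> m) (at_right 0)" by simp
  then show ?thesis
    by (rule tendsto_lowerbound) (use damped in \<open>auto simp: eventually_at_right_less eventually_at_filter\<close>)
qed

text \<open>Cauchy's inequality turns the local domination of \<open>f\<close> into a domination of the difference quotients, so the
derivative passes under the integral by dominated convergence.\<close>

lemma holomorphic_parameter_integral: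
  fixes f :: "'a \<Rightarrow> complex \<Rightarrow> complex"
  assumes S: "open S" and hol: "\<And>t. f t holomorphic_on S"
    and meas: "\<And>z. z \<in> S \<Longrightarrow> (\<lambda>t. f t z) \<in> borel_measurable M"
    and dom: "\<And>z. z \<in> S \<Longrightarrow> \<exists>r>0. \<exists>B. cball z r \<subseteq> S \<and> integrable M B \<and> (\<forall>t. \<forall>w\<in>cball z r. norm (f t w) \<le> B t)"
  shows "(\<lambda>z. \<integral>t. f t z \<partial>M) holomorphic_on S"
    and "\<And>z. z \<in> S \<Longrightarrow> ((\<lambda>z. \<integral>t. f t z \<partial>M) has_field_derivative (\<integral>t. deriv (f t) z \<partial>M)) (at z)"
proof -
  show der: "((\<lambda>z. \<integral>t. f t z \<partial>M) has_field_derivative (\<integral>t. deriv (f t) z \<partial>M)) (at z)" if z: "z \<in> S" for z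
  proof -
    obtain r B where r: "r > 0" "cball z r \<subseteq> S" and B: "integrable M B"
      and fB: "\<And>t w. w \<in> cball z r \<Longrightarrow> norm (f t w) \<le> B t" using dom[OF z] by blast
    have int: "integrable M (\<lambda>t. f t w)" if "w \<in> cball z r" for w
      by (rule Bochner_Integration.integrable_bound[OF B]) (use fB[OF that] meas r(2) that in \<open>auto intro!: AE_I2 intro: order_trans[OF _ abs_ge_self]\<close>)
    have derb: "norm (deriv (f t) w) \<le> B t / (r/2)" if w: "w \<in> ball z (r/2)" for t w
    proof -
      have sub: "cball w (r/2) \<subseteq> cball z r"
      proof
        fix u assume "u \<in> cball w (r/2)"
        then show "u \<in> cball z r" using w dist_triangle[of z u w] by (auto simp: dist_commute)
      qed
      have "norm ((deriv ^^ 1) (f t) w) \<le> fact 1 * B t / (r/2) ^ 1"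
      proof (rule Cauchy_inequality)
        show "f t holomorphic_on ball w (r/2)"
          by (rule holomorphic_on_subset[OF hol[of t]]) (use sub r ball_subset_cball[of w "r/2"] in blast)
        show "continuous_on (cball w (r/2)) (f t)"
          by (rule holomorphic_on_imp_continuous_on, rule holomorphic_on_subset[OF hol[of t]]) (use sub r in auto)
        show "norm (f t x) \<le> B t" if "norm (w - x) = r/2" for x
          by (rule fB, rule set_mp[OF sub]) (use that in \<open>auto simp: dist_norm\<close>)
      qed (use r in auto)
      then show ?thesis by simp
    qed
    have lip: "norm (f t w - f t z) \<le> B t / (r/2) * norm (w - z)" if w: "w \<in> ball z (r/2)" for t w
    proof (rule field_differentiable_bound[OF convex_ball[of z "r/2"]])
      fix u assume u: "u \<in> ball z (r/2)"
      have "u \<in> S" using u r by (auto simp: dist_norm)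
      then have "f t field_differentiable at u" using hol[of t] S holomorphic_on_imp_differentiable_at by blast
      then show "(f t has_field_derivative deriv (f t) u) (at u within ball z (r/2))"
        by (meson DERIV_deriv_iff_field_differentiable has_field_derivative_at_within)
      show "norm (deriv (f t) u) \<le> B t / (r/2)" by (rule derb[OF u])
    qed (use w r in auto)
    show ?thesis unfolding has_field_derivative_iff
    proof (subst tendsto_at_iff_sequentially, intro allI impI)
      fix X assume X: "\<forall>i. X i \<in> UNIV - {z}" "X \<longlonglongrightarrow> z"
      have "\<forall>\<^sub>F n in sequentially. X n \<in> ball z (r/2)"
        by (rule topological_tendstoD[OF X(2)]) (use r in auto)
      then obtain N where N: "\<And>n. n \<ge> N \<Longrightarrow> X n \<in> ball z (r/2)" unfolding eventually_sequentially by blast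
      \<comment> \<open>The difference quotients are dominated only near \<open>z\<close>, so the beginning of the sequence is cut off.\<close>
      define Y where "Y n = X (n + N)" for n
      have Y: "\<And>n. Y n \<in> ball z (r/2)" "\<And>n. Y n \<noteq> z" "Y \<longlonglongrightarrow> z"
        using N X LIMSEQ_ignore_initial_segment[OF X(2), of N] by (auto simp: Y_def[abs_def])
      have Yr: "Y n \<in> cball z r" for n using Y(1)[of n] r by auto
      have lim: "(\<lambda>n. (f t (Y n) - f t z) / (Y n - z)) \<longlonglongrightarrow> deriv (f t) z" for t
      proof -
        have "f t field_differentiable at z" using hol[of t] S z holomorphic_on_imp_differentiable_at by blast
        then have "((\<lambda>y. (f t y - f t z) / (y - z)) \<longlongrightarrow> deriv (f t) z) (at z)"
          by (simp add: DERIV_deriv_iff_field_differentiable[symmetric] has_field_derivative_iff)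
        then show ?thesis using Y by (auto simp: tendsto_at_iff_sequentially comp_def)
      qed
      have zr: "z \<in> cball z r" using r by simp
      have "(\<lambda>n. \<integral>t. (f t (Y n) - f t z) / (Y n - z) \<partial>M) \<longlonglongrightarrow> (\<integral>t. deriv (f t) z \<partial>M)"
      proof (rule integral_dominated_convergence)
        show m: "(\<lambda>t. (f t (Y n) - f t z) / (Y n - z)) \<in> borel_measurable M" for n
          using int[OF Yr[of n]] int[OF zr]
          by (intro borel_measurable_divide borel_measurable_diff borel_measurable_const) auto
        show "(\<lambda>t. deriv (f t) z) \<in> borel_measurable M"
          by (rule borel_measurable_LIMSEQ_metric[of "\<lambda>n t. (f t (Y n) - f t z) / (Y n - z)", OF m]) (rule lim)
        show "integrable M (\<lambda>t. B t / (r/2))" using B by auto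
        show "AE t in M. norm ((f t (Y n) - f t z) / (Y n - z)) \<le> B t / (r/2)" for n
          using lip[OF Y(1)[of n]] Y(2)[of n] by (auto simp: norm_divide divide_le_eq)
      qed (use lim in auto)
      also have "(\<lambda>n. \<integral>t. (f t (Y n) - f t z) / (Y n - z) \<partial>M) = (\<lambda>n. ((\<integral>t. f t (Y n) \<partial>M) - (\<integral>t. f t z \<partial>M)) / (Y n - z))"
        using Bochner_Integration.integral_diff[OF int[OF Yr] int[OF zr]] by (simp only: Bochner_Integration.integral_divide_zero)
      finally have "(\<lambda>n. ((\<lambda>w. ((\<integral>t. f t w \<partial>M) - (\<integral>t. f t z \<partial>M)) / (w - z)) \<circ> X) (n + N)) \<longlonglongrightarrow> (\<integral>t. deriv (f t) z \<partial>M)"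
        by (simp add: Y_def comp_def)
      then show "((\<lambda>w. ((\<integral>t. f t w \<partial>M) - (\<integral>t. f t z \<partial>M)) / (w - z)) \<circ> X) \<longlonglongrightarrow> (\<integral>t. deriv (f t) z \<partial>M)"
        by (rule LIMSEQ_offset)
    qed
  qed
  show "(\<lambda>z. \<integral>t. f t z \<partial>M) holomorphic_on S"
    unfolding holomorphic_on_open[OF S] using der by blast
qed

section \<open>Improper integrals on the real line\<close>

text \<open>The integrand may change sign or be complex, so integrability over the half-line is a hypothesis here; for a
nonnegative integrand it follows from the convergence of the antiderivative, as in the next lemma.\<close>

lemma set_integral_FTC_atLeast:
  fixes f :: "real \<Rightarrow> 'a :: euclidean_space"
  assumes int: "set_integrable lborel {a..} f"
    and F: "\<And>x. a \<le> x \<Longrightarrow> (F has_vector_derivative f x) (at x)"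
    and f: "continuous_on {a..} f" and lim: "(F \<longlongrightarrow> T) at_top"
  shows "(LINT x:{a..}|lborel. f x) = T - F a"
proof -
  have "((\<lambda>b. LINT x:{a..b}|lborel. f x) \<longlongrightarrow> (LINT x:{a..}|lborel. f x)) at_top"
    by (rule tendsto_set_lebesgue_integral_at_top[OF _ int]) auto
  moreover have "\<forall>\<^sub>F b in at_top. (LINT x:{a..b}|lborel. f x) = F b - F a"
    using eventually_ge_at_top[of a]
  proof eventually_elim
    case (elim b)
    show ?case unfolding set_lebesgue_integral_def
      by (rule integral_FTC_atLeastAtMost[OF elim])
        (auto intro: has_vector_derivative_at_within F continuous_on_subset[OF f])
  qed
  ultimately have "((\<lambda>b. F b - F a) \<longlongrightarrow> (LINT x:{a..}|lborel. f x)) at_top"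
    by (rule Lim_transform_eventually)
  moreover have "((\<lambda>b. F b - F a) \<longlongrightarrow> T - F a) at_top" by (intro tendsto_intros lim)
  ultimately show ?thesis by (rule tendsto_unique[OF trivial_limit_at_top_linorder])
qed

lemma set_integral_FTC_atLeast_nonneg:
  fixes f :: "real \<Rightarrow> real"
  assumes [measurable]: "f \<in> borel_measurable borel"
    and F: "\<And>x. a \<le> x \<Longrightarrow> (F has_real_derivative f x) (at x)"
    and nonneg: "\<And>x. a \<le> x \<Longrightarrow> 0 \<le> f x" and lim: "(F \<longlongrightarrow> T) at_top"
  shows "set_integrable lborel {a..} f" "(LINT x:{a..}|lborel. f x) = T - F a"
proof -
  have nn: "(\<integral>\<^sup>+x. ennreal (f x) * indicator {a..} x \<partial>lborel) = T - F a"
    by (rule nn_integral_FTC_atLeast) fact+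
  have mono: "F a \<le> F x" if "x \<ge> a" for x
    using that by (rule DERIV_nonneg_imp_nondecreasing) (use F nonneg in blast)
  have "F a \<le> T"
    by (rule tendsto_lowerbound[OF lim _ trivial_limit_at_top_linorder]) 
       (use mono in \<open>auto simp: eventually_at_top_linorder\<close>)
  have eq: "(\<integral>\<^sup>+x. ennreal (indicator {a..} x *\<^sub>R f x) \<partial>lborel) = T - F a"
    unfolding nn[symmetric] by (intro nn_integral_cong) (auto simp: indicator_def)
  have "has_bochner_integral lborel (\<lambda>x. indicator {a..} x *\<^sub>R f x) (T - F a)"
    by (rule has_bochner_integral_nn_integral[OF _ _ _ eq]) (use nonneg \<open>F a \<le> T\<close> in \<open>auto simp: indicator_def\<close>)
  then show "set_integrable lborel {a..} f" "(LINT x:{a..}|lborel. f x) = T - F a"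
    by (auto simp: set_integrable_def set_lebesgue_integral_def has_bochner_integral_iff)
qed

lemma even_integral_lborel:
  fixes f :: "real \<Rightarrow> 'a :: euclidean_space"
  assumes even: "\<And>x. f (- x) = f x" and int: "set_integrable lborel {0..} f"
  shows "integrable lborel f" "integral\<^sup>L lborel f = 2 *\<^sub>R (LINT x:{0..}|lborel. f x)"
proof -
  let ?g = "\<lambda>x. indicator {0..} x *\<^sub>R f x"
  have g: "integrable lborel ?g" using int by (simp add: set_integrable_def)
  have g': "integrable lborel (\<lambda>x. ?g (0 + (-1) * x))"
    by (rule lborel_integrable_real_affine[OF g]) simp
  have eqi: "integral\<^sup>L lborel (\<lambda>x. ?g (0 + (-1) * x)) = integral\<^sup>L lborel ?g"
    using lborel_integral_real_affine[of "-1" ?g 0] by simp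
  have ae: "AE x in lborel. f x = ?g x + ?g (0 + (-1) * x)"
    using AE_lborel_singleton[of 0] by eventually_elim (auto simp: even indicator_def)
  have h: "has_bochner_integral lborel (\<lambda>x. ?g x + ?g (0 + (-1) * x)) (integral\<^sup>L lborel ?g + integral\<^sup>L lborel ?g)"
    by (intro has_bochner_integral_add) (use g g' eqi in \<open>auto simp: has_bochner_integral_iff\<close>)
  have m: "f \<in> borel_measurable lborel"
  proof -
    have "(\<lambda>x. if x = 0 then f 0 else ?g x + ?g (0 + (-1) * x)) \<in> borel_measurable lborel"
      using g g' by (intro measurable_If) auto
    also have "(\<lambda>x. if x = 0 then f 0 else ?g x + ?g (0 + (-1) * x)) = f"
      by (auto simp: even indicator_def fun_eq_iff)
    finally show ?thesis .
  qed
  have "has_bochner_integral lborel f (integral\<^sup>L lborel ?g + integral\<^sup>L lborel ?g)"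
    using h by (subst has_bochner_integral_cong_AE[OF m _ ae]) (auto simp: has_bochner_integral_iff)
  then show "integrable lborel f" "integral\<^sup>L lborel f = 2 *\<^sub>R (LINT x:{0..}|lborel. f x)"
    by (auto simp: has_bochner_integral_iff set_lebesgue_integral_def scaleR_2)
qed

lemma integrable_cauchy: "integrable lborel (\<lambda>t::real. 1 / (1 + t\<^sup>2))"
  and integral_cauchy: "(\<integral>t. 1 / (1 + (t::real)\<^sup>2) \<partial>lborel) = pi"
proof -
  have d: "(arctan has_real_derivative 1 / (1 + t\<^sup>2)) (at t)" for t
    using DERIV_arctan[of t] by (simp add: inverse_eq_divide)
  have m: "(\<lambda>t::real. 1 / (1 + t\<^sup>2)) \<in> borel_measurable borel" by measurable
  have i: "set_integrable lborel {0::real..} (\<lambda>t. 1 / (1 + t\<^sup>2))"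
    by (rule set_integral_FTC_atLeast_nonneg(1)[OF m d _ tendsto_arctan_at_top]) simp
  have "(LINT t:{0::real..}|lborel. 1 / (1 + t\<^sup>2)) = pi/2 - arctan 0"
    by (rule set_integral_FTC_atLeast_nonneg(2)[OF m d _ tendsto_arctan_at_top]) simp
  with i even_integral_lborel[of "\<lambda>t::real. 1 / (1 + t\<^sup>2)"]
  show "integrable lborel (\<lambda>t::real. 1 / (1 + t\<^sup>2))" "(\<integral>t. 1 / (1 + (t::real)\<^sup>2) \<partial>lborel) = pi"
    by auto
qed

section \<open>Poisson and Schwarz integrals\<close>

text \<open>The condition under which the Poisson integral of \<open>\<phi>\<close> converges in the upper half-plane.\<close>

definition log_integrable :: "(real \<Rightarrow> real) \<Rightarrow> bool" where
  "log_integrable \<phi> \<longleftrightarrow> integrable lborel (\<lambda>t. \<phi> t / (1 + t\<^sup>2))"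

lemma log_integrable_measurable: "log_integrable \<phi> \<Longrightarrow> \<phi> \<in> borel_measurable borel"
proof -
  assume "log_integrable \<phi>"
  then have "(\<lambda>t. \<phi> t / (1 + t\<^sup>2)) \<in> borel_measurable borel"
    unfolding log_integrable_def by (auto dest: borel_measurable_integrable)
  then have "(\<lambda>t. \<phi> t / (1 + t\<^sup>2) * (1 + t\<^sup>2)) \<in> borel_measurable borel" by measurable
  also have "(\<lambda>t. \<phi> t / (1 + t\<^sup>2) * (1 + t\<^sup>2)) = \<phi>"
    by (auto simp: fun_eq_iff divide_simps add_nonneg_eq_0_iff)
  finally show ?thesis .
qed

text \<open>The source of nearly all integrability statements below: the kernels are \<open>O(1 / (1 + t\<^sup>2))\<close>.\<close>

lemma log_integrable_times_kernel:
  fixes k :: "real \<Rightarrow> 'a :: {banach, real_normed_algebra, second_countable_topology}"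
  assumes \<phi>: "log_integrable \<phi>" and k: "k \<in> borel_measurable borel"
    and bound: "\<And>t. norm (k t) \<le> C / (1 + t\<^sup>2)"
  shows "integrable lborel (\<lambda>t. \<phi> t *\<^sub>R k t)"
proof (rule Bochner_Integration.integrable_bound)
  show "integrable lborel (\<lambda>t. C * (\<phi> t / (1 + t\<^sup>2)))"
    using \<phi> unfolding log_integrable_def by (rule integrable_mult_right)
  show "(\<lambda>t. \<phi> t *\<^sub>R k t) \<in> borel_measurable lborel"
    using log_integrable_measurable[OF \<phi>] k by measurable
  have "\<bar>\<phi> t\<bar> * norm (k t) \<le> \<bar>\<phi> t\<bar> * \<bar>C / (1 + t\<^sup>2)\<bar>" for t
    using order_trans[OF bound[of t] abs_ge_self] by (intro mult_left_mono) auto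
  then show "AE t in lborel. norm (\<phi> t *\<^sub>R k t) \<le> norm (C * (\<phi> t / (1 + t\<^sup>2)))"
    by (auto simp: abs_mult mult.commute)
qed

lemma bounded_log_integrable:
  assumes "\<phi> \<in> borel_measurable borel" "\<And>t. \<bar>\<phi> t\<bar> \<le> B"
  shows "log_integrable \<phi>"
  unfolding log_integrable_def
  by (rule Bochner_Integration.integrable_bound[OF integrable_mult_right[OF integrable_cauchy, of B]])
     (use assms in \<open>auto intro!: divide_right_mono AE_I2 order_trans[OF assms(2) abs_ge_self]\<close>)

lemma log_integrable_add: "log_integrable f \<Longrightarrow> log_integrable g \<Longrightarrow> log_integrable (\<lambda>t. f t + g t)"
  unfolding log_integrable_def by (simp add: add_divide_distrib)

lemma log_integrable_abs: "log_integrable f \<Longrightarrow> log_integrable (\<lambda>t. \<bar>f t\<bar>)"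
  unfolding log_integrable_def by (drule integrable_abs) (simp add: abs_divide)

lemma one_plus_sq_le:
  fixes t x y :: real
  assumes "y > 0" and C: "C \<ge> 2" "C * y\<^sup>2 \<ge> 1 + 2 * x\<^sup>2"
  shows "1 + t\<^sup>2 \<le> C * ((t - x)\<^sup>2 + y\<^sup>2)"
proof -
  have "t\<^sup>2 \<le> 2 * (t - x)\<^sup>2 + 2 * x\<^sup>2"
    using zero_le_power2[of "t - 2 * x"] by (simp add: power2_eq_square algebra_simps)
  moreover have "2 * (t - x)\<^sup>2 \<le> C * (t - x)\<^sup>2" by (intro mult_right_mono C) simp
  ultimately show ?thesis using C by (simp add: algebra_simps)
qed

definition poisson_kernel :: "real \<Rightarrow> real \<Rightarrow> real \<Rightarrow> real" where
  "poisson_kernel x y t = y / pi / ((t - x)\<^sup>2 + y\<^sup>2)"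

text \<open>The value at \<open>x + \<i> * y\<close> of the Poisson integral of \<open>\<phi>\<close> in the upper half-plane.\<close>

definition poisson :: "(real \<Rightarrow> real) \<Rightarrow> real \<Rightarrow> real \<Rightarrow> real" where
  "poisson \<phi> x y = (\<integral>t. \<phi> t * poisson_kernel x y t \<partial>lborel)"

text \<open>The usual Schwarz kernel \<open>1 / (\<pi> * \<i> * (t - z))\<close>, symmetrised in \<open>t\<close>. For even functions nothing changes, and the
symmetrised kernel is \<open>O(1 / t\<^sup>2)\<close>, so no subtraction is needed for convergence.\<close>

definition schwarz_kernel :: "complex \<Rightarrow> real \<Rightarrow> complex" where
  "schwarz_kernel z t = z / (of_real pi * \<i> * (of_real (t\<^sup>2) - z\<^sup>2))"

definition schwarz :: "(real \<Rightarrow> real) \<Rightarrow> complex \<Rightarrow> complex" where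
  "schwarz \<phi> z = (\<integral>t. of_real (\<phi> t) * schwarz_kernel z t \<partial>lborel)"

lemma poisson_kernel_measurable[measurable]: "poisson_kernel x y \<in> borel_measurable borel"
  unfolding poisson_kernel_def by measurable

lemma poisson_kernel_pos: "y > 0 \<Longrightarrow> poisson_kernel x y t > 0"
  unfolding poisson_kernel_def by (intro divide_pos_pos add_nonneg_pos) auto

lemma poisson_kernel_bound: assumes y: "y > 0" shows "\<exists>C. \<forall>t. norm (poisson_kernel x y t) \<le> C / (1 + t\<^sup>2)"
proof -
  define C where "C = max 2 ((1 + 2 * x\<^sup>2) / y\<^sup>2)"
  have "(1 + 2 * x\<^sup>2) / y\<^sup>2 \<le> C" unfolding C_def by simp
  then have C: "C * y\<^sup>2 \<ge> 1 + 2 * x\<^sup>2" using y by (simp add: pos_divide_le_eq)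
  have C2: "C \<ge> 2" by (simp add: C_def)
  have "norm (poisson_kernel x y t) \<le> (y / pi * C) / (1 + t\<^sup>2)" for t
  proof -
    have pos: "(t - x)\<^sup>2 + y\<^sup>2 > 0" "1 + t\<^sup>2 > 0" using y by (auto intro: add_nonneg_pos add_pos_nonneg)
    have "1 / ((t - x)\<^sup>2 + y\<^sup>2) \<le> C / (1 + t\<^sup>2)"
      using one_plus_sq_le[OF y C2 C, of t] pos by (simp add: divide_simps mult.commute)
    then have "y / pi * (1 / ((t - x)\<^sup>2 + y\<^sup>2)) \<le> y / pi * (C / (1 + t\<^sup>2))"
      using y by (intro mult_left_mono) auto
    then show ?thesis using poisson_kernel_pos[OF y, of x t] by (simp add: poisson_kernel_def)
  qed
  then show ?thesis by blast
qed

lemma poisson_integrable: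
  assumes "log_integrable \<phi>" "y > 0" shows "integrable lborel (\<lambda>t. \<phi> t * poisson_kernel x y t)"
proof -
  obtain C where "\<And>t. norm (poisson_kernel x y t) \<le> C / (1 + t\<^sup>2)" using poisson_kernel_bound[OF assms(2)] by blast
  from log_integrable_times_kernel[OF assms(1) poisson_kernel_measurable this] show ?thesis by simp
qed

text \<open>The substitution \<open>t = x + y * u\<close>: the Poisson integral is an average of \<open>\<phi>\<close> over a Cauchy distribution with centre \<open>x\<close>
and scale \<open>y\<close>.\<close>

lemma poisson_affine:
  assumes "y > 0"
  shows "poisson \<phi> x y = (\<integral>u. \<phi> (x + y * u) / (1 + u\<^sup>2) \<partial>lborel) / pi"
proof -
  have "poisson \<phi> x y = \<bar>y\<bar> *\<^sub>R (\<integral>u. \<phi> (x + y * u) * poisson_kernel x y (x + y * u) \<partial>lborel)"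
    unfolding poisson_def using assms by (subst lborel_integral_real_affine[where t = x and c = y]) auto
  also have "\<dots> = (\<integral>u. y * (\<phi> (x + y * u) * poisson_kernel x y (x + y * u)) \<partial>lborel)" using assms by simp
  also have "\<dots> = (\<integral>u. (\<phi> (x + y * u) / (1 + u\<^sup>2)) / pi \<partial>lborel)"
  proof (rule Bochner_Integration.integral_cong)
    fix u :: real
    have e: "(y * u)\<^sup>2 + y\<^sup>2 = y\<^sup>2 * (1 + u\<^sup>2)" by (simp add: algebra_simps power_mult_distrib)
    have "1 + u\<^sup>2 > 0" by (simp add: add_pos_nonneg)
    then show "y * (\<phi> (x + y * u) * poisson_kernel x y (x + y * u)) = (\<phi> (x + y * u) / (1 + u\<^sup>2)) / pi"
      using assms by (simp add: poisson_kernel_def e) (simp add: power2_eq_square)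
  qed simp
  finally show ?thesis by (simp only: Bochner_Integration.integral_divide_zero)
qed

lemma poisson_kernel_integral: assumes "y > 0" shows "integrable lborel (poisson_kernel x y)" "(\<integral>t. poisson_kernel x y t \<partial>lborel) = 1"
proof -
  have "log_integrable (\<lambda>_. 1)" by (rule bounded_log_integrable[of _ 1]) auto
  from poisson_integrable[OF this assms, of x] show "integrable lborel (poisson_kernel x y)" by simp
  have "(\<integral>t. poisson_kernel x y t \<partial>lborel) = poisson (\<lambda>_. 1) x y" by (simp add: poisson_def)
  also have "\<dots> = 1" using assms by (subst poisson_affine) (simp_all add: integral_cauchy)
  finally show "(\<integral>t. poisson_kernel x y t \<partial>lborel) = 1" .
qed

lemma poisson_mono:
  assumes "log_integrable \<phi>" "log_integrable \<psi>" "y > 0" "\<And>t. \<phi> t \<le> \<psi> t"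
  shows "poisson \<phi> x y \<le> poisson \<psi> x y"
  unfolding poisson_def
proof (rule integral_mono)
  show "\<phi> t * poisson_kernel x y t \<le> \<psi> t * poisson_kernel x y t" for t
    using assms(4)[of t] poisson_kernel_pos[OF assms(3), of x t] by (intro mult_right_mono) auto
qed (use assms poisson_integrable in auto)

lemma poisson_uminus_arg:
  assumes "\<And>t. \<phi> (- t) = \<phi> t" shows "poisson \<phi> (- x) y = poisson \<phi> x y"
  unfolding poisson_def
  by (subst lborel_integral_real_affine[where t = 0 and c = "-1"])
     (auto simp: assms poisson_kernel_def power2_eq_square algebra_simps)

text \<open>In the average over \<open>x + y * u\<close> the part \<open>\<bar>u\<bar> < N\<close> differs little from \<open>\<psi> x\<close> by uniform continuity, and the Cauchy
distribution gives little mass to \<open>\<bar>u\<bar> \<ge> N\<close>.\<close>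

lemma poisson_boundary_uniform:
  assumes uc: "uniformly_continuous_on UNIV \<psi>" and B: "\<And>t. \<bar>\<psi> t\<bar> \<le> B" and e: "e > 0"
  shows "\<exists>d>0. \<forall>y x. 0 < y \<and> y < d \<longrightarrow> \<bar>poisson \<psi> x y - \<psi> x\<bar> \<le> e"
proof -
  have m[measurable]: "\<psi> \<in> borel_measurable borel"
    by (intro borel_measurable_continuous_onI uniformly_continuous_imp_continuous uc)
  have B0: "B \<ge> 0" using B[of 0] by linarith
  let ?tail = "\<lambda>N::nat. \<integral>u. (if \<bar>u\<bar> \<ge> real N then 1 / (1 + u\<^sup>2) else 0) \<partial>lborel"
  have "?tail \<longlonglongrightarrow> (\<integral>u. 0 \<partial>(lborel :: real measure))"
  proof (rule integral_dominated_convergence[where w = "\<lambda>u. 1 / (1 + u\<^sup>2)"])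
    show "AE u in (lborel :: real measure). (\<lambda>i. if real i \<le> \<bar>u\<bar> then 1 / (1 + u\<^sup>2) else 0) \<longlonglongrightarrow> 0"
    proof (rule AE_I2)
      fix u :: real
      obtain n where "\<bar>u\<bar> < real n" using reals_Archimedean2 by blast
      then have "\<forall>\<^sub>F i in sequentially. (if real i \<le> \<bar>u\<bar> then 1 / (1 + u\<^sup>2) else 0) = 0"
        unfolding eventually_sequentially by (intro exI[of _ n]) auto
      then show "(\<lambda>i. if real i \<le> \<bar>u\<bar> then 1 / (1 + u\<^sup>2) else 0) \<longlonglongrightarrow> 0"
        by (rule tendsto_eventually)
    qed
  qed (use integrable_cauchy in auto)
  then have "?tail \<longlonglongrightarrow> 0" by simp
  then have "\<forall>\<^sub>F N in sequentially. ?tail N < e / (2 * B + 1)"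
    by (rule order_tendstoD) (use e B0 in auto)
  then obtain N where N: "?tail N < e / (2 * B + 1)"
    using eventually_happens'[OF sequentially_bot] by blast
  have e2: "e / 2 > 0" using e by simp
  obtain d where d: "d > 0" "\<And>s t. \<bar>s - t\<bar> < d \<Longrightarrow> \<bar>\<psi> s - \<psi> t\<bar> < e / 2"
    by (rule uniformly_continuous_onE[OF uc e2]) (simp add: dist_real_def abs_minus_commute)
  have "\<bar>poisson \<psi> x y - \<psi> x\<bar> \<le> e" if y: "0 < y" "y < d / (real N + 1)" for x y
  proof -
    have int1: "integrable lborel (\<lambda>u. \<psi> (x + y * u) / (1 + u\<^sup>2))"
    proof -
      have "log_integrable (\<lambda>u. \<psi> (x + y * u))" by (rule bounded_log_integrable[of _ B]) (use B in auto)
      then show ?thesis by (simp add: log_integrable_def)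
    qed
    have int2: "integrable lborel (\<lambda>u. \<psi> x / (1 + u\<^sup>2))"
      using integrable_mult_right[OF integrable_cauchy, of "\<psi> x"] by simp
    have "(\<integral>u. \<psi> x / (1 + u\<^sup>2) \<partial>lborel) = \<psi> x * pi"
      using integral_cauchy Bochner_Integration.integral_mult_right_zero[of lborel "\<psi> x" "\<lambda>u. 1 / (1 + u\<^sup>2)"] by simp
    then have "poisson \<psi> x y - \<psi> x = (\<integral>u. \<psi> (x + y * u) / (1 + u\<^sup>2) - \<psi> x / (1 + u\<^sup>2) \<partial>lborel) / pi"
      using poisson_affine[OF y(1), of \<psi> x] int1 int2 by (simp add: Bochner_Integration.integral_diff diff_divide_distrib)
    then have eq: "pi * \<bar>poisson \<psi> x y - \<psi> x\<bar> = \<bar>\<integral>u. \<psi> (x + y * u) / (1 + u\<^sup>2) - \<psi> x / (1 + u\<^sup>2) \<partial>lborel\<bar>"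
      by (simp add: abs_divide)
    let ?t = "\<lambda>u::real. if \<bar>u\<bar> \<ge> real N then 1 / (1 + u\<^sup>2) else 0"
    have intt: "integrable lborel ?t"
      by (rule Bochner_Integration.integrable_bound[OF integrable_cauchy]) auto
    have "\<bar>\<integral>u. \<psi> (x + y * u) / (1 + u\<^sup>2) - \<psi> x / (1 + u\<^sup>2) \<partial>lborel\<bar>
        \<le> (\<integral>u. \<bar>\<psi> (x + y * u) / (1 + u\<^sup>2) - \<psi> x / (1 + u\<^sup>2)\<bar> \<partial>lborel)"
      by (rule integral_abs_bound)
    also have "\<dots> \<le> (\<integral>u. (e/2) * (1 / (1 + u\<^sup>2)) + (2 * B) * ?t u \<partial>lborel)"
    proof (rule integral_mono)
      show "integrable lborel (\<lambda>u. \<bar>\<psi> (x + y * u) / (1 + u\<^sup>2) - \<psi> x / (1 + u\<^sup>2)\<bar>)"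
        using int1 int2 by auto
      show "integrable lborel (\<lambda>u. (e/2) * (1 / (1 + u\<^sup>2)) + (2 * B) * ?t u)"
        by (intro Bochner_Integration.integrable_add integrable_mult_right integrable_cauchy intt)
      fix u :: real
      have p: "1 + u\<^sup>2 > 0" by (simp add: add_pos_nonneg)
      have "\<bar>\<psi> (x + y * u) / (1 + u\<^sup>2) - \<psi> x / (1 + u\<^sup>2)\<bar> = \<bar>\<psi> (x + y * u) - \<psi> x\<bar> / (1 + u\<^sup>2)"
        using p by (subst diff_divide_distrib[symmetric]) (simp only: abs_divide abs_of_pos)
      also have "\<dots> \<le> (e/2) * (1 / (1 + u\<^sup>2)) + (2 * B) * ?t u"
      proof (cases "\<bar>u\<bar> \<ge> real N")
        case True
        have "\<bar>\<psi> (x + y * u) - \<psi> x\<bar> \<le> 2 * B" using B[of "x + y * u"] B[of x] by linarith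
        then have "\<bar>\<psi> (x + y * u) - \<psi> x\<bar> / (1 + u\<^sup>2) \<le> (2 * B) / (1 + u\<^sup>2)"
          using p by (intro divide_right_mono) auto
        moreover have "(e/2) * (1 / (1 + u\<^sup>2)) \<ge> 0" using e p by simp
        ultimately show ?thesis using True by simp
      next
        case False
        have "y * \<bar>u\<bar> \<le> d / (real N + 1) * \<bar>u\<bar>" using y by (intro mult_right_mono) auto
        also have "\<dots> < d" using False d(1) by (simp add: divide_simps)
        finally have "\<bar>y * u\<bar> < d" using y(1) by (simp add: abs_mult)
        then have "\<bar>\<psi> (x + y * u) - \<psi> x\<bar> \<le> e / 2" using d(2)[of "x + y * u" x] by simp
        then have "\<bar>\<psi> (x + y * u) - \<psi> x\<bar> / (1 + u\<^sup>2) \<le> (e / 2) / (1 + u\<^sup>2)"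
          using p by (intro divide_right_mono) auto
        then show ?thesis using False by simp
      qed
      finally show "\<bar>\<psi> (x + y * u) / (1 + u\<^sup>2) - \<psi> x / (1 + u\<^sup>2)\<bar> \<le> (e/2) * (1 / (1 + u\<^sup>2)) + (2 * B) * ?t u" .
    qed
    also have "\<dots> = (\<integral>u. (e/2) * (1 / (1 + u\<^sup>2)) \<partial>lborel) + (\<integral>u. (2 * B) * ?t u \<partial>lborel)"
      by (intro Bochner_Integration.integral_add integrable_mult_right integrable_cauchy intt)
    also have "\<dots> = (e/2) * pi + (2 * B) * ?tail N"
      by (subst (1 2) Bochner_Integration.integral_mult_right_zero) (simp only: integral_cauchy)
    also have "\<dots> \<le> (e/2) * pi + e"
    proof -
      have "(2 * B) * ?tail N \<le> (2 * B) * (e / (2 * B + 1))" using N B0 by (intro mult_left_mono) auto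
      also have "\<dots> \<le> e" using B0 e by (simp add: divide_simps)
      finally show ?thesis by simp
    qed
    also have "\<dots> \<le> pi * e" using e pi_gt3 by (simp add: field_simps)
    finally have "pi * \<bar>poisson \<psi> x y - \<psi> x\<bar> \<le> pi * e" using eq by simp
    then show ?thesis by simp
  qed
  then show ?thesis by (intro exI[of _ "d / (real N + 1)"]) (use d(1) in auto)
qed

lemma real_sq_minus_sq_nonzero:
  assumes "Im z > 0" shows "complex_of_real t - z \<noteq> 0" "complex_of_real t + z \<noteq> 0" "complex_of_real (t\<^sup>2) - z\<^sup>2 \<noteq> 0"
proof -
  show 1: "complex_of_real t - z \<noteq> 0" "complex_of_real t + z \<noteq> 0" using assms by (auto simp: complex_eq_iff)
  have "complex_of_real (t\<^sup>2) - z\<^sup>2 = (of_real t - z) * (of_real t + z)"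
    by (simp add: power2_eq_square algebra_simps)
  with 1 show "complex_of_real (t\<^sup>2) - z\<^sup>2 \<noteq> 0" by simp
qed

lemma schwarz_kernel_partial_fractions:
  assumes "Im z > 0"
  shows "schwarz_kernel z t = (1 / (of_real t - z) - 1 / (of_real t + z)) / (2 * of_real pi * \<i>)"
proof -
  note nz = real_sq_minus_sq_nonzero[OF assms, of t]
  have e: "complex_of_real (t\<^sup>2) - z\<^sup>2 = (of_real t - z) * (of_real t + z)"
    by (simp add: power2_eq_square algebra_simps)
  show ?thesis unfolding schwarz_kernel_def e using nz(1,2) by (simp add: divide_simps)
qed

lemma norm_sq_real_diff: "(norm (complex_of_real t - z))\<^sup>2 = (t - Re z)\<^sup>2 + (Im z)\<^sup>2"
  by (simp add: cmod_power2)

lemma norm_sq_real_add: "(norm (complex_of_real t + z))\<^sup>2 = (t + Re z)\<^sup>2 + (Im z)\<^sup>2"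
  by (simp add: cmod_power2)

lemma Re_schwarz_kernel:
  assumes "Im z > 0"
  shows "Re (schwarz_kernel z t) = (poisson_kernel (Re z) (Im z) t + poisson_kernel (- Re z) (Im z) t) / 2"
proof -
  have a: "Re (w / (2 * of_real pi * \<i>)) = Im w / (2 * pi)" for w
    by (simp add: Re_divide power2_eq_square divide_simps)
  show ?thesis unfolding schwarz_kernel_partial_fractions[OF assms] a poisson_kernel_def
    by (simp add: Im_divide power2_eq_square add_divide_distrib) (simp only: mult.assoc mult.commute mult.left_commute)
qed

text \<open>The constant depends only on a lower bound for \<open>Im z\<close> and an upper bound for \<open>\<bar>z\<bar>\<close>; this local uniformity gives the
domination that \<open>holomorphic_parameter_integral\<close> asks for.\<close>

lemma schwarz_kernel_bound:
  assumes y0: "y0 > 0" "Im z \<ge> y0" and R: "norm z \<le> R" and C: "C \<ge> 2" "C * y0\<^sup>2 \<ge> 1 + 2 * R\<^sup>2"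
  shows "norm (schwarz_kernel z t) \<le> (R * C / pi) / (1 + t\<^sup>2)"
proof -
  have z: "Im z > 0" using y0 by simp
  have C0: "C > 0" using C by simp
  have R0: "R \<ge> 0" using R norm_ge_zero[of z] by linarith
  have x: "(Re z)\<^sup>2 \<le> R\<^sup>2" using abs_Re_le_cmod[of z] R by (simp add: abs_le_square_iff[symmetric])
  have "y0\<^sup>2 \<le> (Im z)\<^sup>2" using y0 by (intro power_mono) auto
  then have Cy: "C * y0\<^sup>2 \<le> C * (Im z)\<^sup>2" using C0 by (intro mult_left_mono) auto
  then have Cz: "C * (Im z)\<^sup>2 \<ge> 1 + 2 * (Re z)\<^sup>2" "C * (Im z)\<^sup>2 \<ge> 1 + 2 * (- Re z)\<^sup>2"
    using order_trans[OF C(2) Cy] x by auto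
  have a: "1 + t\<^sup>2 \<le> C * (norm (complex_of_real t - z))\<^sup>2"
    unfolding norm_sq_real_diff by (rule one_plus_sq_le[OF z C(1) Cz(1)])
  have b: "1 + t\<^sup>2 \<le> C * (norm (complex_of_real t + z))\<^sup>2"
    unfolding norm_sq_real_add using one_plus_sq_le[OF z C(1) Cz(2), of t] by simp
  have e: "complex_of_real (t\<^sup>2) - z\<^sup>2 = (of_real t - z) * (of_real t + z)"
    by (simp add: power2_eq_square algebra_simps)
  have "(1 + t\<^sup>2) * (1 + t\<^sup>2) \<le> (C * (norm (complex_of_real t - z))\<^sup>2) * (C * (norm (complex_of_real t + z))\<^sup>2)"
    by (intro mult_mono a b) (use C0 in auto)
  also have "\<dots> = (C * norm (complex_of_real (t\<^sup>2) - z\<^sup>2))\<^sup>2"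
    unfolding e norm_mult by (simp add: power_mult_distrib power2_eq_square)
  finally have "(1 + t\<^sup>2)\<^sup>2 \<le> (C * norm (complex_of_real (t\<^sup>2) - z\<^sup>2))\<^sup>2" by (simp add: power2_eq_square)
  then have d: "1 + t\<^sup>2 \<le> C * norm (complex_of_real (t\<^sup>2) - z\<^sup>2)"
    by (rule power2_le_imp_le) (use C0 in auto)
  have p: "1 + t\<^sup>2 > 0" by (simp add: add_pos_nonneg)
  have dp: "norm (complex_of_real (t\<^sup>2) - z\<^sup>2) > 0" using real_sq_minus_sq_nonzero(3)[OF z] by simp
  have "norm (schwarz_kernel z t) = norm z / pi * (1 / norm (complex_of_real (t\<^sup>2) - z\<^sup>2))"
    by (simp add: schwarz_kernel_def norm_mult norm_divide)
  also have "\<dots> \<le> R / pi * (C / (1 + t\<^sup>2))"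
  proof (intro mult_mono divide_right_mono)
    show "1 / norm (complex_of_real (t\<^sup>2) - z\<^sup>2) \<le> C / (1 + t\<^sup>2)"
      using d p dp by (subst frac_le_eq) (auto intro!: divide_nonpos_pos)
  qed (use R R0 in auto)
  finally show ?thesis by simp
qed

lemma schwarz_kernel_bound_exists:
  assumes y0: "y0 > 0" and R: "R \<ge> 0"
  shows "\<exists>C. \<forall>z t. Im z \<ge> y0 \<longrightarrow> norm z \<le> R \<longrightarrow> norm (schwarz_kernel z t) \<le> C / (1 + t\<^sup>2)"
proof -
  define C where "C = max 2 ((1 + 2 * R\<^sup>2) / y0\<^sup>2)"
  have "(1 + 2 * R\<^sup>2) / y0\<^sup>2 \<le> C" unfolding C_def by simp
  then have C: "C * y0\<^sup>2 \<ge> 1 + 2 * R\<^sup>2" using y0 by (simp add: pos_divide_le_eq)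
  have C2: "C \<ge> 2" by (simp add: C_def)
  show ?thesis using schwarz_kernel_bound[OF y0 _ _ C2 C] by blast
qed

lemma schwarz_kernel_measurable[measurable]: "schwarz_kernel z \<in> borel_measurable borel"
  unfolding schwarz_kernel_def by measurable

lemma schwarz_integrable:
  assumes "log_integrable \<phi>" "Im z > 0" shows "integrable lborel (\<lambda>t. of_real (\<phi> t) * schwarz_kernel z t)"
proof -
  obtain C where "\<And>t. norm (schwarz_kernel z t) \<le> C / (1 + t\<^sup>2)"
    using schwarz_kernel_bound_exists[OF assms(2) norm_ge_zero[of z]] by blast
  from log_integrable_times_kernel[OF assms(1) schwarz_kernel_measurable this] show ?thesis
    by (simp add: scaleR_conv_of_real)
qed

lemma schwarz_holomorphic:
  assumes \<phi>: "log_integrable \<phi>" shows "schwarz \<phi> holomorphic_on {z. Im z > 0}"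
  unfolding schwarz_def
proof (rule holomorphic_parameter_integral(1))
  show "open {z. Im z > 0}" by (rule open_halfspace_Im_gt)
  show "(\<lambda>z. complex_of_real (\<phi> t) * schwarz_kernel z t) holomorphic_on {z. Im z > 0}" for t
    unfolding schwarz_kernel_def by (intro holomorphic_intros) (use real_sq_minus_sq_nonzero(3) in auto)
  show "(\<lambda>t. complex_of_real (\<phi> t) * schwarz_kernel z t) \<in> borel_measurable lborel" if "z \<in> {z. Im z > 0}" for z
    using schwarz_integrable[OF \<phi>, of z] that by auto
  fix z assume z: "z \<in> {z. 0 < Im z}"
  define r where "r = Im z / 2"
  have r: "r > 0" using z by (simp add: r_def)
  obtain C where C: "\<And>w t. Im w \<ge> r \<Longrightarrow> norm w \<le> norm z + r \<Longrightarrow> norm (schwarz_kernel w t) \<le> C / (1 + t\<^sup>2)"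
    using schwarz_kernel_bound_exists[of r "norm z + r"] r by auto
  have w: "Im w \<ge> r" "norm w \<le> norm z + r" if "w \<in> cball z r" for w
  proof -
    have "\<bar>Im (z - w)\<bar> \<le> r" using that abs_Im_le_cmod[of "z - w"] by (simp add: dist_norm)
    then show "Im w \<ge> r" unfolding r_def minus_complex.sel by linarith
    show "norm w \<le> norm z + r" using that norm_triangle_ineq2[of w z] by (simp add: dist_norm norm_minus_commute)
  qed
  show "\<exists>r>0. \<exists>B. cball z r \<subseteq> {z. 0 < Im z} \<and> integrable lborel B \<and>
         (\<forall>t. \<forall>w\<in>cball z r. norm (complex_of_real (\<phi> t) * schwarz_kernel w t) \<le> B t)"
  proof (intro exI[of _ r] conjI exI[of _ "\<lambda>t. C * (\<bar>\<phi> t\<bar> / (1 + t\<^sup>2))"] allI ballI)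
    show "cball z r \<subseteq> {z. 0 < Im z}" using w(1) r by fastforce
    show "integrable lborel (\<lambda>t. C * (\<bar>\<phi> t\<bar> / (1 + t\<^sup>2)))"
      using log_integrable_abs[OF \<phi>] unfolding log_integrable_def by (rule integrable_mult_right)
    fix t w assume "w \<in> cball z r"
    then have "\<bar>\<phi> t\<bar> * norm (schwarz_kernel w t) \<le> \<bar>\<phi> t\<bar> * (C / (1 + t\<^sup>2))" using C w by (intro mult_left_mono) auto
    then show "norm (complex_of_real (\<phi> t) * schwarz_kernel w t) \<le> C * (\<bar>\<phi> t\<bar> / (1 + t\<^sup>2))"
      by (simp add: norm_mult mult.commute)
  qed (rule r)
qed

lemma Re_schwarz:
  assumes \<phi>: "log_integrable \<phi>" and even: "\<And>t. \<phi> (- t) = \<phi> t" and z: "Im z > 0"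
  shows "Re (schwarz \<phi> z) = poisson \<phi> (Re z) (Im z)"
proof -
  have "Re (schwarz \<phi> z) = (\<integral>t. Re (of_real (\<phi> t) * schwarz_kernel z t) \<partial>lborel)"
    unfolding schwarz_def by (rule integral_Re[symmetric, OF schwarz_integrable[OF \<phi> z]])
  also have "\<dots> = (\<integral>t. (\<phi> t * poisson_kernel (Re z) (Im z) t + \<phi> t * poisson_kernel (- Re z) (Im z) t) / 2 \<partial>lborel)"
    by (intro Bochner_Integration.integral_cong) (simp_all add: Re_schwarz_kernel[OF z] algebra_simps add_divide_distrib)
  also have "\<dots> = (poisson \<phi> (Re z) (Im z) + poisson \<phi> (- Re z) (Im z)) / 2"
    unfolding poisson_def using poisson_integrable[OF \<phi> z]
    by (simp only: Bochner_Integration.integral_divide_zero Bochner_Integration.integral_add)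
  also have "poisson \<phi> (- Re z) (Im z) = poisson \<phi> (Re z) (Im z)" using even by (rule poisson_uminus_arg)
  finally show ?thesis by simp
qed

section \<open>Majorization by the Poisson integral of a weight\<close>

text \<open>The properties of \<open>log_Ostrowski M\<close> that potential theory needs.\<close>

definition weight :: "(real \<Rightarrow> real) \<Rightarrow> bool" where
  "weight \<phi> \<longleftrightarrow> continuous_on UNIV \<phi> \<and> (\<forall>t. \<phi> (- t) = \<phi> t) \<and> mono_on {0..} \<phi>"

text \<open>A bounded, uniformly continuous minorant of the weight. It makes the maximum principle and the uniform boundary
behaviour available; the general case follows as \<open>R\<close> tends to infinity.\<close>

definition capped :: "(real \<Rightarrow> real) \<Rightarrow> real \<Rightarrow> real \<Rightarrow> real" where
  "capped \<phi> R t = \<phi> (min \<bar>t\<bar> R)"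

lemma weight_even: "weight \<phi> \<Longrightarrow> \<phi> (- t) = \<phi> t" by (simp add: weight_def)
lemma weight_abs: "weight \<phi> \<Longrightarrow> \<phi> \<bar>t\<bar> = \<phi> t" by (simp add: weight_def abs_if)
lemma weight_mono: "weight \<phi> \<Longrightarrow> \<bar>s\<bar> \<le> \<bar>t\<bar> \<Longrightarrow> \<phi> s \<le> \<phi> t"
  using monotone_onD[of "{0..}" "(\<le>)" "(\<le>)" \<phi> "\<bar>s\<bar>" "\<bar>t\<bar>"] by (auto simp: weight_abs) (simp add: weight_def)
lemma weight_ge0: "weight \<phi> \<Longrightarrow> \<phi> 0 \<le> \<phi> t" by (rule weight_mono) auto
lemma weight_measurable: "weight \<phi> \<Longrightarrow> \<phi> \<in> borel_measurable borel"
  by (simp add: weight_def borel_measurable_continuous_onI)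

lemma weight_capped:
  assumes w: "weight \<phi>" and R: "R \<ge> 0"
  shows "capped \<phi> R (- t) = capped \<phi> R t" "\<phi> 0 \<le> capped \<phi> R t" "capped \<phi> R t \<le> \<phi> R" "capped \<phi> R t \<le> \<phi> t"
    "\<bar>capped \<phi> R t\<bar> \<le> \<bar>\<phi> 0\<bar> + \<bar>\<phi> R\<bar>"
    "uniformly_continuous_on UNIV (capped \<phi> R)" "log_integrable (capped \<phi> R)"
proof -
  show "capped \<phi> R (- t) = capped \<phi> R t" by (simp add: capped_def)
  show 1: "\<phi> 0 \<le> capped \<phi> R t" for t unfolding capped_def by (rule weight_ge0[OF w])
  show 2: "capped \<phi> R t \<le> \<phi> R" for t unfolding capped_def by (rule weight_mono[OF w]) (use R in auto)
  show "capped \<phi> R t \<le> \<phi> t" unfolding capped_def by (rule weight_mono[OF w]) (use R in auto)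
  show 3: "\<bar>capped \<phi> R t\<bar> \<le> \<bar>\<phi> 0\<bar> + \<bar>\<phi> R\<bar>" for t using 1[of t] 2[of t] by linarith
  have "uniformly_continuous_on {0..R} \<phi>"
    by (rule compact_uniformly_continuous) (use w in \<open>auto simp: weight_def intro: continuous_on_subset\<close>)
  then show uc: "uniformly_continuous_on UNIV (capped \<phi> R)"
    unfolding uniformly_continuous_on_def
  proof (intro allI impI)
    fix e :: real assume H: "\<forall>e>0. \<exists>d>0. \<forall>x\<in>{0..R}. \<forall>x'\<in>{0..R}. dist x' x < d \<longrightarrow> dist (\<phi> x') (\<phi> x) < e" and "e > 0"
    then obtain d where d: "d > 0" "\<And>x x'. x \<in> {0..R} \<Longrightarrow> x' \<in> {0..R} \<Longrightarrow> dist x' x < d \<Longrightarrow> dist (\<phi> x') (\<phi> x) < e"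
      by meson
    have "dist (capped \<phi> R x') (capped \<phi> R x) < e" if "dist x' x < d" for x x'
      unfolding capped_def by (rule d(2)) (use that R in \<open>auto simp: dist_real_def\<close>)
    then show "\<exists>d>0. \<forall>x\<in>UNIV. \<forall>x'\<in>UNIV. dist x' x < d \<longrightarrow> dist (capped \<phi> R x') (capped \<phi> R x) < e"
      using d(1) by blast
  qed
  show "log_integrable (capped \<phi> R)"
    by (rule bounded_log_integrable[OF _ 3])
       (intro borel_measurable_continuous_onI uniformly_continuous_imp_continuous uc)
qed

lemma poisson_const: "y > 0 \<Longrightarrow> poisson (\<lambda>_. c) x y = c"
  unfolding poisson_def by (simp add: poisson_kernel_integral)

lemma log_integrable_const: "log_integrable (\<lambda>_. c)"
  by (rule bounded_log_integrable[of _ "\<bar>c\<bar>"]) auto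

lemma poisson_capped_bounds:
  assumes w: "weight \<phi>" and R: "R \<ge> 0" and y: "y > 0"
  shows "\<phi> 0 \<le> poisson (capped \<phi> R) x y" "poisson (capped \<phi> R) x y \<le> \<phi> R"
  using poisson_mono[OF log_integrable_const weight_capped(7)[OF w R] y weight_capped(2)[OF w R], of x]
    poisson_mono[OF weight_capped(7)[OF w R] log_integrable_const y weight_capped(3)[OF w R], of x]
  by (simp_all add: poisson_const[OF y])

lemma capped_tendsto: "(\<lambda>n. capped \<phi> (real n) t) \<longlonglongrightarrow> \<phi> \<bar>t\<bar>"
proof -
  obtain n where "\<bar>t\<bar> < real n" using reals_Archimedean2 by blast
  then have "\<forall>\<^sub>F i in sequentially. capped \<phi> (real i) t = \<phi> \<bar>t\<bar>"
    unfolding eventually_sequentially by (intro exI[of _ n]) (auto simp: capped_def min_def)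
  then show ?thesis by (rule tendsto_eventually)
qed

lemma poisson_capped_tendsto:
  assumes w: "weight \<phi>" and \<phi>: "log_integrable \<phi>" and y: "y > 0"
  shows "(\<lambda>n. poisson (capped \<phi> (real n)) x y) \<longlonglongrightarrow> poisson \<phi> x y"
  unfolding poisson_def
proof (rule integral_dominated_convergence[where w = "\<lambda>t. (\<bar>\<phi> t\<bar> + \<bar>\<phi> 0\<bar>) * poisson_kernel x y t"])
  show "integrable lborel (\<lambda>t. (\<bar>\<phi> t\<bar> + \<bar>\<phi> 0\<bar>) * poisson_kernel x y t)"
    by (intro poisson_integrable log_integrable_add log_integrable_abs \<phi> log_integrable_const y)
  show "(\<lambda>t. \<phi> t * poisson_kernel x y t) \<in> borel_measurable lborel"
    using poisson_integrable[OF \<phi> y] by auto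
  show "(\<lambda>t. capped \<phi> (real i) t * poisson_kernel x y t) \<in> borel_measurable lborel" for i
    using poisson_integrable[OF weight_capped(7)[OF w] y] by auto
  show "AE t in lborel. (\<lambda>i. capped \<phi> (real i) t * poisson_kernel x y t) \<longlonglongrightarrow> \<phi> t * poisson_kernel x y t"
    using capped_tendsto[of \<phi>] by (intro AE_I2 tendsto_mult_right) (simp add: weight_abs[OF w])
  have "\<bar>capped \<phi> (real i) t\<bar> \<le> \<bar>\<phi> t\<bar> + \<bar>\<phi> 0\<bar>" for i t
    using weight_capped(2,4)[OF w, of "real i" t] by auto
  then have "\<bar>capped \<phi> (real i) t\<bar> * poisson_kernel x y t \<le> (\<bar>\<phi> t\<bar> + \<bar>\<phi> 0\<bar>) * poisson_kernel x y t" for i t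
    using poisson_kernel_pos[OF y, of x t] by (intro mult_right_mono) auto
  then show "AE t in lborel. norm (capped \<phi> (real i) t * poisson_kernel x y t) \<le> (\<bar>\<phi> t\<bar> + \<bar>\<phi> 0\<bar>) * poisson_kernel x y t" for i
    using poisson_kernel_pos[OF y, of x] by (auto simp: abs_mult abs_of_pos)
qed

text \<open>The function \<open>f * exp (schwarz (capped \<phi> R))\<close> is bounded, and its modulus is at most nearly \<open>1\<close> on lines close to the
real axis, so it is at most \<open>1\<close>.\<close>

lemma majorization_capped:
  assumes w: "weight \<phi>" and hol: "f holomorphic_on {z. Im z > 0}"
    and f: "\<And>z. Im z > 0 \<Longrightarrow> norm (f z) \<le> exp (- \<phi> (Re z))" and R: "R \<ge> 0" and z: "Im z > 0"
  shows "norm (f z) \<le> exp (- poisson (capped \<phi> R) (Re z) (Im z))"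
proof -
  let ?\<psi> = "capped \<phi> R"
  note \<psi> = weight_capped[OF w R]
  define g where "g = (\<lambda>z. f z * exp (schwarz ?\<psi> z))"
  have ng: "norm (g z) = norm (f z) * exp (poisson ?\<psi> (Re z) (Im z))" if "Im z > 0" for z
    using Re_schwarz[OF \<psi>(7,1) that] by (simp add: g_def norm_mult)
  have holg: "g holomorphic_on {z. Im z > 0}"
    unfolding g_def by (intro holomorphic_intros hol schwarz_holomorphic \<psi>(7))
  have bdd: "norm (g z) \<le> exp (- \<phi> 0) * exp (\<phi> R)" if "Im z > 0" for z
    unfolding ng[OF that]
  proof (intro mult_mono)
    show "norm (f z) \<le> exp (- \<phi> 0)" using f[OF that] weight_ge0[OF w, of "Re z"]
      by (meson dual_order.trans exp_le_cancel_iff neg_le_iff_le)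
    show "exp (poisson ?\<psi> (Re z) (Im z)) \<le> exp (\<phi> R)"
      using poisson_capped_bounds(2)[OF w R that] by simp
  qed auto
  have main: "norm (g z) \<le> exp e" if e: "e > 0" for e
  proof -
    obtain d where d: "d > 0" "\<And>y x. 0 < y \<Longrightarrow> y < d \<Longrightarrow> \<bar>poisson ?\<psi> x y - ?\<psi> x\<bar> \<le> e"
      using poisson_boundary_uniform[OF \<psi>(6,5) e] by blast
    define y where "y = min (d / 2) (Im z)"
    have y: "0 < y" "y < d" "y \<le> Im z" using d(1) z by (auto simp: y_def)
    show ?thesis
    proof (rule half_plane_maximum_principle[OF holg y(1) bdd _ _ y(3)])
      fix x
      have "norm (g (Complex x y)) \<le> exp (- \<phi> x) * exp (?\<psi> x + e)"
        using ng[of "Complex x y"] f[of "Complex x y"] d(2)[OF y(1,2), of x] y(1)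
        by (auto intro!: mult_mono)
      also have "\<dots> = exp (?\<psi> x + e - \<phi> x)" by (simp add: exp_add exp_diff exp_minus field_simps)
      also have "\<dots> \<le> exp e" using \<psi>(4)[of x] by simp
      finally show "norm (g (Complex x y)) \<le> exp e" .
    qed auto
  qed
  have "norm (g z) \<le> 1"
  proof (rule ccontr)
    assume "\<not> norm (g z) \<le> 1"
    then have "norm (g z) > 1" by simp
    then have pos: "ln (norm (g z)) > 0" by (rule ln_gt_zero)
    have "norm (g z) \<le> exp (ln (norm (g z)) / 2)" by (rule main) (use pos in simp)
    then have "exp (ln (norm (g z))) \<le> exp (ln (norm (g z)) / 2)" using \<open>norm (g z) > 1\<close> by (subst exp_ln) auto
    then show False using pos by (simp only: exp_le_cancel_iff)
  qed
  then show ?thesis unfolding ng[OF z] by (simp add: exp_minus field_simps)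
qed

text \<open>At a point where \<open>f\<close> does not vanish, the majorization bounds the Poisson integrals of all the functions \<open>capped \<phi> n\<close>,
and these increase to that of \<open>\<phi>\<close>.\<close>

lemma log_integrable_if_majorized:
  assumes w: "weight \<phi>" and hol: "f holomorphic_on {z. Im z > 0}"
    and f: "\<And>z. Im z > 0 \<Longrightarrow> norm (f z) \<le> exp (- \<phi> (Re z))" and z: "Im z > 0" "f z \<noteq> 0"
  shows "log_integrable \<phi>"
proof -
  define x y where "x = Re z" and "y = Im z"
  have y: "y > 0" using z by (simp add: y_def)
  have bound: "poisson (capped \<phi> (real n)) x y \<le> - ln (norm (f z))" for n
  proof -
    have "norm (f z) \<le> exp (- poisson (capped \<phi> (real n)) x y)"
      unfolding x_def y_def by (rule majorization_capped[OF w hol f]) (use z in auto)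
    then have "ln (norm (f z)) \<le> - poisson (capped \<phi> (real n)) x y"
      using z(2) by (metis ln_exp ln_mono zero_less_norm_iff)
    then show ?thesis by simp
  qed
  have mono: "capped \<phi> (real i) t \<le> capped \<phi> (real j) t" if "i \<le> j" for i j t
    unfolding capped_def by (rule weight_mono[OF w]) (use that in auto)
  have inc: "incseq (\<lambda>n. poisson (capped \<phi> (real n)) x y)"
    by (intro incseq_def[THEN iffD2] allI impI poisson_mono weight_capped(7)[OF w] y mono) auto
  obtain L where L: "(\<lambda>n. poisson (capped \<phi> (real n)) x y) \<longlonglongrightarrow> L"
    using incseq_convergent[OF inc, of "- ln (norm (f z))"] bound by metis
  have "integrable lborel (\<lambda>t. \<phi> t * poisson_kernel x y t)"
  proof (rule integrable_monotone_convergence[where x = L])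
    show "integrable lborel (\<lambda>t. capped \<phi> (real i) t * poisson_kernel x y t)" for i
      by (rule poisson_integrable[OF weight_capped(7)[OF w] y]) simp
    show "AE t in lborel. mono (\<lambda>n. capped \<phi> (real n) t * poisson_kernel x y t)"
      by (intro AE_I2 monoI mult_right_mono mono less_imp_le[OF poisson_kernel_pos[OF y]])
    show "AE t in lborel. (\<lambda>i. capped \<phi> (real i) t * poisson_kernel x y t) \<longlonglongrightarrow> \<phi> t * poisson_kernel x y t"
      using capped_tendsto[of \<phi>] by (intro AE_I2 tendsto_mult_right) (simp add: weight_abs[OF w])
    show "(\<lambda>i. \<integral>t. capped \<phi> (real i) t * poisson_kernel x y t \<partial>lborel) \<longlonglongrightarrow> L"
      using L by (simp add: poisson_def)
    show "(\<lambda>t. \<phi> t * poisson_kernel x y t) \<in> borel_measurable lborel"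
      using weight_measurable[OF w] by measurable
  qed
  then show ?thesis unfolding log_integrable_def
  proof (rule Bochner_Integration.integrable_bound[OF integrable_mult_right[of "pi / y * (2 + 2 * x\<^sup>2 + y\<^sup>2)"]])
    show "(\<lambda>t. \<phi> t / (1 + t\<^sup>2)) \<in> borel_measurable lborel"
      using weight_measurable[OF w] by measurable
    have "\<bar>\<phi> t\<bar> / (1 + t\<^sup>2) \<le> pi / y * (2 + 2 * x\<^sup>2 + y\<^sup>2) * (\<bar>\<phi> t\<bar> * poisson_kernel x y t)" for t
    proof -
      have p: "1 + t\<^sup>2 > 0" "(t - x)\<^sup>2 + y\<^sup>2 > 0" using y by (auto simp: add_pos_nonneg add_nonneg_pos)
      have "(t - x)\<^sup>2 \<le> 2 * t\<^sup>2 + 2 * x\<^sup>2" using zero_le_power2[of "t + x"] by (simp add: power2_eq_square algebra_simps)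
      moreover have "(2 + 2 * x\<^sup>2 + y\<^sup>2) * (1 + t\<^sup>2) = 2 + 2 * x\<^sup>2 + y\<^sup>2 + 2 * t\<^sup>2 + 2 * (x\<^sup>2 * t\<^sup>2) + y\<^sup>2 * t\<^sup>2"
        by (simp add: algebra_simps)
      moreover have "0 \<le> x\<^sup>2 * t\<^sup>2" "0 \<le> y\<^sup>2 * t\<^sup>2" by auto
      ultimately have "(t - x)\<^sup>2 + y\<^sup>2 \<le> (2 + 2 * x\<^sup>2 + y\<^sup>2) * (1 + t\<^sup>2)" by linarith
      then have "1 / (1 + t\<^sup>2) \<le> (2 + 2 * x\<^sup>2 + y\<^sup>2) / ((t - x)\<^sup>2 + y\<^sup>2)"
        using p by (subst frac_le_eq) (auto intro!: divide_nonpos_pos simp: mult.commute)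
      then have "\<bar>\<phi> t\<bar> * (1 / (1 + t\<^sup>2)) \<le> \<bar>\<phi> t\<bar> * ((2 + 2 * x\<^sup>2 + y\<^sup>2) / ((t - x)\<^sup>2 + y\<^sup>2))"
        by (intro mult_left_mono) auto
      also have "\<dots> = pi / y * (2 + 2 * x\<^sup>2 + y\<^sup>2) * (\<bar>\<phi> t\<bar> * poisson_kernel x y t)"
        using y by (simp add: poisson_kernel_def)
      finally show ?thesis by simp
    qed
    then show "AE t in lborel. norm (\<phi> t / (1 + t\<^sup>2)) \<le> norm (pi / y * (2 + 2 * x\<^sup>2 + y\<^sup>2) * (\<phi> t * poisson_kernel x y t))"
      using y poisson_kernel_pos[OF y] by (auto simp: abs_mult abs_of_pos add_nonneg_nonneg)
  qed
qed

lemma majorization: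
  assumes w: "weight \<phi>" and \<phi>: "log_integrable \<phi>" and hol: "f holomorphic_on {z. Im z > 0}"
    and f: "\<And>z. Im z > 0 \<Longrightarrow> norm (f z) \<le> exp (- \<phi> (Re z))" and z: "Im z > 0"
  shows "norm (f z) \<le> exp (- poisson \<phi> (Re z) (Im z))"
proof (rule LIMSEQ_le_const)
  show "(\<lambda>n. exp (- poisson (capped \<phi> (real n)) (Re z) (Im z))) \<longlonglongrightarrow> exp (- poisson \<phi> (Re z) (Im z))"
    by (intro tendsto_intros poisson_capped_tendsto w \<phi> z)
  show "\<exists>N. \<forall>n\<ge>N. norm (f z) \<le> exp (- poisson (capped \<phi> (real n)) (Re z) (Im z))"
    by (intro exI[of _ 0] allI impI majorization_capped[OF w hol f] z) auto
qed

text \<open>The majorization in the opposite direction: now \<open>exp (- schwarz (capped \<phi> R))\<close> multiplies the \<open>n\<close>-th power of the map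
\<open>z / (1 - \<i> * z / R)\<close>. This map behaves like \<open>z\<close> but is bounded by \<open>R\<close>, and at height \<open>y\<close> it is at most
\<open>min \<bar>x\<bar> R + y\<close>, in accordance with the cap.\<close>

lemma power_le_exp_poisson_capped:
  assumes w: "weight \<phi>" and m: "m > 0" and t: "\<And>t. t \<ge> 0 \<Longrightarrow> t ^ n \<le> m * exp (\<phi> t)"
    and R: "R > 0" and z: "Im z > 0"
  shows "norm (z / (1 - \<i> * z / of_real R)) ^ n \<le> m * exp (poisson (capped \<phi> R) (Re z) (Im z))"
proof -
  let ?\<psi> = "capped \<phi> R"
  have R0: "R \<ge> 0" using R by simp
  note \<psi> = weight_capped[OF w R0]
  define b where "b = (\<lambda>z. z / (1 - \<i> * z / complex_of_real R))"
  have beq: "norm (b z) = R * norm z / norm (of_real R - \<i> * z)" for z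
  proof -
    have e: "1 - \<i> * z / complex_of_real R = (of_real R - \<i> * z) / of_real R" using R by (simp add: field_simps)
    show ?thesis unfolding b_def e using R by (simp add: norm_divide norm_mult)
  qed
  have Re': "Re (of_real R - \<i> * z) = R + Im z" "Im (of_real R - \<i> * z) = - Re z" for z by auto
  have dge: "norm (of_real R - \<i> * z) \<ge> norm z" "norm (of_real R - \<i> * z) \<ge> R" "norm (of_real R - \<i> * z) \<ge> \<bar>Re z\<bar>"
    if "Im z > 0" for z
  proof -
    have "(Im z)\<^sup>2 \<le> (R + Im z)\<^sup>2" using that R by (intro power_mono) auto
    then have "(norm z)\<^sup>2 \<le> (norm (of_real R - \<i> * z))\<^sup>2" unfolding cmod_power2 Re' by simp
    then show "norm (of_real R - \<i> * z) \<ge> norm z" by (rule power2_le_imp_le) simp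
    show "norm (of_real R - \<i> * z) \<ge> R" using complex_Re_le_cmod[of "of_real R - \<i> * z"] that by simp
    show "norm (of_real R - \<i> * z) \<ge> \<bar>Re z\<bar>" using abs_Im_le_cmod[of "of_real R - \<i> * z"] by simp
  qed
  have nz: "1 - \<i> * z / complex_of_real R \<noteq> 0" if "Im z > 0" for z
  proof
    assume "1 - \<i> * z / complex_of_real R = 0"
    then have "of_real R - \<i> * z = 0" using R by (simp add: field_simps)
    then show False using dge(2)[OF that] R by simp
  qed
  define g where "g = (\<lambda>z. b z ^ n * exp (- schwarz ?\<psi> z))"
  have ng: "norm (g z) = norm (b z) ^ n * exp (- poisson ?\<psi> (Re z) (Im z))" if "Im z > 0" for z
    using Re_schwarz[OF \<psi>(7,1) that] by (simp add: g_def norm_mult norm_power)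
  have holg: "g holomorphic_on {z. Im z > 0}"
    unfolding g_def b_def by (intro holomorphic_intros schwarz_holomorphic \<psi>(7)) (use nz in auto)
  have bdd: "norm (g z) \<le> R ^ n * exp (- \<phi> 0)" if "Im z > 0" for z
    unfolding ng[OF that]
  proof (intro mult_mono power_mono)
    have "R * norm z \<le> R * norm (of_real R - \<i> * z)" using dge(1)[OF that] R by (intro mult_left_mono) auto
    then show "norm (b z) \<le> R" unfolding beq using dge(2)[OF that] R by (subst pos_divide_le_eq) auto
    show "exp (- poisson ?\<psi> (Re z) (Im z)) \<le> exp (- \<phi> 0)"
      using poisson_capped_bounds(1)[OF w R0 that] by simp
  qed (use R in auto)
  have main: "norm (g z) \<le> m * exp (2 * e)" if e: "e > 0" for e
  proof -
    have uc: "uniformly_continuous_on {0..R+1} \<phi>"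
      by (rule compact_uniformly_continuous) (use w in \<open>auto simp: weight_def intro: continuous_on_subset\<close>)
    obtain d' where d': "d' > 0" "\<And>x x'. x \<in> {0..R+1} \<Longrightarrow> x' \<in> {0..R+1} \<Longrightarrow> dist x' x < d' \<Longrightarrow> dist (\<phi> x') (\<phi> x) < e"
      using uniformly_continuous_onE[OF uc e] by metis
    obtain d where d: "d > 0" "\<And>y x. 0 < y \<Longrightarrow> y < d \<Longrightarrow> \<bar>poisson ?\<psi> x y - ?\<psi> x\<bar> \<le> e"
      using poisson_boundary_uniform[OF \<psi>(6,5) e] by blast
    define y where "y = Min {d / 2, d' / 2, 1, Im z}"
    have y: "0 < y" "y < d" "y \<le> Im z" "y < d'" "y \<le> 1" using d(1) d'(1) z by (auto simp: y_def min_def)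
    show ?thesis
    proof (rule half_plane_maximum_principle[OF holg y(1) bdd _ _ y(3)])
      fix x
      let ?z = "Complex x y"
      define u where "u = min \<bar>x\<bar> R"
      have u: "u \<in> {0..R+1}" "u + y \<in> {0..R+1}" using R y by (auto simp: u_def)
      have "norm ?z \<le> \<bar>x\<bar> + y" using cmod_le[of ?z] y(1) by simp
      then have "R * norm ?z \<le> R * (\<bar>x\<bar> + y)" using R by simp
      also have "\<dots> \<le> (u + y) * norm (of_real R - \<i> * ?z)"
      proof (cases "\<bar>x\<bar> \<le> R")
        case True
        have "(u + y) * R \<le> (u + y) * norm (of_real R - \<i> * ?z)"
          using dge(2)[of ?z] y(1) u by (intro mult_left_mono) auto
        then show ?thesis using True by (simp add: u_def mult.commute)
      next
        case False
        have "R * (\<bar>x\<bar> + y) \<le> (u + y) * \<bar>x\<bar>" 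
          using False y(1) R by (simp add: u_def algebra_simps)
        also have "\<dots> \<le> (u + y) * norm (of_real R - \<i> * ?z)"
          using dge(3)[of ?z] y(1) u by (intro mult_left_mono) auto
        finally show ?thesis .
      qed
      finally have "norm (b ?z) \<le> u + y" unfolding beq using dge(2)[of ?z] R y(1) by (subst pos_divide_le_eq) auto
      then have "norm (b ?z) ^ n \<le> (u + y) ^ n" by (intro power_mono) auto
      also have "\<dots> \<le> m * exp (\<phi> (u + y))" by (rule t) (use u in auto)
      also have "\<phi> (u + y) \<le> ?\<psi> x + e"
        using d'(2)[OF u] y by (simp add: dist_real_def capped_def u_def)
      finally have "norm (b ?z) ^ n \<le> m * exp (?\<psi> x + e)" using m by simp
      then have "norm (g ?z) \<le> m * exp (?\<psi> x + e) * exp (- ?\<psi> x + e)"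
        using ng[of ?z] d(2)[OF y(1,2), of x] y(1) m by (auto intro!: mult_mono)
      also have "\<dots> = m * exp (2 * e)" by (simp add: mult.assoc exp_add[symmetric])
      finally show "norm (g ?z) \<le> m * exp (2 * e)" .
    qed (use m in auto)
  qed
  have "norm (g z) \<le> m"
  proof (rule tendsto_lowerbound)
    have "((\<lambda>e. m * exp (2 * e)) \<longlongrightarrow> m * exp (2 * 0)) (at_right 0)" by (intro tendsto_intros)
    then show "((\<lambda>e. m * exp (2 * e)) \<longlongrightarrow> m) (at_right 0)" by simp
    show "\<forall>\<^sub>F e in at_right 0. norm (g z) \<le> m * exp (2 * e)"
      using main by (auto simp: eventually_at_right_less eventually_at_filter)
  qed auto
  then show ?thesis unfolding ng[OF z] b_def by (simp add: exp_minus field_simps)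
qed

text \<open>The function \<open>n * ln \<bar>z\<bar>\<close> is harmonic in the upper half-plane and grows slowly, so it is dominated there by the
Poisson integral of any majorant of its boundary values.\<close>

lemma power_le_exp_poisson:
  assumes w: "weight \<phi>" and \<phi>: "log_integrable \<phi>" and m: "m > 0"
    and t: "\<And>t. t \<ge> 0 \<Longrightarrow> t ^ n \<le> m * exp (\<phi> t)" and z: "Im z > 0"
  shows "norm z ^ n \<le> m * exp (poisson \<phi> (Re z) (Im z))"
proof -
  have "(\<lambda>k. norm (z / (1 - \<i> * z * of_real (1 / real (Suc k)))) ^ n) \<longlonglongrightarrow> norm (z / (1 - \<i> * z * of_real 0)) ^ n"
    by (intro tendsto_intros LIMSEQ_Suc[OF lim_1_over_n]) auto
  then have lim: "(\<lambda>k. norm (z / (1 - \<i> * z * of_real (1 / real (Suc k)))) ^ n) \<longlonglongrightarrow> norm z ^ n" by simp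
  show ?thesis
  proof (rule LIMSEQ_le_const2[OF lim], intro exI[of _ 0] allI impI)
    fix k :: nat
    have "norm (z / (1 - \<i> * z / of_real (real (Suc k)))) ^ n \<le> m * exp (poisson (capped \<phi> (real (Suc k))) (Re z) (Im z))"
      by (rule power_le_exp_poisson_capped[OF w m t _ z]) auto
    also have "\<dots> \<le> m * exp (poisson \<phi> (Re z) (Im z))"
      using poisson_mono[OF weight_capped(7)[OF w, of "real (Suc k)"] \<phi> z weight_capped(4)[OF w, of "real (Suc k)"], of "Re z"] m by simp
    finally show "norm (z / (1 - \<i> * z * of_real (1 / real (Suc k)))) ^ n \<le> m * exp (poisson \<phi> (Re z) (Im z))"
      by (simp add: divide_inverse of_real_inverse)
  qed
qed

section \<open>Integrals of increasing weights and the curvature\<close>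

lemma integrable_imp_set_integrable:
  fixes f :: "real \<Rightarrow> 'a :: {banach, second_countable_topology}"
  shows "integrable lborel f \<Longrightarrow> A \<in> sets borel \<Longrightarrow> set_integrable lborel A f"
  unfolding set_integrable_def by (rule integrable_mult_indicator) auto

text \<open>Layer-cake decomposition: up to a constant, which \<open>k\<close> does not see, an even increasing function is a superposition of
indicators of sets \<open>{t. \<bar>t\<bar> > u}\<close>, and \<open>k\<close> has a nonnegative integral over each of them.\<close>

lemma monotone_integral_nonneg:
  fixes \<phi> k :: "real \<Rightarrow> real"
  assumes w: "weight \<phi>" and even: "\<And>t. k (- t) = k t" and k: "integrable lborel k"
    and \<phi>k: "integrable lborel (\<lambda>t. \<phi> t * k t)" and zero: "(\<integral>t. k t \<partial>lborel) = 0"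
    and tail: "\<And>u. u \<ge> 0 \<Longrightarrow> (LINT t:{u..}|lborel. k t) \<ge> 0"
  shows "(\<integral>t. \<phi> t * k t \<partial>lborel) \<ge> 0"
proof -
  have [measurable]: "\<phi> \<in> borel_measurable borel" by (rule weight_measurable[OF w])
  have [measurable]: "k \<in> borel_measurable borel" using k by auto
  define f where "f = (\<lambda>t l. indicator {0<..<\<phi> t - \<phi> 0} l * k t :: real)"
  have mf: "case_prod f \<in> borel_measurable (lborel \<Otimes>\<^sub>M lborel)"
  proof -
    have "(\<lambda>p. (if 0 < snd p \<and> snd p < \<phi> (fst p) - \<phi> 0 then 1 else 0) * k (fst p)) \<in> borel_measurable (lborel \<Otimes>\<^sub>M (lborel :: real measure))"
      by measurable
    also have "(\<lambda>p. (if 0 < snd p \<and> snd p < \<phi> (fst p) - \<phi> 0 then 1 else 0) * k (fst p)) = case_prod f"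
      by (auto simp: f_def fun_eq_iff indicator_def)
    finally show ?thesis .
  qed
  have pos: "\<phi> t - \<phi> 0 \<ge> 0" for t using weight_ge0[OF w, of t] by simp
  have inner: "(\<integral>l. indicator {0<..<\<phi> t - \<phi> 0} l * c \<partial>lborel) = (\<phi> t - \<phi> 0) * c" for t and c :: real
    using pos[of t] by (simp add: measure_def)
  have inneri: "integrable lborel (\<lambda>l. indicator {0<..<\<phi> t - \<phi> 0} l * c)" for t and c :: real
    by (intro integrable_mult_left integrable_real_indicator) (use pos[of t] in auto)
  have int0: "integrable lborel (\<lambda>t. (\<phi> t - \<phi> 0) * k t)"
    using \<phi>k k by (simp add: left_diff_distrib)
  have intf: "integrable (lborel \<Otimes>\<^sub>M lborel) (case_prod f)"
  proof (rule lborel_pair.Fubini_integrable)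
    have "(\<lambda>t. \<integral>l. norm (case_prod f (t, l)) \<partial>lborel) = (\<lambda>t. norm ((\<phi> t - \<phi> 0) * k t))"
    proof
      fix t
      have "(\<integral>l. norm (case_prod f (t, l)) \<partial>lborel) = (\<integral>l. indicator {0<..<\<phi> t - \<phi> 0} l * \<bar>k t\<bar> \<partial>lborel)"
        by (intro Bochner_Integration.integral_cong) (auto simp: f_def abs_mult)
      then show "(\<integral>l. norm (case_prod f (t, l)) \<partial>lborel) = norm ((\<phi> t - \<phi> 0) * k t)"
        unfolding inner using pos[of t] by (simp add: abs_mult)
    qed
    then show "integrable lborel (\<lambda>t. \<integral>l. norm (case_prod f (t, l)) \<partial>lborel)" using int0 by simp
    show "AE t in lborel. integrable lborel (\<lambda>l. case_prod f (t, l))"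
      unfolding f_def prod.case using inneri by auto
  qed (rule mf)
  have "(\<integral>t. \<phi> t * k t \<partial>lborel) = (\<integral>t. (\<phi> t - \<phi> 0) * k t \<partial>lborel)"
    using \<phi>k k zero by (simp add: left_diff_distrib)
  also have "\<dots> = (\<integral>t. (\<integral>l. f t l \<partial>lborel) \<partial>lborel)" unfolding f_def inner ..
  also have "\<dots> = (\<integral>l. (\<integral>t. f t l \<partial>lborel) \<partial>lborel)" by (rule lborel_pair.Fubini_integral[OF intf, symmetric])
  finally have eq: "(\<integral>t. \<phi> t * k t \<partial>lborel) = (\<integral>l. (\<integral>t. f t l \<partial>lborel) \<partial>lborel)" .
  show ?thesis unfolding eq
  proof (rule integral_nonneg_AE, rule AE_I2)
    fix l :: real
    show "(\<integral>t. f t l \<partial>lborel) \<ge> 0"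
    proof (cases "l > 0 \<and> (\<exists>t. l < \<phi> t - \<phi> 0)")
      case False
      then have "f t l = 0" for t by (auto simp: f_def)
      then show ?thesis by simp
    next
      case True
      define A where "A = {t. t \<ge> 0 \<and> l < \<phi> t - \<phi> 0}"
      obtain t1 where "l < \<phi> t1 - \<phi> 0" using True by blast
      then have A: "\<bar>t1\<bar> \<in> A" unfolding A_def using weight_abs[OF w, of t1] by simp
      have bdd: "bdd_below A" by (auto simp: A_def bdd_below_def)
      \<comment> \<open>\<open>{t. l < \<phi> t - \<phi> 0}\<close> agrees up to two points with \<open>{t. \<bar>t\<bar> \<ge> u}\<close>.\<close>
      define u where "u = Inf A"
      have "A \<noteq> {}" using A by blast
      then have u0: "u \<ge> 0" unfolding u_def by (rule cInf_greatest) (auto simp: A_def)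
      have gt: "l < \<phi> t - \<phi> 0" if "\<bar>t\<bar> > u" for t
      proof -
        have "\<exists>s\<in>A. s < \<bar>t\<bar>" by (rule cInf_lessD[OF \<open>A \<noteq> {}\<close>]) (use that in \<open>simp add: u_def\<close>)
        then obtain s where s: "s \<in> A" "s < \<bar>t\<bar>" by blast
        have "\<phi> s \<le> \<phi> t" by (rule weight_mono[OF w]) (use s in \<open>auto simp: A_def\<close>)
        then show ?thesis using s by (auto simp: A_def)
      qed
      have lt: "\<not> l < \<phi> t - \<phi> 0" if "\<bar>t\<bar> < u" for t
      proof
        assume "l < \<phi> t - \<phi> 0"
        then have "\<bar>t\<bar> \<in> A" unfolding A_def using weight_abs[OF w, of t] by simp
        then show False using cInf_lower[OF _ bdd] that by (force simp: u_def)
      qed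
      let ?g = "\<lambda>t. if \<bar>t\<bar> \<ge> u then k t else 0"
      have "(\<integral>t. f t l \<partial>lborel) = (\<integral>t. ?g t \<partial>lborel)"
      proof (rule integral_cong_AE)
        show "AE t in lborel. f t l = ?g t"
          using AE_lborel_singleton[of u] AE_lborel_singleton[of "- u"]
        proof eventually_elim
          case (elim t)
          then have "\<bar>t\<bar> < u \<or> \<bar>t\<bar> > u" by linarith
          then show ?case
          proof
            assume "\<bar>t\<bar> < u"
            then show ?case using lt[of t] by (simp add: f_def)
          next
            assume "\<bar>t\<bar> > u"
            then show ?case using gt[of t] True by (simp add: f_def)
          qed
        qed
        show "(\<lambda>t. f t l) \<in> borel_measurable lborel"
        proof -
          have "(\<lambda>t. (if 0 < l \<and> l < \<phi> t - \<phi> 0 then 1 else 0) * k t) \<in> borel_measurable lborel" by measurable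
          also have "(\<lambda>t. (if 0 < l \<and> l < \<phi> t - \<phi> 0 then 1 else 0) * k t) = (\<lambda>t. f t l)"
            by (auto simp: f_def fun_eq_iff indicator_def)
          finally show ?thesis .
        qed
        have "(\<lambda>t. \<bar>t\<bar>) \<in> borel_measurable (lborel :: real measure)" by measurable
        then show "?g \<in> borel_measurable lborel" by measurable
      qed
      also have "\<dots> = 2 *\<^sub>R (LINT t:{0..}|lborel. ?g t)"
      proof (rule even_integral_lborel(2))
        show "set_integrable lborel {0..} ?g" unfolding set_integrable_def
          by (rule Bochner_Integration.integrable_bound[OF k]) (auto simp: indicator_def)
      qed (auto simp: even)
      also have "(LINT t:{0..}|lborel. ?g t) = (LINT t:{u..}|lborel. k t)"
        unfolding set_lebesgue_integral_def using u0
        by (intro Bochner_Integration.integral_cong) (auto simp: indicator_def)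
      finally show ?thesis using tail[OF u0] by simp
    qed
  qed
qed

text \<open>Up to sign, the second derivative in \<open>y\<close> of \<open>poisson_kernel 0 y t\<close>, hence also its second derivative in \<open>x\<close> at \<open>x = 0\<close>
after symmetrisation in \<open>t\<close>.\<close>

definition curvature_kernel :: "real \<Rightarrow> real \<Rightarrow> real" where
  "curvature_kernel y t = 2 * y * (3 * t\<^sup>2 - y\<^sup>2) / (pi * (t\<^sup>2 + y\<^sup>2) ^ 3)"

text \<open>The derivative in \<open>y\<close> of \<open>poisson_kernel 0 y t\<close>.\<close>

definition slope_kernel :: "real \<Rightarrow> real \<Rightarrow> real" where
  "slope_kernel y t = (t\<^sup>2 - y\<^sup>2) / (pi * (t\<^sup>2 + y\<^sup>2)\<^sup>2)"

definition curvature :: "(real \<Rightarrow> real) \<Rightarrow> real \<Rightarrow> real" where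
  "curvature \<phi> y = (\<integral>t. \<phi> t * curvature_kernel y t \<partial>lborel)"

lemma kernels_measurable[measurable]: "curvature_kernel y \<in> borel_measurable borel" "slope_kernel y \<in> borel_measurable borel"
  unfolding curvature_kernel_def slope_kernel_def by measurable

lemma sq_sum_pos: "y > 0 \<Longrightarrow> (t::real)\<^sup>2 + y\<^sup>2 > 0"
  by (simp add: add_nonneg_pos)

lemma curvature_kernel_abs_le: assumes "y > 0" shows "\<bar>curvature_kernel y t\<bar> \<le> 6 * y / (pi * (t\<^sup>2 + y\<^sup>2)\<^sup>2)"
proof -
  let ?s = "t\<^sup>2 + y\<^sup>2"
  have s: "?s > 0" by (rule sq_sum_pos[OF assms])
  have "\<bar>3 * t\<^sup>2 - y\<^sup>2\<bar> \<le> 3 * ?s" using zero_le_power2[of t] zero_le_power2[of y] by (simp add: abs_le_iff)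
  then have "\<bar>curvature_kernel y t\<bar> \<le> 2 * y * (3 * ?s) / (pi * ?s ^ 3)"
    using assms s unfolding curvature_kernel_def
    by (simp add: abs_mult abs_divide abs_of_pos divide_right_mono mult_left_mono)
  also have "\<dots> = (?s * (6 * y)) / (?s * (pi * ?s\<^sup>2))"
    by (rule arg_cong2[of _ _ _ _ "(/)"]) (simp_all add: power2_eq_square power3_eq_cube algebra_simps)
  also have "\<dots> = 6 * y / (pi * ?s\<^sup>2)" using s by simp
  finally show ?thesis .
qed

lemma slope_kernel_abs_le: assumes "y > 0" shows "\<bar>slope_kernel y t\<bar> \<le> 1 / (pi * (t\<^sup>2 + y\<^sup>2))"
proof -
  let ?s = "t\<^sup>2 + y\<^sup>2"
  have s: "?s > 0" by (rule sq_sum_pos[OF assms])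
  have "\<bar>t\<^sup>2 - y\<^sup>2\<bar> \<le> ?s" using zero_le_power2[of t] zero_le_power2[of y] by (simp add: abs_le_iff)
  then have "\<bar>slope_kernel y t\<bar> \<le> ?s / (pi * ?s\<^sup>2)"
    using s unfolding slope_kernel_def by (simp add: abs_mult abs_divide abs_of_pos divide_right_mono)
  also have "\<dots> = 1 / (pi * ?s)" using s by (simp add: power2_eq_square)
  finally show ?thesis .
qed

lemma inverse_sq_sum_bound:
  fixes y :: real assumes "y > 0" shows "\<exists>C>0. \<forall>t. 1 / (t\<^sup>2 + y\<^sup>2) \<le> C / (1 + t\<^sup>2)"
proof -
  define C where "C = max 2 (1 / y\<^sup>2)"
  have "1 / y\<^sup>2 \<le> C" unfolding C_def by simp
  then have C: "C * y\<^sup>2 \<ge> 1 + 2 * 0\<^sup>2" using assms by (simp add: pos_divide_le_eq)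
  have C2: "C \<ge> 2" by (simp add: C_def)
  have "1 / (t\<^sup>2 + y\<^sup>2) \<le> C / (1 + t\<^sup>2)" for t
    using one_plus_sq_le[OF assms C2 C, of t] sq_sum_pos[OF assms, of t]
    by (simp add: divide_simps mult.commute add_pos_nonneg)
  then show ?thesis using C2 by (intro exI[of _ C]) auto
qed

lemma bound_kernel_integrable:
  assumes \<phi>: "log_integrable \<phi>" and y: "y > 0" and k: "k \<in> borel_measurable borel"
    and b: "\<And>t. \<bar>k t\<bar> \<le> C / (t\<^sup>2 + y\<^sup>2)" 
  shows "integrable lborel (\<lambda>t. \<phi> t * (k t :: real))"
proof -
  obtain D where D: "D > 0" "\<And>t. 1 / (t\<^sup>2 + y\<^sup>2) \<le> D / (1 + t\<^sup>2)" using inverse_sq_sum_bound[OF y] by blast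
  have C0: "C \<ge> 0" using b[of 0] y order_trans[OF abs_ge_zero b[of 0]] by (simp add: zero_le_divide_iff)
  have "norm (k t) \<le> (C * D) / (1 + t\<^sup>2)" for t
    using order_trans[OF b[of t]] mult_left_mono[OF D(2)[of t] C0] by simp
  from log_integrable_times_kernel[OF \<phi> k this] show ?thesis by simp
qed

lemma inverse_sq_sum_sq_bound:
  fixes y t :: real assumes y: "y > 0" shows "1 / (t\<^sup>2 + y\<^sup>2)\<^sup>2 \<le> (1 / y\<^sup>2) / (t\<^sup>2 + y\<^sup>2)"
proof -
  have s: "t\<^sup>2 + y\<^sup>2 > 0" by (rule sq_sum_pos[OF y])
  have "1 / (t\<^sup>2 + y\<^sup>2) \<le> 1 / y\<^sup>2" using y s by (intro divide_left_mono mult_pos_pos) auto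
  then have "1 / (t\<^sup>2 + y\<^sup>2) * (1 / (t\<^sup>2 + y\<^sup>2)) \<le> 1 / y\<^sup>2 * (1 / (t\<^sup>2 + y\<^sup>2))" using s by (intro mult_right_mono) auto
  then show ?thesis by (simp add: power2_eq_square)
qed

lemma kernels_integrable:
  assumes \<phi>: "log_integrable \<phi>" and y: "y > 0"
  shows "integrable lborel (\<lambda>t. \<phi> t * curvature_kernel y t)" "integrable lborel (\<lambda>t. \<phi> t * slope_kernel y t)"
    "integrable lborel (\<lambda>t. \<phi> t * (1 / (t\<^sup>2 + y\<^sup>2)\<^sup>2))"
proof -
  have "\<bar>curvature_kernel y t\<bar> \<le> (6 * y / pi / y\<^sup>2) / (t\<^sup>2 + y\<^sup>2)" for t
    using order_trans[OF curvature_kernel_abs_le[OF y, of t]] mult_left_mono[OF inverse_sq_sum_sq_bound[OF y, of t], of "6 * y / pi"] y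
    by simp
  then show "integrable lborel (\<lambda>t. \<phi> t * curvature_kernel y t)" by (intro bound_kernel_integrable[OF \<phi> y, of _ "6 * y / pi / y\<^sup>2"]) auto
  show "integrable lborel (\<lambda>t. \<phi> t * slope_kernel y t)"
    by (rule bound_kernel_integrable[OF \<phi> y, of _ "1/pi"]) (use slope_kernel_abs_le[OF y] in auto)
  show "integrable lborel (\<lambda>t. \<phi> t * (1 / (t\<^sup>2 + y\<^sup>2)\<^sup>2))"
    by (rule bound_kernel_integrable[OF \<phi> y, of _ "1 / y\<^sup>2"]) (use inverse_sq_sum_sq_bound[OF y] in auto)
qed

lemma curvature_kernel_integrable: "y > 0 \<Longrightarrow> integrable lborel (curvature_kernel y)"
  using kernels_integrable(1)[OF log_integrable_const[of 1]] by simp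

lemma curvature_antiderivative_tendsto: "((\<lambda>t::real. - (2 * y * t) / (pi * (t\<^sup>2 + y\<^sup>2)\<^sup>2)) \<longlongrightarrow> 0) at_top"
  by real_asymp

text \<open>The kernel has an elementary antiderivative, and its tail integrals are positive although it changes sign.\<close>

lemma curvature_kernel_tail:
  assumes y: "y > 0" shows "(LINT t:{u..}|lborel. curvature_kernel y t) = 2 * y * u / (pi * (u\<^sup>2 + y\<^sup>2)\<^sup>2)"
proof -
  have nz: "t\<^sup>2 + y\<^sup>2 \<noteq> 0" for t using sq_sum_pos[OF y, of t] by (metis less_irrefl)
  have "(LINT t:{u..}|lborel. curvature_kernel y t) = 0 - (- (2 * y * u) / (pi * (u\<^sup>2 + y\<^sup>2)\<^sup>2))"
  proof (rule set_integral_FTC_atLeast)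
    show "set_integrable lborel {u..} (curvature_kernel y)" unfolding set_integrable_def
      by (rule Bochner_Integration.integrable_bound[OF curvature_kernel_integrable[OF y]]) (auto simp: indicator_def)
    show "((\<lambda>t. - (2 * y * t) / (pi * (t\<^sup>2 + y\<^sup>2)\<^sup>2)) has_vector_derivative curvature_kernel y t) (at t)" for t
    proof -
      let ?s = "t\<^sup>2 + y\<^sup>2"
      have den: "((\<lambda>t. pi * (t\<^sup>2 + y\<^sup>2)\<^sup>2) has_real_derivative pi * (4 * t * ?s)) (at t)"
        by (auto intro!: derivative_eq_intros)
      have num: "((\<lambda>t. - (2 * y * t)) has_real_derivative - (2 * y)) (at t)"
        by (auto intro!: derivative_eq_intros)
      have "((\<lambda>t. - (2 * y * t) / (pi * (t\<^sup>2 + y\<^sup>2)\<^sup>2)) has_real_derivative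
          (- (2 * y) * (pi * ?s\<^sup>2) - (- (2 * y * t)) * (pi * (4 * t * ?s))) / ((pi * ?s\<^sup>2) * (pi * ?s\<^sup>2))) (at t)"
        by (rule DERIV_divide[OF num den]) (simp only: mult_eq_0_iff power_eq_0_iff nz[of t] pi_neq_zero simp_thms)
      also have "(- (2 * y) * (pi * ?s\<^sup>2) - (- (2 * y * t)) * (pi * (4 * t * ?s))) / ((pi * ?s\<^sup>2) * (pi * ?s\<^sup>2))
          = ((pi * ?s) * (2 * y * (4 * t\<^sup>2 - ?s))) / ((pi * ?s) * (pi * ?s ^ 3))"
        by (rule arg_cong2[of _ _ _ _ "(/)"]) (simp_all add: power2_eq_square power3_eq_cube algebra_simps)
      also have "\<dots> = 2 * y * (4 * t\<^sup>2 - ?s) / (pi * ?s ^ 3)"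
        by (rule mult_divide_mult_cancel_left) (simp only: mult_eq_0_iff nz[of t] pi_neq_zero simp_thms)
      also have "\<dots> = curvature_kernel y t" unfolding curvature_kernel_def by simp
      finally show ?thesis by (simp add: has_real_derivative_iff_has_vector_derivative)
    qed
    show "continuous_on {u..} (curvature_kernel y)" unfolding curvature_kernel_def by (intro continuous_intros) (simp only: mult_eq_0_iff power_eq_0_iff nz pi_neq_zero simp_thms ball_simps, simp)
  qed (rule curvature_antiderivative_tendsto)
  then show ?thesis by simp
qed

lemma curvature_kernel_even: "curvature_kernel y (- t) = curvature_kernel y t" by (simp add: curvature_kernel_def)

lemma curvature_kernel_integral: "y > 0 \<Longrightarrow> (\<integral>t. curvature_kernel y t \<partial>lborel) = 0"
  using even_integral_lborel(2)[of "curvature_kernel y", OF curvature_kernel_even integrable_imp_set_integrable[OF curvature_kernel_integrable[of y]]] curvature_kernel_tail[of y 0]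
  by simp

text \<open>The kernel changes sign at different places for \<open>y\<close> and \<open>y'\<close>, so the kernels cannot be compared pointwise; their tail
integrals can, and for increasing weights this is enough.\<close>

lemma curvature_slowly_varying:
  assumes w: "weight \<phi>" and \<phi>: "log_integrable \<phi>" and y: "0 < y" "y \<le> y'" "y'\<^sup>2 \<le> 2 * y\<^sup>2"
  shows "curvature \<phi> y / 4 \<le> curvature \<phi> y'"
proof -
  have y': "y' > 0" using y by simp
  let ?k = "\<lambda>t. curvature_kernel y' t - curvature_kernel y t / 4"
  have "(\<integral>t. \<phi> t * ?k t \<partial>lborel) \<ge> 0"
  proof (rule monotone_integral_nonneg[OF w])
    show k: "integrable lborel ?k" using curvature_kernel_integrable[OF y'] curvature_kernel_integrable[OF y(1)] by simp
    show "integrable lborel (\<lambda>t. \<phi> t * ?k t)"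
      using kernels_integrable(1)[OF \<phi> y'] kernels_integrable(1)[OF \<phi> y(1)] by (simp add: right_diff_distrib)
    show "(\<integral>t. ?k t \<partial>lborel) = 0"
      using curvature_kernel_integrable[OF y'] curvature_kernel_integrable[OF y(1)] by (simp add: curvature_kernel_integral y' y)
    fix u :: real assume u: "u \<ge> 0"
    have si: "set_integrable lborel {u..} (curvature_kernel y)" if "y > 0" for y
      by (rule integrable_imp_set_integrable[OF curvature_kernel_integrable[OF that]]) simp
    have s: "u\<^sup>2 + y\<^sup>2 > 0" "u\<^sup>2 + y'\<^sup>2 > 0" by (auto intro: sq_sum_pos y y')
    have "u\<^sup>2 + y'\<^sup>2 \<le> 2 * u\<^sup>2 + 2 * y\<^sup>2" by (intro add_mono y(3)) simp
    then have "u\<^sup>2 + y'\<^sup>2 \<le> 2 * (u\<^sup>2 + y\<^sup>2)" by (simp only: distrib_left)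
    then have "(u\<^sup>2 + y'\<^sup>2)\<^sup>2 \<le> (2 * (u\<^sup>2 + y\<^sup>2))\<^sup>2" by (rule power_mono) (rule less_imp_le[OF s(2)])
    then have "(u\<^sup>2 + y'\<^sup>2)\<^sup>2 \<le> 4 * (u\<^sup>2 + y\<^sup>2)\<^sup>2" by (simp only: power_mult_distrib) simp
    then have "1 / (4 * (u\<^sup>2 + y\<^sup>2)\<^sup>2) \<le> 1 / (u\<^sup>2 + y'\<^sup>2)\<^sup>2" using s by (intro divide_left_mono mult_pos_pos) auto
    then have "(2 * y * u / pi) * (1 / (4 * (u\<^sup>2 + y\<^sup>2)\<^sup>2)) \<le> (2 * y' * u / pi) * (1 / (u\<^sup>2 + y'\<^sup>2)\<^sup>2)"
      using u y by (intro mult_mono divide_right_mono mult_right_mono) auto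
    then have "(LINT t:{u..}|lborel. curvature_kernel y t) / 4 \<le> (LINT t:{u..}|lborel. curvature_kernel y' t)"
      unfolding curvature_kernel_tail[OF y(1)] curvature_kernel_tail[OF y'] by simp
    moreover have "(LINT t:{u..}|lborel. ?k t) = (LINT t:{u..}|lborel. curvature_kernel y' t) - (LINT t:{u..}|lborel. curvature_kernel y t) / 4"
      using si[OF y'] si[OF y(1)] by (subst set_integral_diff) auto
    ultimately show "(LINT t:{u..}|lborel. ?k t) \<ge> 0" by simp
  qed (simp add: curvature_kernel_even)
  then show ?thesis
    using kernels_integrable(1)[OF \<phi> y'] kernels_integrable(1)[OF \<phi> y(1)] by (simp add: right_diff_distrib curvature_def)
qed

text \<open>If a kernel of total mass zero goes from negative to positive at \<open>t0\<close>, subtracting the constant \<open>\<phi> t0\<close> makes the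
integrand nonnegative everywhere, so that parts of the integral may be dropped.\<close>

lemma single_sign_change_integral:
  fixes \<phi> k :: "real \<Rightarrow> real"
  assumes w: "weight \<phi>" and k: "integrable lborel k" "(\<integral>t. k t \<partial>lborel) = 0" 
    and \<phi>k: "integrable lborel (\<lambda>t. \<phi> t * k t)"
    and neg: "\<And>t. \<bar>t\<bar> \<le> t0 \<Longrightarrow> k t \<le> 0" and pos: "\<And>t. \<bar>t\<bar> \<ge> t0 \<Longrightarrow> k t \<ge> 0" and t0: "t0 \<ge> 0"
  shows "(\<integral>t. \<phi> t * k t \<partial>lborel) = (\<integral>t. (\<phi> t - \<phi> t0) * k t \<partial>lborel)" "\<And>t. (\<phi> t - \<phi> t0) * k t \<ge> 0"
proof -
  show "(\<integral>t. \<phi> t * k t \<partial>lborel) = (\<integral>t. (\<phi> t - \<phi> t0) * k t \<partial>lborel)"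
    using k \<phi>k by (simp add: left_diff_distrib)
  fix t
  show "(\<phi> t - \<phi> t0) * k t \<ge> 0"
  proof (cases "\<bar>t\<bar> \<le> t0")
    case True
    then show ?thesis using neg[of t] weight_mono[OF w, of t t0] t0 by (intro mult_nonpos_nonpos) auto
  next
    case False
    then show ?thesis using pos[of t] weight_mono[OF w, of t0 t] t0 by (intro mult_nonneg_nonneg) auto
  qed
qed

lemma curvature_kernel_sign:
  assumes "y > 0"
  shows "3 * t\<^sup>2 \<le> y\<^sup>2 \<Longrightarrow> curvature_kernel y t \<le> 0" "3 * t\<^sup>2 \<ge> y\<^sup>2 \<Longrightarrow> curvature_kernel y t \<ge> 0"
  using sq_sum_pos[OF assms, of t] assms unfolding curvature_kernel_def
  by (auto intro!: divide_nonpos_pos divide_nonneg_pos mult_nonneg_nonpos)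

lemma sq_threshold: 
  fixes y t :: real assumes "y \<ge> 0"
  shows "\<bar>t\<bar> \<le> y / sqrt 3 \<Longrightarrow> 3 * t\<^sup>2 \<le> y\<^sup>2" "\<bar>t\<bar> \<ge> y / sqrt 3 \<Longrightarrow> 3 * t\<^sup>2 \<ge> y\<^sup>2"
proof -
  have e: "(y / sqrt 3)\<^sup>2 = y\<^sup>2 / 3" by (simp add: power_divide)
  show "\<bar>t\<bar> \<le> y / sqrt 3 \<Longrightarrow> 3 * t\<^sup>2 \<le> y\<^sup>2"
    using power_mono[of "\<bar>t\<bar>" "y / sqrt 3" 2] e by simp
  show "\<bar>t\<bar> \<ge> y / sqrt 3 \<Longrightarrow> 3 * t\<^sup>2 \<ge> y\<^sup>2"
    using power_mono[of "y / sqrt 3" "\<bar>t\<bar>" 2] e assms by simp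
qed

text \<open>The kernel changes sign at \<open>y / sqrt 3 < y\<close>. Only the range \<open>\<bar>t\<bar> \<ge> 2 * y\<close> is kept, where the logarithmic slope \<open>n\<close> at
\<open>y\<close> gives \<open>\<phi> t - \<phi> y \<ge> n * ln 2\<close>.\<close>

lemma curvature_lower_bound:
  assumes w: "weight \<phi>" and \<phi>: "log_integrable \<phi>" and y: "y > 0" and n: "n \<ge> 0"
    and slope: "\<And>t. t \<ge> y \<Longrightarrow> \<phi> t \<ge> \<phi> y + n * ln (t / y)"
  shows "curvature \<phi> y \<ge> n / (25 * y\<^sup>2)"
proof -
  define t0 where "t0 = y / sqrt 3"
  have t0: "t0 \<ge> 0" "t0 \<le> y" using y by (auto simp: t0_def pos_divide_le_eq mult_le_cancel_left1)
  note ssc = single_sign_change_integral[OF w curvature_kernel_integrable[OF y] curvature_kernel_integral[OF y] kernels_integrable(1)[OF \<phi> y], of t0]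
  have neg: "\<bar>t\<bar> \<le> t0 \<Longrightarrow> curvature_kernel y t \<le> 0" and pos: "\<bar>t\<bar> \<ge> t0 \<Longrightarrow> curvature_kernel y t \<ge> 0" for t
    using sq_threshold[of y t] curvature_kernel_sign[OF y, of t] y by (auto simp: t0_def)
  let ?h = "\<lambda>t. (if \<bar>t\<bar> \<ge> 2 * y then n / 2 * curvature_kernel y t else 0)"
  have hs: "set_integrable lborel {0..} ?h" unfolding set_integrable_def
    by (rule Bochner_Integration.integrable_bound[OF integrable_mult_right[OF curvature_kernel_integrable[OF y], of "n/2"]])
       (auto simp: indicator_def)
  have he: "?h (- t) = ?h t" for t by (simp add: curvature_kernel_even)
  have "2 *\<^sub>R (LINT t:{0..}|lborel. ?h t) = (\<integral>t. ?h t \<partial>lborel)"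
    by (rule even_integral_lborel(2)[OF he hs, symmetric])
  also have "\<dots> \<le> (\<integral>t. (\<phi> t - \<phi> t0) * curvature_kernel y t \<partial>lborel)"
  proof (rule integral_mono)
    show "integrable lborel ?h" by (rule even_integral_lborel(1)[OF he hs])
    show "integrable lborel (\<lambda>t. (\<phi> t - \<phi> t0) * curvature_kernel y t)"
      using kernels_integrable(1)[OF \<phi> y] curvature_kernel_integrable[OF y] by (simp add: left_diff_distrib)
    fix t
    show "?h t \<le> (\<phi> t - \<phi> t0) * curvature_kernel y t"
    proof (cases "\<bar>t\<bar> \<ge> 2 * y")
      case True
      have "1/2 \<le> ln (2::real)" using ln2_ge_two_thirds by simp
      also have "\<dots> \<le> ln (\<bar>t\<bar> / y)" using True y by (intro ln_mono) (auto simp: pos_le_divide_eq)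
      finally have "n * (1/2) \<le> n * ln (\<bar>t\<bar> / y)" using n by (rule mult_left_mono)
      then have "\<phi> t \<ge> \<phi> y + n / 2" using slope[of "\<bar>t\<bar>"] True y by (simp add: weight_abs[OF w])
      moreover have "\<phi> t0 \<le> \<phi> y" by (rule weight_mono[OF w]) (use t0 in auto)
      ultimately have "n / 2 * curvature_kernel y t \<le> (\<phi> t - \<phi> t0) * curvature_kernel y t"
        using pos[of t] t0 True y by (intro mult_right_mono) auto
      then show ?thesis using True by simp
    next
      case False
      then show ?thesis using ssc(2)[OF neg pos t0(1)] by simp
    qed
  qed
  also have "\<dots> = curvature \<phi> y" unfolding curvature_def using ssc(1)[OF neg pos t0(1)] by simp
  finally have "2 * (LINT t:{0..}|lborel. ?h t) \<le> curvature \<phi> y" by simp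
  moreover have "(LINT t:{0..}|lborel. ?h t) = (LINT t:{2*y..}|lborel. n / 2 * curvature_kernel y t)"
    unfolding set_lebesgue_integral_def using y
    by (intro Bochner_Integration.integral_cong) (auto simp: indicator_def)
  moreover have "(LINT t:{2*y..}|lborel. n / 2 * curvature_kernel y t) = n / 2 * (2 * y * (2 * y) / (pi * ((2*y)\<^sup>2 + y\<^sup>2)\<^sup>2))"
    unfolding set_integral_mult_right curvature_kernel_tail[OF y] ..
  moreover have "2 * (n / 2 * (2 * y * (2 * y) / (pi * ((2*y)\<^sup>2 + y\<^sup>2)\<^sup>2))) \<ge> n / (25 * y\<^sup>2)"
  proof -
    have "((2*y)\<^sup>2 + y\<^sup>2)\<^sup>2 = 25 * y\<^sup>2 * y\<^sup>2" by (simp add: power2_eq_square)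
    then have "2 * (n / 2 * (2 * y * (2 * y) / (pi * ((2*y)\<^sup>2 + y\<^sup>2)\<^sup>2))) = n / (25 * y\<^sup>2) * (4 / pi)"
      using y by (simp add: power2_eq_square field_simps)
    moreover have "4 / pi \<ge> 1" using pi_less_4 by (simp add: pos_le_divide_eq)
    moreover have "n / (25 * y\<^sup>2) \<ge> 0" using n by simp
    ultimately show ?thesis using mult_left_mono[of 1 "4 / pi" "n / (25 * y\<^sup>2)"] by simp
  qed
  ultimately show ?thesis by linarith
qed

lemma curvature_upper_bound:
  assumes \<phi>: "log_integrable \<phi>"
  shows "\<exists>C>0. \<forall>y\<ge>1. curvature \<phi> y \<le> C / y"
proof -
  define K where "K = (\<integral>t. \<bar>\<phi> t\<bar> / (1 + t\<^sup>2) \<partial>lborel)"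
  have K: "K \<ge> 0" unfolding K_def by (intro integral_nonneg_AE) auto
  have "curvature \<phi> y \<le> (2 * K + 1) / y" if y: "y \<ge> 1" for y
  proof -
    have y0: "y > 0" using y by simp
    have "curvature \<phi> y \<le> (\<integral>t. 2 / y * (\<bar>\<phi> t\<bar> / (1 + t\<^sup>2)) \<partial>lborel)"
      unfolding curvature_def
    proof (rule integral_mono)
      show "integrable lborel (\<lambda>t. 2 / y * (\<bar>\<phi> t\<bar> / (1 + t\<^sup>2)))"
        using log_integrable_abs[OF \<phi>] unfolding log_integrable_def by (rule integrable_mult_right)
      show "integrable lborel (\<lambda>t. \<phi> t * curvature_kernel y t)" by (rule kernels_integrable(1)[OF \<phi> y0])
      fix t
      have s: "t\<^sup>2 + y\<^sup>2 > 0" by (rule sq_sum_pos[OF y0])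
      have "y\<^sup>2 \<ge> 1" using y by simp
      then have "y\<^sup>2 * (1 + t\<^sup>2) \<le> (t\<^sup>2 + y\<^sup>2)\<^sup>2" 
        unfolding power2_eq_square[of "t\<^sup>2 + y\<^sup>2"] by (intro mult_mono) auto
      then have "6 * y / (pi * (t\<^sup>2 + y\<^sup>2)\<^sup>2) \<le> 6 * y / (3 * (y\<^sup>2 * (1 + t\<^sup>2)))"
        using y0 s pi_gt3 by (intro divide_left_mono mult_mono mult_pos_pos) (auto simp: add_pos_nonneg)
      also have "\<dots> = 2 / y * (1 / (1 + t\<^sup>2))" using y0 by (simp add: power2_eq_square)
      finally have "\<bar>curvature_kernel y t\<bar> \<le> 2 / y * (1 / (1 + t\<^sup>2))" using curvature_kernel_abs_le[OF y0, of t] by simp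
      then have "\<bar>\<phi> t\<bar> * \<bar>curvature_kernel y t\<bar> \<le> \<bar>\<phi> t\<bar> * (2 / y * (1 / (1 + t\<^sup>2)))" by (rule mult_left_mono) simp
      then show "\<phi> t * curvature_kernel y t \<le> 2 / y * (\<bar>\<phi> t\<bar> / (1 + t\<^sup>2))"
        using abs_ge_self[of "\<phi> t * curvature_kernel y t"] by (simp add: abs_mult mult.commute)
    qed
    also have "\<dots> = 2 / y * K" unfolding K_def by (rule Bochner_Integration.integral_mult_right_zero)
    also have "\<dots> \<le> (2 * K + 1) / y" using y0 by (simp add: divide_right_mono)
    finally show ?thesis .
  qed
  then show ?thesis using K by (intro exI[of _ "2 * K + 1"]) auto
qed

section \<open>Growth of the Poisson integral away from the imaginary axis\<close>

lemma poisson_symmetrized: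
  assumes "log_integrable \<phi>" "\<And>t. \<phi> (- t) = \<phi> t" "y > 0"
  shows "poisson \<phi> x y = (\<integral>t. \<phi> t * ((poisson_kernel x y t + poisson_kernel (- x) y t) / 2) \<partial>lborel)"
proof -
  have "(\<integral>t. \<phi> t * ((poisson_kernel x y t + poisson_kernel (- x) y t) / 2) \<partial>lborel)
      = (\<integral>t. (\<phi> t * poisson_kernel x y t + \<phi> t * poisson_kernel (- x) y t) / 2 \<partial>lborel)"
    by (intro Bochner_Integration.integral_cong) (simp_all add: algebra_simps add_divide_distrib)
  also have "\<dots> = (poisson \<phi> x y + poisson \<phi> (- x) y) / 2"
    unfolding poisson_def using poisson_integrable[OF assms(1,3)]
    by (simp only: Bochner_Integration.integral_divide_zero Bochner_Integration.integral_add)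
  also have "poisson \<phi> (- x) y = poisson \<phi> x y" using assms(2) by (rule poisson_uminus_arg)
  finally show ?thesis by simp
qed

lemma poisson_kernel_reflect: "poisson_kernel x y (- t) = poisson_kernel (- x) y t"
  unfolding poisson_kernel_def by (simp add: power2_eq_square algebra_simps)

lemma poisson_kernel_difference:
  assumes y: "y > 0"
  shows "(poisson_kernel x y t + poisson_kernel (- x) y t) / 2 - poisson_kernel 0 y t =
    y * x\<^sup>2 / pi * ((3 * t\<^sup>2 - (x\<^sup>2 + y\<^sup>2)) / ((t\<^sup>2 + y\<^sup>2) * (((t - x)\<^sup>2 + y\<^sup>2) * ((t + x)\<^sup>2 + y\<^sup>2))))"
proof -
  define p q r where "p = (t - x)\<^sup>2 + y\<^sup>2" and "q = (t + x)\<^sup>2 + y\<^sup>2" and "r = t\<^sup>2 + y\<^sup>2"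
  have pos: "p > 0" "q > 0" "r > 0" using y by (auto simp: p_def q_def r_def add_nonneg_pos)
  have "(poisson_kernel x y t + poisson_kernel (- x) y t) / 2 - poisson_kernel 0 y t = y / pi * ((1 / p + 1 / q) / 2 - 1 / r)"
    by (simp add: poisson_kernel_def p_def q_def r_def algebra_simps add_divide_distrib diff_divide_distrib)
  also have "(1 / p + 1 / q) / 2 - 1 / r = ((p + q) * r - 2 * (p * q)) / (2 * (r * (p * q)))"
    using pos by (simp add: field_simps)
  also have "(p + q) * r - 2 * (p * q) = 2 * (x\<^sup>2 * (3 * t\<^sup>2 - (x\<^sup>2 + y\<^sup>2)))"
    unfolding p_def q_def r_def by (simp add: power2_eq_square algebra_simps)
  finally show ?thesis by (simp add: p_def q_def r_def)
qed

text \<open>With \<open>a\<^sup>2 = x\<^sup>2 + y\<^sup>2\<close>, the kernel of the increment and \<open>curvature_kernel a\<close> change sign at the same points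
\<open>3 * t\<^sup>2 = a\<^sup>2\<close>, and the first dominates a multiple of the second on either side.\<close>

lemma poisson_increment_lower:
  assumes w: "weight \<phi>" and \<phi>: "log_integrable \<phi>" and y: "y > 0"
  shows "poisson \<phi> x y - poisson \<phi> 0 y \<ge> (y * x\<^sup>2 / (2 * sqrt (x\<^sup>2 + y\<^sup>2))) * curvature \<phi> (sqrt (x\<^sup>2 + y\<^sup>2))"
proof -
  define a where "a = sqrt (x\<^sup>2 + y\<^sup>2)"
  define c where "c = y * x\<^sup>2 / (2 * a)"
  have a2: "a\<^sup>2 = x\<^sup>2 + y\<^sup>2" unfolding a_def by simp
  have a: "a > 0" unfolding a_def using sq_sum_pos[OF y] by simp
  let ?D = "\<lambda>t. (poisson_kernel x y t + poisson_kernel (- x) y t) / 2 - poisson_kernel 0 y t"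
  let ?k = "\<lambda>t. ?D t - c * curvature_kernel a t"
  define t0 where "t0 = a / sqrt 3"
  have t0: "t0 \<ge> 0" using a by (simp add: t0_def)
  have keq: "?k t = y * x\<^sup>2 / pi * ((3 * t\<^sup>2 - a\<^sup>2) * (1 / ((t\<^sup>2 + y\<^sup>2) * (((t - x)\<^sup>2 + y\<^sup>2) * ((t + x)\<^sup>2 + y\<^sup>2))) - 1 / (t\<^sup>2 + a\<^sup>2) ^ 3))" for t
  proof -
    have "c * curvature_kernel a t = y * x\<^sup>2 / pi * ((3 * t\<^sup>2 - a\<^sup>2) * (1 / (t\<^sup>2 + a\<^sup>2) ^ 3))"
      using a by (simp add: c_def curvature_kernel_def)
    then show ?thesis unfolding poisson_kernel_difference[OF y] a2[symmetric]
      by (simp add: right_diff_distrib)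
  qed
  have le: "1 / (t\<^sup>2 + a\<^sup>2) ^ 3 \<le> 1 / ((t\<^sup>2 + y\<^sup>2) * (((t - x)\<^sup>2 + y\<^sup>2) * ((t + x)\<^sup>2 + y\<^sup>2)))" for t
  proof (rule divide_left_mono)
    have s: "t\<^sup>2 + y\<^sup>2 > 0" "(t - x)\<^sup>2 + y\<^sup>2 > 0" "(t + x)\<^sup>2 + y\<^sup>2 > 0" "t\<^sup>2 + a\<^sup>2 > 0"
      using y a by (auto intro: add_nonneg_pos)
    have "((t - x)\<^sup>2 + y\<^sup>2) * ((t + x)\<^sup>2 + y\<^sup>2) = (t\<^sup>2 + a\<^sup>2)\<^sup>2 - 4 * (t\<^sup>2 * x\<^sup>2)"
      unfolding a2 by (simp add: power2_eq_square algebra_simps)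
    also have "\<dots> \<le> (t\<^sup>2 + a\<^sup>2)\<^sup>2" by simp
    finally have "(t\<^sup>2 + y\<^sup>2) * (((t - x)\<^sup>2 + y\<^sup>2) * ((t + x)\<^sup>2 + y\<^sup>2)) \<le> (t\<^sup>2 + a\<^sup>2) * (t\<^sup>2 + a\<^sup>2)\<^sup>2"
      using s by (intro mult_mono) (auto simp: a2)
    then show "(t\<^sup>2 + y\<^sup>2) * (((t - x)\<^sup>2 + y\<^sup>2) * ((t + x)\<^sup>2 + y\<^sup>2)) \<le> (t\<^sup>2 + a\<^sup>2) ^ 3"
      by (simp only: power3_eq_cube power2_eq_square mult.assoc)
    show "0 < (t\<^sup>2 + a\<^sup>2) ^ 3 * ((t\<^sup>2 + y\<^sup>2) * (((t - x)\<^sup>2 + y\<^sup>2) * ((t + x)\<^sup>2 + y\<^sup>2)))"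
      using s by simp
  qed simp
  have c0: "y * x\<^sup>2 / pi \<ge> 0" using y by simp
  have neg: "?k t \<le> 0" if "\<bar>t\<bar> \<le> t0" for t
    unfolding keq using sq_threshold(1)[of a t] that a le[of t] c0
    by (intro mult_nonneg_nonpos mult_nonpos_nonneg) (auto simp: t0_def)
  have pos: "?k t \<ge> 0" if "\<bar>t\<bar> \<ge> t0" for t
    unfolding keq using sq_threshold(2)[of a t] that a le[of t] c0
    by (intro mult_nonneg_nonneg) (auto simp: t0_def)
  have pk: "integrable lborel (poisson_kernel x y)" for x by (rule poisson_kernel_integral[OF y])
  have k: "integrable lborel ?k" using pk curvature_kernel_integrable[OF a] by simp
  have k0: "(\<integral>t. ?k t \<partial>lborel) = 0"
    using pk curvature_kernel_integrable[OF a] by (simp add: poisson_kernel_integral[OF y] curvature_kernel_integral[OF a])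
  have pi1: "integrable lborel (\<lambda>t. \<phi> t * ((poisson_kernel x y t + poisson_kernel (- x) y t) / 2))"
  proof -
    have "integrable lborel (\<lambda>t. (\<phi> t * poisson_kernel x y t + \<phi> t * poisson_kernel (- x) y t) / 2)"
      using poisson_integrable[OF \<phi> y] by simp
    then show ?thesis by (simp add: algebra_simps add_divide_distrib)
  qed
  have pi0: "integrable lborel (\<lambda>t. \<phi> t * poisson_kernel 0 y t)" by (rule poisson_integrable[OF \<phi> y])
  have ci: "integrable lborel (\<lambda>t. c * (\<phi> t * curvature_kernel a t))" using kernels_integrable(1)[OF \<phi> a] by simp
  have split: "\<phi> t * ?k t = \<phi> t * ((poisson_kernel x y t + poisson_kernel (- x) y t) / 2) - \<phi> t * poisson_kernel 0 y t - c * (\<phi> t * curvature_kernel a t)" for t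
    by (simp add: algebra_simps)
  have \<phi>k: "integrable lborel (\<lambda>t. \<phi> t * ?k t)" unfolding split using pi1 pi0 ci by (intro Bochner_Integration.integrable_diff)
  have "0 \<le> (\<integral>t. (\<phi> t - \<phi> t0) * ?k t \<partial>lborel)"
    by (intro integral_nonneg_AE AE_I2 single_sign_change_integral(2)[OF w k k0 \<phi>k neg pos t0])
  also have "\<dots> = (\<integral>t. \<phi> t * ?k t \<partial>lborel)" by (rule single_sign_change_integral(1)[OF w k k0 \<phi>k neg pos t0, symmetric])
  also have "\<dots> = poisson \<phi> x y - poisson \<phi> 0 y - c * curvature \<phi> a"
    unfolding split Bochner_Integration.integral_diff[OF Bochner_Integration.integrable_diff[OF pi1 pi0] ci]
      Bochner_Integration.integral_diff[OF pi1 pi0] Bochner_Integration.integral_mult_right_zero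
    by (simp only: poisson_symmetrized[OF \<phi> weight_even[OF w] y, of x] poisson_def[of \<phi> 0] curvature_def)
  finally show ?thesis unfolding a_def c_def by simp
qed

lemma curvature_nonneg:
  assumes w: "weight \<phi>" and \<phi>: "log_integrable \<phi>" and y: "y > 0" shows "curvature \<phi> y \<ge> 0"
  using curvature_lower_bound[OF w \<phi> y, of 0] weight_mono[OF w, of y] y by simp

lemma poisson_ge_axis:
  assumes w: "weight \<phi>" and \<phi>: "log_integrable \<phi>" and y: "y > 0"
  shows "poisson \<phi> 0 y \<le> poisson \<phi> x y"
proof -
  have "0 \<le> (y * x\<^sup>2 / (2 * sqrt (x\<^sup>2 + y\<^sup>2))) * curvature \<phi> (sqrt (x\<^sup>2 + y\<^sup>2))"
    using y by (intro mult_nonneg_nonneg curvature_nonneg w \<phi>) (auto simp: sq_sum_pos add_nonneg_pos)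
  then show ?thesis using poisson_increment_lower[OF w \<phi> y, of x] by linarith
qed

lemma poisson_kernel_tail:
  assumes y: "y > 0" shows "(LINT t:{u..}|lborel. poisson_kernel x y t) = 1 / 2 - arctan ((u - x) / y) / pi"
proof -
  have d: "((\<lambda>t. arctan ((t - x) / y) / pi) has_real_derivative poisson_kernel x y t) (at t)" for t
  proof -
    have "1 + ((t - x) / y)\<^sup>2 = ((t - x)\<^sup>2 + y\<^sup>2) / y\<^sup>2" using y by (simp add: field_simps power_divide)
    then have e: "inverse (1 + ((t - x) / y)\<^sup>2) * (1 / y) / pi = poisson_kernel x y t"
      unfolding poisson_kernel_def using y by (simp add: power2_eq_square)
    have "((\<lambda>t. arctan ((t - x) / y) / pi) has_real_derivative inverse (1 + ((t - x) / y)\<^sup>2) * (1 / y) / pi) (at t)"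
      using y by (auto intro!: derivative_eq_intros)
    then show ?thesis unfolding e .
  qed
  have lim: "((\<lambda>t. arctan ((t - x) / y) / pi) \<longlongrightarrow> (pi / 2) / pi) at_top"
  proof (intro tendsto_divide tendsto_const filterlim_compose[OF tendsto_arctan_at_top])
    show "filterlim (\<lambda>t. (t - x) / y) at_top at_top" using y by real_asymp
  qed simp
  have "(LINT t:{u..}|lborel. poisson_kernel x y t) = (pi / 2) / pi - arctan ((u - x) / y) / pi"
    by (rule set_integral_FTC_atLeast_nonneg(2)[OF poisson_kernel_measurable d _ lim]) (use poisson_kernel_pos[OF y] less_imp_le in auto)
  then show ?thesis by simp
qed

text \<open>The tail integrals of the symmetrised Poisson kernel are sums of two arctangents, and they increase with \<open>x\<close>: the
harmonic measure of \<open>{t. \<bar>t\<bar> > u}\<close> grows as the point moves away from the imaginary axis.\<close>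

lemma poisson_mono_arg:
  assumes w: "weight \<phi>" and \<phi>: "log_integrable \<phi>" and y: "y > 0" and x: "0 \<le> x'" "x' \<le> x"
  shows "poisson \<phi> x' y \<le> poisson \<phi> x y"
proof -
  let ?K = "\<lambda>x t. (poisson_kernel x y t + poisson_kernel (- x) y t) / 2"
  let ?k = "\<lambda>t. ?K x t - ?K x' t"
  have pk: "integrable lborel (poisson_kernel x y)" for x by (rule poisson_kernel_integral[OF y])
  have pi1: "integrable lborel (\<lambda>t. \<phi> t * ?K x t)" for x
  proof -
    have "integrable lborel (\<lambda>t. (\<phi> t * poisson_kernel x y t + \<phi> t * poisson_kernel (- x) y t) / 2)"
      using poisson_integrable[OF \<phi> y] by simp
    then show ?thesis by (simp add: algebra_simps add_divide_distrib)
  qed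
  have "(\<integral>t. \<phi> t * ?k t \<partial>lborel) \<ge> 0"
  proof (rule monotone_integral_nonneg[OF w])
    show "integrable lborel ?k" using pk by simp
    show "integrable lborel (\<lambda>t. \<phi> t * ?k t)" unfolding right_diff_distrib
      using pi1[of x] pi1[of x'] by (intro Bochner_Integration.integrable_diff)
    show "(\<integral>t. ?k t \<partial>lborel) = 0" using pk by (simp add: poisson_kernel_integral[OF y])
    show "?k (- t) = ?k t" for t by (simp only: poisson_kernel_reflect minus_minus add.commute)
    fix u :: real assume u: "u \<ge> 0"
    have si: "set_integrable lborel {u..} (poisson_kernel x y)" for x
      by (rule integrable_imp_set_integrable[OF pk]) simp
    have half: "(LINT t:{u..}|lborel. ?K x t) = 1 / 2 - (arctan ((u - x) / y) + arctan ((u + x) / y)) / (2 * pi)" for x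
    proof -
      have e: "(1 / 2 - A / pi + (1 / 2 - B / pi)) / 2 = 1 / 2 - (A + B) / (2 * pi)" for A B :: real
        by (simp add: field_simps)
      have "(LINT t:{u..}|lborel. ?K x t) = ((LINT t:{u..}|lborel. poisson_kernel x y t) + (LINT t:{u..}|lborel. poisson_kernel (- x) y t)) / 2"
        using si[of x] si[of "- x"] by (simp only: set_integral_divide_zero set_integral_add)
      then show ?thesis unfolding poisson_kernel_tail[OF y] e by simp
    qed
    have anti: "arctan ((u - x) / y) + arctan ((u + x) / y) \<le> arctan ((u - x') / y) + arctan ((u + x') / y)"
    proof (rule DERIV_nonpos_imp_nonincreasing[OF x(2)])
      fix v assume v: "x' \<le> v" "v \<le> x"
      let ?d = "inverse (1 + ((u + v) / y)\<^sup>2) / y - inverse (1 + ((u - v) / y)\<^sup>2) / y"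
      have "((\<lambda>v. arctan ((u - v) / y) + arctan ((u + v) / y)) has_real_derivative ?d) (at v)"
        using y by (auto intro!: derivative_eq_intros simp: divide_inverse)
      moreover have "?d \<le> 0"
      proof -
        have "(u - v)\<^sup>2 \<le> (u + v)\<^sup>2" using u v x by (simp add: power2_eq_square algebra_simps)
        then have "((u - v) / y)\<^sup>2 \<le> ((u + v) / y)\<^sup>2" unfolding power_divide by (intro divide_right_mono) auto
        then have "inverse (1 + ((u + v) / y)\<^sup>2) \<le> inverse (1 + ((u - v) / y)\<^sup>2)"
          by (intro le_imp_inverse_le) (auto simp: add_pos_nonneg)
        then have "inverse (1 + ((u + v) / y)\<^sup>2) / y \<le> inverse (1 + ((u - v) / y)\<^sup>2) / y"
          using y by (intro divide_right_mono) auto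
        then show ?thesis by simp
      qed
      ultimately show "\<exists>d. ((\<lambda>v. arctan ((u - v) / y) + arctan ((u + v) / y)) has_real_derivative d) (at v) \<and> d \<le> 0" by blast
    qed
    have "(LINT t:{u..}|lborel. ?k t) = (LINT t:{u..}|lborel. ?K x t) - (LINT t:{u..}|lborel. ?K x' t)"
      using si[of x] si[of "- x"] si[of x'] si[of "- x'"] by (intro set_integral_diff(2)) (auto simp: set_integral_add)
    also have "\<dots> \<ge> 0" unfolding half using anti pi_gt_zero by (simp add: divide_right_mono)
    finally show "(LINT t:{u..}|lborel. ?k t) \<ge> 0" .
  qed
  then show ?thesis using pi1[of x] pi1[of x']
    by (simp add: right_diff_distrib poisson_symmetrized[OF \<phi> weight_even[OF w] y])
qed

text \<open>For \<open>\<bar>x\<bar> \<le> y\<close> the point \<open>sqrt (x\<^sup>2 + y\<^sup>2)\<close> is comparable with \<open>y\<close>, so the curvature there is comparable with that at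
\<open>y\<close>; for \<open>\<bar>x\<bar> \<ge> y\<close> the bound at \<open>x = y\<close> persists by monotonicity. In contrast to a Taylor expansion this controls
all \<open>x\<close>.\<close>

lemma poisson_quadratic_growth:
  assumes w: "weight \<phi>" and \<phi>: "log_integrable \<phi>" and y: "y > 0"
  shows "\<bar>x\<bar> \<le> y \<Longrightarrow> poisson \<phi> x y - poisson \<phi> 0 y \<ge> x\<^sup>2 * curvature \<phi> y / 12"
    and "\<bar>x\<bar> \<ge> y \<Longrightarrow> poisson \<phi> x y - poisson \<phi> 0 y \<ge> y\<^sup>2 * curvature \<phi> y / 12"
proof -
  show main: "poisson \<phi> x y - poisson \<phi> 0 y \<ge> x\<^sup>2 * curvature \<phi> y / 12" if "\<bar>x\<bar> \<le> y" for x
  proof -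
    define a where "a = sqrt (x\<^sup>2 + y\<^sup>2)"
    have a2: "a\<^sup>2 = x\<^sup>2 + y\<^sup>2" unfolding a_def by simp
    have x2: "x\<^sup>2 \<le> y\<^sup>2" using that by (simp add: abs_le_square_iff[symmetric])
    have a: "a > 0" "y \<le> a" unfolding a_def using y by (auto simp: add_nonneg_pos intro: real_le_rsqrt)
    have a2y: "a\<^sup>2 \<le> 2 * y\<^sup>2" using a2 x2 by simp
    moreover have "(3 / 2 * y)\<^sup>2 = 9 / 4 * y\<^sup>2" by (simp add: power2_eq_square)
    ultimately have "a\<^sup>2 \<le> (3 / 2 * y)\<^sup>2" using zero_le_power2[of y] by linarith
    then have ay: "a \<le> 3 / 2 * y" by (rule power2_le_imp_le) (use y in simp)
    have third: "1 / 3 \<le> y / (2 * a)" using ay a by (simp add: pos_le_divide_eq)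
    have le3: "x\<^sup>2 * (1 / 3) \<le> x\<^sup>2 * (y / (2 * a))" by (rule mult_left_mono[OF third]) simp
    have "(x\<^sup>2 * (1 / 3)) * (curvature \<phi> y / 4) \<le> (x\<^sup>2 * (y / (2 * a))) * curvature \<phi> a"
      using curvature_slowly_varying[OF w \<phi> y a(2) a2y] curvature_nonneg[OF w \<phi> y] y a
      by (intro mult_mono[OF le3] mult_nonneg_nonneg) auto
    also have "\<dots> \<le> poisson \<phi> x y - poisson \<phi> 0 y"
      using poisson_increment_lower[OF w \<phi> y, of x] unfolding a_def by (simp add: mult.commute)
    finally show ?thesis by simp
  qed
  assume x: "\<bar>x\<bar> \<ge> y"
  have "poisson \<phi> x y = poisson \<phi> \<bar>x\<bar> y"
    using poisson_uminus_arg[of \<phi> x y] weight_even[OF w] by (simp add: abs_if)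
  moreover have "poisson \<phi> y y \<le> poisson \<phi> \<bar>x\<bar> y" by (rule poisson_mono_arg[OF w \<phi> y]) (use x y in auto)
  ultimately show "poisson \<phi> x y - poisson \<phi> 0 y \<ge> y\<^sup>2 * curvature \<phi> y / 12" using main[of y] y by simp
qed

section \<open>Taylor expansion on the imaginary axis\<close>

lemma inverse_third_order:
  fixes u h :: complex
  assumes "u \<noteq> 0" "u - h \<noteq> 0"
  shows "1 / (u - h) = 1 / u + h / u ^ 2 + h ^ 2 / u ^ 3 + h ^ 3 / (u ^ 3 * (u - h))"
proof -
  have "1 / u + h / u ^ 2 + h ^ 2 / u ^ 3 = (u ^ 2 + h * u + h ^ 2) / u ^ 3"
    using assms by (simp add: field_simps power2_eq_square power3_eq_cube)
  moreover have "1 / (u - h) - h ^ 3 / (u ^ 3 * (u - h)) = ((u - h) * (u ^ 2 + h * u + h ^ 2)) / ((u - h) * u ^ 3)"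
    using assms by (simp add: divide_simps) (simp add: power2_eq_square power3_eq_cube algebra_simps)
  moreover have "((u - h) * (u ^ 2 + h * u + h ^ 2)) / ((u - h) * u ^ 3) = (u ^ 2 + h * u + h ^ 2) / u ^ 3"
    by (rule mult_divide_mult_cancel_left) (use assms in simp)
  ultimately show ?thesis by (simp add: algebra_simps)
qed

lemma divide_2_pi_i:
  fixes A B C D h P :: complex
  shows "(2 * \<i> * A + h * (2 * B) + h\<^sup>2 * (2 * \<i> * C) + D) / (2 * P * \<i>)
    = (A / P - \<i> * h * (B / P) + h\<^sup>2 * (C / P)) + D / (2 * P * \<i>)"
proof -
  have e: "w / (2 * P * \<i>) = - \<i> * w / (2 * P)" for w :: complex
  proof -
    have "w / (2 * P * \<i>) = w / (2 * P) / \<i>" by (simp only: divide_divide_eq_left)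
    then show ?thesis by simp
  qed
  have "- \<i> * (2 * \<i> * A + h * (2 * B) + h\<^sup>2 * (2 * \<i> * C) + D) = 2 * (A - \<i> * h * B + h\<^sup>2 * C) + - \<i> * D"
    by (simp add: algebra_simps)
  moreover have "2 * (A - \<i> * h * B + h\<^sup>2 * C) / (2 * P) = (A - \<i> * h * B + h\<^sup>2 * C) / P"
    by (rule mult_divide_mult_cancel_left) simp
  moreover have "(A - \<i> * h * B + h\<^sup>2 * C) / P = A / P - \<i> * h * (B / P) + h\<^sup>2 * (C / P)"
    by (simp only: add_divide_distrib diff_divide_distrib times_divide_eq_right)
  ultimately show ?thesis unfolding e by (simp only: add_divide_distrib)
qed

text \<open>Second-order expansion at \<open>\<i> * y\<close> of both partial fractions by finite geometric series. The remainder is explicit, and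
the hypotheses on \<open>h\<close> keep its denominators comparable with \<open>(t\<^sup>2 + y\<^sup>2)\<^sup>2\<close>.\<close>

lemma schwarz_kernel_taylor:
  assumes y: "y > 0" and im: "Im (\<i> * of_real y + h) > 0"
    and n1: "norm (of_real t - \<i> * of_real y) \<le> 2 * norm (of_real t - \<i> * of_real y - h)"
    and n2: "norm (of_real t + \<i> * of_real y) \<le> 2 * norm (of_real t + \<i> * of_real y + h)"
  shows "norm (schwarz_kernel (\<i> * of_real y + h) t - (of_real (poisson_kernel 0 y t) - \<i> * h * of_real (slope_kernel y t) + h\<^sup>2 / 2 * of_real (curvature_kernel y t)))
      \<le> norm h ^ 3 * (1 / (t\<^sup>2 + y\<^sup>2)\<^sup>2)"
proof -
  define u v r where "u = of_real t - \<i> * complex_of_real y" and "v = of_real t + \<i> * complex_of_real y" and "r = t\<^sup>2 + y\<^sup>2"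
  have r: "r > 0" unfolding r_def by (rule sq_sum_pos[OF y])
  have uv: "u * v = of_real r" by (simp add: u_def v_def r_def power2_eq_square algebra_simps)
  have nu: "(norm u)\<^sup>2 = r" "(norm v)\<^sup>2 = r" by (simp_all add: u_def v_def r_def cmod_power2)
  have nz: "u \<noteq> 0" "v \<noteq> 0" using nu r by auto
  have np: "norm u > 0" "norm v > 0" using nz by auto
  have nz': "u - h \<noteq> 0" "v + h \<noteq> 0" using n1 n2 np unfolding u_def[symmetric] v_def[symmetric] by auto
  have e1: "1 / (u - h) = 1 / u + h / u ^ 2 + h ^ 2 / u ^ 3 + h ^ 3 / (u ^ 3 * (u - h))"
    by (rule inverse_third_order) fact+
  have e2: "1 / (v + h) = 1 / v - h / v ^ 2 + h ^ 2 / v ^ 3 - h ^ 3 / (v ^ 3 * (v + h))"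
    using inverse_third_order[of v "- h"] nz nz' by simp
  have "schwarz_kernel (\<i> * of_real y + h) t = (1 / (u - h) - 1 / (v + h)) / (2 * of_real pi * \<i>)"
    using schwarz_kernel_partial_fractions[OF im, of t] by (simp add: u_def v_def algebra_simps)
  also have "\<dots> = ((1 / u - 1 / v) + h * (1 / u ^ 2 + 1 / v ^ 2) + h ^ 2 * (1 / u ^ 3 - 1 / v ^ 3)
      + (h ^ 3 / (u ^ 3 * (u - h)) + h ^ 3 / (v ^ 3 * (v + h)))) / (2 * of_real pi * \<i>)"
    unfolding e1 e2 by (simp add: algebra_simps)
  also have "1 / u - 1 / v = 2 * \<i> * of_real (y / r)"
  proof -
    have "1 / u - 1 / v = (v - u) / (u * v)" using nz by (simp add: field_simps)
    also have "v - u = 2 * \<i> * of_real y" by (simp add: u_def v_def)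
    finally show ?thesis unfolding uv by simp
  qed
  also have "1 / u ^ 2 + 1 / v ^ 2 = 2 * of_real ((t\<^sup>2 - y\<^sup>2) / r\<^sup>2)"
  proof -
    have "1 / u ^ 2 + 1 / v ^ 2 = (u ^ 2 + v ^ 2) / (u * v) ^ 2" using nz by (simp add: field_simps)
    also have "u ^ 2 + v ^ 2 = 2 * of_real (t\<^sup>2 - y\<^sup>2)" by (simp add: u_def v_def power2_eq_square algebra_simps)
    finally show ?thesis unfolding uv by simp
  qed
  also have "1 / u ^ 3 - 1 / v ^ 3 = 2 * \<i> * of_real (y * (3 * t\<^sup>2 - y\<^sup>2) / r ^ 3)"
  proof -
    have "1 / u ^ 3 - 1 / v ^ 3 = (v ^ 3 - u ^ 3) / (u * v) ^ 3" using nz by (simp add: field_simps)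
    also have "v ^ 3 - u ^ 3 = 2 * \<i> * of_real (y * (3 * t\<^sup>2 - y\<^sup>2))"
      by (simp add: u_def v_def complex_eq_iff power2_eq_square power3_eq_cube algebra_simps)
    finally show ?thesis unfolding uv by simp
  qed
  finally have expansion: "schwarz_kernel (\<i> * of_real y + h) t
      = of_real (y / r) / of_real pi - \<i> * h * (of_real ((t\<^sup>2 - y\<^sup>2) / r\<^sup>2) / of_real pi) + h\<^sup>2 * (of_real (y * (3 * t\<^sup>2 - y\<^sup>2) / r ^ 3) / of_real pi)
      + (h ^ 3 / (u ^ 3 * (u - h)) + h ^ 3 / (v ^ 3 * (v + h))) / (2 * of_real pi * \<i>)"
    unfolding divide_2_pi_i .
  have coeffs: "of_real (y / r) / of_real pi = complex_of_real (poisson_kernel 0 y t)"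
    "of_real ((t\<^sup>2 - y\<^sup>2) / r\<^sup>2) / of_real pi = complex_of_real (slope_kernel y t)"
    "h\<^sup>2 * (of_real (y * (3 * t\<^sup>2 - y\<^sup>2) / r ^ 3) / of_real pi) = h\<^sup>2 / 2 * complex_of_real (curvature_kernel y t)"
    by (simp_all add: poisson_kernel_def slope_kernel_def curvature_kernel_def r_def mult.commute)
  have "schwarz_kernel (\<i> * of_real y + h) t - (of_real (poisson_kernel 0 y t) - \<i> * h * of_real (slope_kernel y t) + h\<^sup>2 / 2 * of_real (curvature_kernel y t))
     = (h ^ 3 / (u ^ 3 * (u - h)) + h ^ 3 / (v ^ 3 * (v + h))) / (2 * of_real pi * \<i>)"
    unfolding expansion coeffs by simp
  also have "norm \<dots> \<le> (norm h ^ 3 * (2 / r\<^sup>2) + norm h ^ 3 * (2 / r\<^sup>2)) / (2 * pi)"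
  proof -
    have aux: "norm (h ^ 3 / (w ^ 3 * w')) \<le> norm h ^ 3 * (2 / r\<^sup>2)" if "(norm w)\<^sup>2 = r" "norm w \<le> 2 * norm w'" "norm w > 0" for w w'
    proof -
      have "r\<^sup>2 = norm w ^ 3 * norm w" unfolding that(1)[symmetric] by (simp add: power2_eq_square power3_eq_cube)
      also have "\<dots> \<le> norm w ^ 3 * (2 * norm w')" using that by (intro mult_left_mono) auto
      finally have le: "r\<^sup>2 \<le> 2 * (norm w ^ 3 * norm w')" by simp
      have "norm w ^ 3 * norm w' > 0" using that by (intro mult_pos_pos) auto
      then have "1 / (norm w ^ 3 * norm w') \<le> 2 / r\<^sup>2" using le r by (simp add: divide_simps mult.commute)
      then have "norm h ^ 3 * (1 / (norm w ^ 3 * norm w')) \<le> norm h ^ 3 * (2 / r\<^sup>2)" by (intro mult_left_mono) auto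
      then show ?thesis by (simp add: norm_mult norm_divide norm_power)
    qed
    have "norm (h ^ 3 / (u ^ 3 * (u - h)) + h ^ 3 / (v ^ 3 * (v + h))) \<le> norm h ^ 3 * (2 / r\<^sup>2) + norm h ^ 3 * (2 / r\<^sup>2)"
      by (rule norm_triangle_le, rule add_mono; rule aux) (use nu np n1 n2 in \<open>auto simp: u_def v_def\<close>)
    moreover have "norm (w / (2 * of_real pi * \<i>)) = norm w / (2 * pi)" for w :: complex
      by (simp add: norm_divide norm_mult)
    ultimately show ?thesis by (simp only: divide_right_mono pi_ge_zero mult_nonneg_nonneg zero_le_numeral)
  qed
  also have "\<dots> = norm h ^ 3 * (1 / r\<^sup>2) * (2 / pi)" by (simp add: field_simps)
  also have "\<dots> \<le> norm h ^ 3 * (1 / r\<^sup>2) * 1" using pi_gt3 by (intro mult_left_mono) auto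
  finally show ?thesis by (simp add: r_def)
qed

text \<open>A bound for the coefficient of the cubic error in the Taylor expansion of \<open>schwarz \<phi>\<close> at \<open>\<i> * y\<close>.\<close>

definition remainder :: "(real \<Rightarrow> real) \<Rightarrow> real \<Rightarrow> real" where
  "remainder \<phi> y = (\<integral>t. \<bar>\<phi> t\<bar> * (1 / (t\<^sup>2 + y\<^sup>2)\<^sup>2) \<partial>lborel)"

text \<open>The derivative of the Poisson integral along the imaginary axis, see \<open>poisson_axis_derivative\<close>.\<close>

definition slope :: "(real \<Rightarrow> real) \<Rightarrow> real \<Rightarrow> real" where
  "slope \<phi> y = (\<integral>t. \<phi> t * slope_kernel y t \<partial>lborel)"

lemma schwarz_taylor:
  assumes \<phi>: "log_integrable \<phi>" and y: "y > 0" and im: "Im (\<i> * of_real y + h) > 0"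
    and n1: "\<And>t. norm (of_real t - \<i> * of_real y) \<le> 2 * norm (of_real t - \<i> * of_real y - h)"
    and n2: "\<And>t. norm (of_real t + \<i> * of_real y) \<le> 2 * norm (of_real t + \<i> * of_real y + h)"
  shows "norm (schwarz \<phi> (\<i> * of_real y + h) - (of_real (poisson \<phi> 0 y) - \<i> * h * of_real (slope \<phi> y) + h\<^sup>2 / 2 * of_real (curvature \<phi> y)))
      \<le> norm h ^ 3 * remainder \<phi> y"
proof -
  let ?z = "\<i> * of_real y + h"
  let ?P = "\<lambda>t. of_real (\<phi> t * poisson_kernel 0 y t) - (\<i> * h) * of_real (\<phi> t * slope_kernel y t) + (h\<^sup>2 / 2) * of_real (\<phi> t * curvature_kernel y t)"
  have i1: "integrable lborel (\<lambda>t. complex_of_real (\<phi> t * poisson_kernel 0 y t))"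
    using poisson_integrable[OF \<phi> y, of 0] by (rule integrable_of_real)
  have i2: "integrable lborel (\<lambda>t. (\<i> * h) * complex_of_real (\<phi> t * slope_kernel y t))"
    using kernels_integrable(2)[OF \<phi> y] by (intro integrable_mult_right integrable_of_real)
  have i3: "integrable lborel (\<lambda>t. (h\<^sup>2 / 2) * complex_of_real (\<phi> t * curvature_kernel y t))"
    using kernels_integrable(1)[OF \<phi> y] by (intro integrable_mult_right integrable_of_real)
  have iP: "integrable lborel ?P" by (intro Bochner_Integration.integrable_add Bochner_Integration.integrable_diff i1 i2 i3)
  have PI: "(\<integral>t. ?P t \<partial>lborel) = of_real (poisson \<phi> 0 y) - \<i> * h * of_real (slope \<phi> y) + h\<^sup>2 / 2 * of_real (curvature \<phi> y)"
    unfolding Bochner_Integration.integral_add[OF Bochner_Integration.integrable_diff[OF i1 i2] i3]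
      Bochner_Integration.integral_diff[OF i1 i2] Bochner_Integration.integral_mult_right_zero
      integral_complex_of_real poisson_def slope_def curvature_def ..
  have iS: "integrable lborel (\<lambda>t. of_real (\<phi> t) * schwarz_kernel ?z t)" by (rule schwarz_integrable[OF \<phi> im])
  have eq: "schwarz \<phi> ?z - (\<integral>t. ?P t \<partial>lborel) = (\<integral>t. of_real (\<phi> t) * schwarz_kernel ?z t - ?P t \<partial>lborel)"
    unfolding schwarz_def by (rule Bochner_Integration.integral_diff[OF iS iP, symmetric])
  have "norm (\<integral>t. of_real (\<phi> t) * schwarz_kernel ?z t - ?P t \<partial>lborel) \<le> (\<integral>t. norm h ^ 3 * (\<bar>\<phi> t\<bar> * (1 / (t\<^sup>2 + y\<^sup>2)\<^sup>2)) \<partial>lborel)"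
  proof (rule order_trans[OF integral_norm_bound], rule integral_mono)
    show "integrable lborel (\<lambda>t. norm (of_real (\<phi> t) * schwarz_kernel ?z t - ?P t))" by (intro integrable_norm Bochner_Integration.integrable_diff iS iP)
    show "integrable lborel (\<lambda>t. norm h ^ 3 * (\<bar>\<phi> t\<bar> * (1 / (t\<^sup>2 + y\<^sup>2)\<^sup>2)))"
      by (intro integrable_mult_right kernels_integrable(3) log_integrable_abs \<phi> y)
    fix t
    have dist: "a * S - (a * p - k * (a * d) + q * (a * c)) = a * (S - (p - k * d + q * c))" for a S p k d q c :: complex
      by (simp add: algebra_simps)
    have "of_real (\<phi> t) * schwarz_kernel ?z t - ?P t = of_real (\<phi> t) * (schwarz_kernel ?z t - (of_real (poisson_kernel 0 y t) - \<i> * h * of_real (slope_kernel y t) + h\<^sup>2 / 2 * of_real (curvature_kernel y t)))"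
      unfolding of_real_mult by (rule dist)
    also have "norm \<dots> \<le> \<bar>\<phi> t\<bar> * (norm h ^ 3 * (1 / (t\<^sup>2 + y\<^sup>2)\<^sup>2))"
      by (subst norm_mult, subst norm_of_real) (rule mult_left_mono[OF schwarz_kernel_taylor[OF y im n1 n2] abs_ge_zero])
    also have "\<bar>\<phi> t\<bar> * (norm h ^ 3 * (1 / (t\<^sup>2 + y\<^sup>2)\<^sup>2)) = norm h ^ 3 * (\<bar>\<phi> t\<bar> * (1 / (t\<^sup>2 + y\<^sup>2)\<^sup>2))"
      by (rule mult.left_commute)
    finally show "norm (of_real (\<phi> t) * schwarz_kernel ?z t - ?P t) \<le> norm h ^ 3 * (\<bar>\<phi> t\<bar> * (1 / (t\<^sup>2 + y\<^sup>2)\<^sup>2))" .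
  qed
  also have "\<dots> = norm h ^ 3 * remainder \<phi> y" unfolding remainder_def by (rule Bochner_Integration.integral_mult_right_zero)
  finally show ?thesis unfolding eq[symmetric] PI .
qed

lemma schwarz_taylor_horizontal:
  assumes \<phi>: "log_integrable \<phi>" and y: "y > 0" and x: "\<bar>x\<bar> \<le> y"
  shows "norm (schwarz \<phi> (Complex x y) - (of_real (poisson \<phi> 0 y) - \<i> * of_real (x * slope \<phi> y) + of_real (x\<^sup>2 / 2 * curvature \<phi> y)))
      \<le> \<bar>x\<bar> ^ 3 * remainder \<phi> y"
proof -
  have aux: "t\<^sup>2 + y\<^sup>2 \<le> 4 * ((t - s)\<^sup>2 + y\<^sup>2)" if "\<bar>s\<bar> \<le> y" for t s
  proof -
    have "t\<^sup>2 \<le> 2 * (t - s)\<^sup>2 + 2 * s\<^sup>2"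
      using zero_le_power2[of "t - 2 * s"] by (simp add: power2_eq_square algebra_simps)
    moreover have "s\<^sup>2 \<le> y\<^sup>2" using that by (simp add: abs_le_square_iff[symmetric])
    moreover have "(t - s)\<^sup>2 \<ge> 0" "y\<^sup>2 \<ge> 0" by auto
    ultimately show ?thesis unfolding distrib_left by linarith
  qed
  have z: "\<i> * of_real y + of_real x = Complex x y" by (simp add: complex_eq_iff)
  have "norm (schwarz \<phi> (\<i> * of_real y + of_real x) - (of_real (poisson \<phi> 0 y) - \<i> * of_real x * of_real (slope \<phi> y) + (of_real x)\<^sup>2 / 2 * of_real (curvature \<phi> y)))
      \<le> norm (complex_of_real x) ^ 3 * remainder \<phi> y"
  proof (rule schwarz_taylor[OF \<phi> y])
    fix t
    have "(norm (of_real t - \<i> * of_real y))\<^sup>2 \<le> (2 * norm (of_real t - \<i> * of_real y - complex_of_real x))\<^sup>2"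
      unfolding power_mult_distrib cmod_power2 using aux[of x t] x by simp
    then show "norm (of_real t - \<i> * of_real y) \<le> 2 * norm (of_real t - \<i> * of_real y - complex_of_real x)"
      by (rule power2_le_imp_le) simp
    have "(norm (of_real t + \<i> * of_real y))\<^sup>2 \<le> (2 * norm (of_real t + \<i> * of_real y + complex_of_real x))\<^sup>2"
      unfolding power_mult_distrib cmod_power2 using aux[of "- x" t] x by simp
    then show "norm (of_real t + \<i> * of_real y) \<le> 2 * norm (of_real t + \<i> * of_real y + complex_of_real x)"
      by (rule power2_le_imp_le) simp
  qed (use y in simp)
  then show ?thesis unfolding z by (simp add: mult.assoc)
qed

text \<open>The Taylor expansion of the Schwarz integral, read along the imaginary axis.\<close>

lemma poisson_axis_derivative:
  assumes \<phi>: "log_integrable \<phi>" and even: "\<And>t. \<phi> (- t) = \<phi> t" and y: "y > 0"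
  shows "((\<lambda>y. poisson \<phi> 0 y) has_real_derivative slope \<phi> y) (at y)"
proof -
  let ?A = "curvature \<phi> y" and ?B = "remainder \<phi> y" and ?d = "slope \<phi> y"
  have B: "?B \<ge> 0" unfolding remainder_def by (intro integral_nonneg_AE) auto
  have est: "\<bar>poisson \<phi> 0 (y + e) - poisson \<phi> 0 y - e * ?d\<bar> \<le> e\<^sup>2 * (\<bar>?A\<bar> / 2 + y * ?B)" if e: "\<bar>e\<bar> \<le> y / 2" for e
  proof -
    have ye: "y + e > 0" using e y by linarith
    have nrm: "norm (w :: complex) \<le> 2 * norm (w + s * (\<i> * of_real e))" if "norm w \<ge> y" "\<bar>s\<bar> = 1" for w and s :: real
    proof -
      have "norm (w + s * (\<i> * of_real e)) \<ge> norm w - \<bar>e\<bar>"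
        using norm_triangle_ineq4[of "w + s * (\<i> * of_real e)" "s * (\<i> * of_real e)"] that by (simp add: norm_mult)
      then show ?thesis using that e by linarith
    qed
    have ge: "norm (of_real t - \<i> * of_real y) \<ge> y" "norm (of_real t + \<i> * of_real y) \<ge> y" for t
      using abs_Im_le_cmod[of "of_real t - \<i> * of_real y"] abs_Im_le_cmod[of "of_real t + \<i> * of_real y"] y by auto
    have "norm (schwarz \<phi> (\<i> * of_real y + \<i> * of_real e) - (of_real (poisson \<phi> 0 y) - \<i> * (\<i> * of_real e) * of_real ?d + (\<i> * of_real e)\<^sup>2 / 2 * of_real ?A))
      \<le> norm (\<i> * complex_of_real e) ^ 3 * ?B"
    proof (rule schwarz_taylor[OF \<phi> y])
      show "norm (of_real t - \<i> * of_real y) \<le> 2 * norm (of_real t - \<i> * of_real y - \<i> * complex_of_real e)" for t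
        using nrm[OF ge(1)[of t], of "-1"] by simp
      show "norm (of_real t + \<i> * of_real y) \<le> 2 * norm (of_real t + \<i> * of_real y + \<i> * complex_of_real e)" for t
        using nrm[OF ge(2)[of t], of 1] by simp
    qed (use ye in simp)
    moreover have "of_real (poisson \<phi> 0 y) - \<i> * (\<i> * of_real e) * of_real ?d + (\<i> * of_real e)\<^sup>2 / 2 * of_real ?A
        = complex_of_real (poisson \<phi> 0 y + e * ?d - e\<^sup>2 / 2 * ?A)"
      by (simp add: power_mult_distrib)
    ultimately have "norm (schwarz \<phi> (\<i> * of_real y + \<i> * of_real e) - complex_of_real (poisson \<phi> 0 y + e * ?d - e\<^sup>2 / 2 * ?A)) \<le> \<bar>e\<bar> ^ 3 * ?B"
      by (simp add: norm_mult)
    then have "\<bar>Re (schwarz \<phi> (\<i> * of_real y + \<i> * of_real e) - complex_of_real (poisson \<phi> 0 y + e * ?d - e\<^sup>2 / 2 * ?A))\<bar> \<le> \<bar>e\<bar> ^ 3 * ?B"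
      using abs_Re_le_cmod order_trans by blast
    moreover have "Re (schwarz \<phi> (\<i> * of_real y + \<i> * of_real e)) = poisson \<phi> 0 (y + e)"
      using Re_schwarz[OF \<phi> even, of "\<i> * of_real y + \<i> * of_real e"] ye by simp
    ultimately have 1: "\<bar>poisson \<phi> 0 (y + e) - (poisson \<phi> 0 y + e * ?d - e\<^sup>2 / 2 * ?A)\<bar> \<le> \<bar>e\<bar> ^ 3 * ?B"
      by simp
    have "\<bar>e\<bar> ^ 3 * ?B = e\<^sup>2 * (\<bar>e\<bar> * ?B)" by (simp add: power3_eq_cube power2_eq_square)
    also have "\<dots> \<le> e\<^sup>2 * (y * ?B)" using e B y by (intro mult_left_mono mult_right_mono) auto
    finally have 2: "\<bar>e\<bar> ^ 3 * ?B \<le> e\<^sup>2 * (y * ?B)" .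
    have 3: "\<bar>e\<^sup>2 / 2 * ?A\<bar> = e\<^sup>2 * (\<bar>?A\<bar> / 2)" by (simp add: abs_mult)
    show ?thesis using 1 2 3 unfolding distrib_left by linarith
  qed
  have "((\<lambda>e. (poisson \<phi> 0 (y + e) - poisson \<phi> 0 y) / e) \<longlongrightarrow> ?d) (at 0)"
  proof (rule LIM_zero_cancel, rule tendsto_rabs_zero_cancel, rule tendsto_sandwich)
    show "\<forall>\<^sub>F e in at 0. 0 \<le> \<bar>(poisson \<phi> 0 (y + e) - poisson \<phi> 0 y) / e - ?d\<bar>" by simp
    have "((\<lambda>e. \<bar>e\<bar> * (\<bar>?A\<bar> / 2 + y * ?B)) \<longlongrightarrow> \<bar>0\<bar> * (\<bar>?A\<bar> / 2 + y * ?B)) (at 0)" by (intro tendsto_intros)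
    then show "((\<lambda>e. \<bar>e\<bar> * (\<bar>?A\<bar> / 2 + y * ?B)) \<longlongrightarrow> 0) (at 0)" by simp
    have "\<forall>\<^sub>F e in at 0. \<bar>e\<bar> \<le> y / 2 \<and> e \<noteq> 0"
      unfolding eventually_at by (intro exI[of _ "y / 2"]) (use y in \<open>auto simp: dist_real_def\<close>)
    then show "\<forall>\<^sub>F e in at 0. \<bar>(poisson \<phi> 0 (y + e) - poisson \<phi> 0 y) / e - ?d\<bar> \<le> \<bar>e\<bar> * (\<bar>?A\<bar> / 2 + y * ?B)"
    proof eventually_elim
      case (elim e)
      have "(poisson \<phi> 0 (y + e) - poisson \<phi> 0 y) / e - ?d = (poisson \<phi> 0 (y + e) - poisson \<phi> 0 y - e * ?d) / e"
        using elim by (simp add: field_simps)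
      then have "\<bar>(poisson \<phi> 0 (y + e) - poisson \<phi> 0 y) / e - ?d\<bar> = \<bar>poisson \<phi> 0 (y + e) - poisson \<phi> 0 y - e * ?d\<bar> / \<bar>e\<bar>"
        by (simp add: abs_divide)
      also have "\<dots> \<le> e\<^sup>2 * (\<bar>?A\<bar> / 2 + y * ?B) / \<bar>e\<bar>" using est[of e] elim by (intro divide_right_mono) auto
      also have "e\<^sup>2 = \<bar>e\<bar> * \<bar>e\<bar>" by (simp add: power2_eq_square)
      also have "\<bar>e\<bar> * \<bar>e\<bar> * (\<bar>?A\<bar> / 2 + y * ?B) / \<bar>e\<bar> = \<bar>e\<bar> * (\<bar>?A\<bar> / 2 + y * ?B)"
        using elim by (simp only: mult.assoc nonzero_mult_div_cancel_left abs_eq_0 simp_thms)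
      finally show ?case .
    qed
  qed simp
  then show ?thesis unfolding DERIV_def .
qed

text \<open>The kernel of \<open>p y - y * p' y\<close> is the positive function \<open>2 * y\<^sup>3 / (\<pi> * (t\<^sup>2 + y\<^sup>2)\<^sup>2)\<close>, which has mass of order \<open>1\<close>
on the interval from \<open>y\<close> to \<open>2 * y\<close>, where \<open>\<phi> \<ge> \<phi> y\<close>.\<close>

lemma legendre_value_lower:
  assumes w: "weight \<phi>" and \<phi>: "log_integrable \<phi>" and y: "y > 0"
  shows "poisson \<phi> 0 y - y * slope \<phi> y \<ge> (\<phi> y - \<phi> 0) / 50 - 2 * \<bar>\<phi> 0\<bar>"
proof -
  define m where "m = (\<lambda>t. poisson_kernel 0 y t - y * slope_kernel y t)"
  have meq: "m t = 2 * y ^ 3 / (pi * (t\<^sup>2 + y\<^sup>2)\<^sup>2)" for t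
  proof -
    have nz: "t\<^sup>2 + y\<^sup>2 \<noteq> 0" using sq_sum_pos[OF y, of t] by (metis less_irrefl)
    have frac: "1 / s = s / s\<^sup>2" if "s \<noteq> 0" for s :: real using that by (simp add: power2_eq_square)
    have "m t = (y / pi) * (1 / (t\<^sup>2 + y\<^sup>2) - (t\<^sup>2 - y\<^sup>2) / (t\<^sup>2 + y\<^sup>2)\<^sup>2)" by (simp add: m_def poisson_kernel_def slope_kernel_def right_diff_distrib diff_divide_distrib)
    also have "1 / (t\<^sup>2 + y\<^sup>2) - (t\<^sup>2 - y\<^sup>2) / (t\<^sup>2 + y\<^sup>2)\<^sup>2 = 2 * y\<^sup>2 / (t\<^sup>2 + y\<^sup>2)\<^sup>2"
    proof -
      have "1 / (t\<^sup>2 + y\<^sup>2) = (t\<^sup>2 + y\<^sup>2) / (t\<^sup>2 + y\<^sup>2)\<^sup>2" using frac[OF nz] .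
      then show ?thesis by (simp add: diff_divide_distrib[symmetric])
    qed
    finally show ?thesis by (simp add: power2_eq_square power3_eq_cube)
  qed
  have m0: "m t \<ge> 0" for t unfolding meq using y by simp
  have mle: "m t \<le> 2 * poisson_kernel 0 y t" for t
  proof -
    have "\<bar>slope_kernel y t\<bar> \<le> 1 / (pi * (t\<^sup>2 + y\<^sup>2))" by (rule slope_kernel_abs_le[OF y])
    then have "y * (- slope_kernel y t) \<le> y * (1 / (pi * (t\<^sup>2 + y\<^sup>2)))" using y by (intro mult_left_mono) linarith+
    then show ?thesis by (simp add: m_def poisson_kernel_def)
  qed
  have mi: "integrable lborel m" unfolding m_def
    using poisson_kernel_integral(1)[OF y, of 0] kernels_integrable(2)[OF log_integrable_const[of 1] y] by simp
  have \<phi>mi: "integrable lborel (\<lambda>t. \<phi> t * m t)"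
    unfolding m_def right_diff_distrib using poisson_integrable[OF \<phi> y, of 0] integrable_mult_right[OF kernels_integrable(2)[OF \<phi> y], of y]
    by (simp add: mult.left_commute)
  have val: "poisson \<phi> 0 y - y * slope \<phi> y = (\<integral>t. \<phi> t * m t \<partial>lborel)"
  proof -
    have "(\<integral>t. \<phi> t * m t \<partial>lborel) = (\<integral>t. \<phi> t * poisson_kernel 0 y t - y * (\<phi> t * slope_kernel y t) \<partial>lborel)"
      by (intro Bochner_Integration.integral_cong) (simp_all add: m_def algebra_simps)
    also have "\<dots> = poisson \<phi> 0 y - y * slope \<phi> y"
      unfolding poisson_def slope_def using poisson_integrable[OF \<phi> y, of 0] integrable_mult_right[OF kernels_integrable(2)[OF \<phi> y], of y]
      by (subst Bochner_Integration.integral_diff) auto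
    finally show ?thesis by simp
  qed
  have mI: "(\<integral>t. m t \<partial>lborel) \<le> 2"
  proof -
    have "(\<integral>t. m t \<partial>lborel) \<le> (\<integral>t. 2 * poisson_kernel 0 y t \<partial>lborel)"
      by (rule integral_mono[OF mi _ mle]) (use poisson_kernel_integral[OF y] in auto)
    then show ?thesis by (simp add: poisson_kernel_integral[OF y])
  qed
  have mI0: "(\<integral>t. m t \<partial>lborel) \<ge> 0" using m0 by (intro integral_nonneg_AE) auto
  define c where "c = (\<phi> y - \<phi> 0) * (2 * y ^ 3 / (pi * (25 * y ^ 4)))"
  have \<phi>y: "\<phi> y - \<phi> 0 \<ge> 0" using weight_ge0[OF w, of y] by simp
  have "c * y = (\<integral>t. indicator {y..2*y} t * c \<partial>lborel)" using y by simp
  also have "\<dots> \<le> (\<integral>t. (\<phi> t - \<phi> 0) * m t \<partial>lborel)"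
  proof (rule integral_mono)
    show "integrable lborel (\<lambda>t. indicator {y..2*y} t * c)"
      using y by (intro integrable_mult_left integrable_real_indicator) auto
    show "integrable lborel (\<lambda>t. (\<phi> t - \<phi> 0) * m t)" using \<phi>mi mi by (simp add: left_diff_distrib)
    fix t
    show "indicator {y..2*y} t * c \<le> (\<phi> t - \<phi> 0) * m t"
    proof (cases "t \<in> {y..2*y}")
      case True
      have "t\<^sup>2 \<le> (2 * y)\<^sup>2" using True y by (intro power_mono) auto
      then have "t\<^sup>2 + y\<^sup>2 \<le> 5 * y\<^sup>2" by (simp add: power2_eq_square)
      then have "(t\<^sup>2 + y\<^sup>2)\<^sup>2 \<le> (5 * y\<^sup>2)\<^sup>2" by (intro power_mono) auto
      then have le: "(t\<^sup>2 + y\<^sup>2)\<^sup>2 \<le> 25 * y ^ 4" by (simp add: power2_eq_square power4_eq_xxxx)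
      have "2 * y ^ 3 / (pi * (25 * y ^ 4)) \<le> m t" unfolding meq
        using y le sq_sum_pos[OF y, of t] by (intro divide_left_mono mult_left_mono mult_pos_pos) auto
      moreover have "\<phi> y \<le> \<phi> t" by (rule weight_mono[OF w]) (use True y in auto)
      ultimately have "c \<le> (\<phi> t - \<phi> 0) * m t" unfolding c_def using \<phi>y y by (intro mult_mono) auto
      then show ?thesis using True by simp
    next
      case False
      then show ?thesis using m0[of t] weight_ge0[OF w, of t] by simp
    qed
  qed
  also have "\<dots> = (\<integral>t. \<phi> t * m t \<partial>lborel) - \<phi> 0 * (\<integral>t. m t \<partial>lborel)" 
    using \<phi>mi mi by (simp add: left_diff_distrib)
  finally have "c * y \<le> (\<integral>t. \<phi> t * m t \<partial>lborel) - \<phi> 0 * (\<integral>t. m t \<partial>lborel)" .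
  moreover have "- (\<phi> 0 * (\<integral>t. m t \<partial>lborel)) \<le> \<bar>\<phi> 0\<bar> * 2"
  proof -
    have "- (\<phi> 0 * (\<integral>t. m t \<partial>lborel)) \<le> \<bar>\<phi> 0\<bar> * (\<integral>t. m t \<partial>lborel)"
      using mI0 by (metis abs_ge_minus_self abs_mult abs_of_nonneg)
    also have "\<dots> \<le> \<bar>\<phi> 0\<bar> * 2" using mI by (intro mult_left_mono) auto
    finally show ?thesis .
  qed
  moreover have "c * y = (\<phi> y - \<phi> 0) / 50 * (4 / pi)"
    using y by (simp add: c_def field_simps power3_eq_cube power4_eq_xxxx)
  moreover have "(\<phi> y - \<phi> 0) / 50 * (4 / pi) \<ge> (\<phi> y - \<phi> 0) / 50 * 1"
    using \<phi>y pi_less_4 by (intro mult_left_mono) (auto simp: pos_le_divide_eq)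
  ultimately show ?thesis unfolding val by linarith
qed

section \<open>The Ostrowski function\<close>

text \<open>The difference quotients decrease as \<open>w\<close> decreases to \<open>v\<close> and are bounded below by a quotient on the left; their limit is
their infimum.\<close>

lemma convex_right_slope:
  fixes f :: "real \<Rightarrow> real"
  assumes f: "convex_on UNIV f"
  obtains n where "((\<lambda>w. (f w - f v) / (w - v)) \<longlongrightarrow> n) (at_right v)" "\<And>w. w \<ge> v \<Longrightarrow> f w \<ge> f v + n * (w - v)"
proof -
  define q where "q w = (f w - f v) / (w - v)" for w
  have conv: "f ((1 - t) * a + t * b) \<le> (1 - t) * f a + t * f b" if "0 \<le> t" "t \<le> 1" for t a b
    using convex_onD[OF f that] by simp
  have mono: "q w \<le> q w'" if w: "v < w" "w \<le> w'" for w w'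
  proof -
    define t where "t = (w - v) / (w' - v)"
    have t: "0 \<le> t" "t \<le> 1" using w by (auto simp: t_def)
    have e: "(1 - t) * v + t * w' = w"
    proof -
      have "t * (w' - v) = w - v" using w by (simp add: t_def)
      then show ?thesis by (simp add: algebra_simps)
    qed
    have "f w \<le> (1 - t) * f v + t * f w'" using conv[OF t, of v w'] unfolding e .
    then have "f w - f v \<le> t * (f w' - f v)" by (simp add: algebra_simps)
    then have "(f w - f v) / (w - v) \<le> (t * (f w' - f v)) / (w - v)" using w by (intro divide_right_mono) auto
    also have "\<dots> = (f w' - f v) / (w' - v)" using w by (simp add: t_def)
    finally show ?thesis by (simp add: q_def)
  qed
  have below: "q w \<ge> f v - f (v - 1)" if w: "v < w" for w
  proof -
    define t where "t = 1 / (1 + (w - v))"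
    have t: "0 \<le> t" "t \<le> 1" using w by (auto simp: t_def)
    have t1: "t * (1 + (w - v)) = 1" using w by (simp add: t_def)
    have "(1 - t) * (v - 1) + t * w = v - 1 + t * (1 + (w - v))" by (simp add: algebra_simps)
    then have e: "(1 - t) * (v - 1) + t * w = v" unfolding t1 by simp
    have "f v \<le> (1 - t) * f (v - 1) + t * f w" using conv[OF t, of "v - 1" w] unfolding e .
    then have "(1 + (w - v)) * f v \<le> (1 + (w - v)) * ((1 - t) * f (v - 1) + t * f w)" using w by (intro mult_left_mono) auto
    also have "\<dots> = (1 + (w - v)) * f (v - 1) - (t * (1 + (w - v))) * f (v - 1) + (t * (1 + (w - v))) * f w"
      by (simp add: algebra_simps)
    finally have "(w - v) * (f v - f (v - 1)) \<le> f w - f v" unfolding t1 by (simp add: algebra_simps)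
    then show ?thesis using w by (simp add: q_def pos_le_divide_eq mult.commute)
  qed
  define n where "n = Inf (q ` {v<..})"
  have bdd: "bdd_below (q ` {v<..})" unfolding bdd_below_def using below by auto
  have n_le: "n \<le> q w" if "v < w" for w unfolding n_def by (rule cInf_lower[OF _ bdd]) (use that in auto)
  have "(q \<longlongrightarrow> n) (at_right v)"
  proof (rule order_tendstoI)
    fix a assume "a < n"
    then show "\<forall>\<^sub>F w in at_right v. a < q w"
      using n_le unfolding eventually_at_right_field by (intro exI[of _ "v + 1"]) (auto intro: less_le_trans)
  next
    fix a assume "n < a"
    moreover have "q ` {v<..} \<noteq> {}" using gt_ex[of v] by auto
    ultimately have "\<exists>s\<in>q ` {v<..}. s < a" unfolding n_def by (rule cInf_lessD[rotated])
    then obtain w0 where w0: "v < w0" "q w0 < a" by auto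
    then show "\<forall>\<^sub>F w in at_right v. q w < a"
      unfolding eventually_at_right_field
    proof (intro exI[of _ w0] conjI allI impI)
      fix w assume "v < w" "w < w0"
      then show "q w < a" using mono[of w w0] w0(2) by simp
    qed (rule w0(1))
  qed
  moreover have "f w \<ge> f v + n * (w - v)" if "w \<ge> v" for w
  proof (cases "w = v")
    case False
    then show ?thesis using n_le[of w] that by (simp add: q_def pos_le_divide_eq)
  qed simp
  ultimately show ?thesis using that unfolding q_def by blast
qed

text \<open>The case in which the real supremum that defines \<open>Ostrowski M r\<close> is a genuine one.\<close>

definition finite_Ostrowski :: "(nat \<Rightarrow> real) \<Rightarrow> bool" where
  "finite_Ostrowski M \<longleftrightarrow> (\<forall>n. M n > 0) \<and> (\<forall>r\<ge>0. bdd_above (range (\<lambda>n. r ^ n / M n)))"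

lemma Ostrowski_ge: "finite_Ostrowski M \<Longrightarrow> r \<ge> 0 \<Longrightarrow> r ^ n / M n \<le> Ostrowski M r"
  unfolding Ostrowski_def finite_Ostrowski_def by (intro cSUP_upper) auto

lemma Ostrowski_le: "(\<And>n. r ^ n / M n \<le> B) \<Longrightarrow> Ostrowski M r \<le> B"
  unfolding Ostrowski_def by (intro cSUP_least) auto

lemma finite_Ostrowski_pos: "finite_Ostrowski M \<Longrightarrow> M n > 0" by (simp add: finite_Ostrowski_def)

lemma Ostrowski_pos: "finite_Ostrowski M \<Longrightarrow> r \<ge> 0 \<Longrightarrow> Ostrowski M r > 0"
  using Ostrowski_ge[of M r 0] finite_Ostrowski_pos[of M 0] by (simp add: less_le_trans[of 0 "1 / M 0"])

lemma power_le_exp_log_Ostrowski: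
  assumes "finite_Ostrowski M" "t \<ge> 0" shows "t ^ n \<le> M n * exp (log_Ostrowski M t)"
proof -
  have "exp (log_Ostrowski M t) = Ostrowski M t"
    using Ostrowski_pos[OF assms] assms(2) by (simp add: log_Ostrowski_def)
  then show ?thesis using Ostrowski_ge[OF assms, of n] finite_Ostrowski_pos[OF assms(1), of n] by (simp add: pos_divide_le_eq mult.commute)
qed

lemma log_Ostrowski_ge:
  assumes "finite_Ostrowski M" "t > 0" shows "real n * ln t - ln (M n) \<le> log_Ostrowski M t"
proof -
  have "ln (t ^ n / M n) \<le> ln (Ostrowski M t)"
    using Ostrowski_ge[OF assms(1), of t n] finite_Ostrowski_pos[OF assms(1), of n] assms by (intro ln_mono) auto
  then show ?thesis using assms finite_Ostrowski_pos[OF assms(1), of n] by (simp add: log_Ostrowski_def ln_div ln_realpow)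
qed

lemma log_Ostrowski_le:
  assumes "finite_Ostrowski M" "t > 0" "\<And>n. real n * ln t - ln (M n) \<le> B" shows "log_Ostrowski M t \<le> B"
proof -
  have "Ostrowski M t \<le> exp B"
  proof (rule Ostrowski_le)
    fix n
    have "t ^ n / M n = exp (real n * ln t - ln (M n))"
      using assms(2) finite_Ostrowski_pos[OF assms(1), of n] by (simp add: exp_diff exp_of_nat_mult)
    then show "t ^ n / M n \<le> exp B" using assms(3)[of n] by simp
  qed
  then have "ln (Ostrowski M t) \<le> ln (exp B)" using Ostrowski_pos[OF assms(1), of t] assms(2) by (intro ln_mono) auto
  then show ?thesis using assms(2) by (simp add: log_Ostrowski_def)
qed

text \<open>In the variable \<open>v = ln t\<close> the weight is a supremum of the affine functions \<open>n * v - ln (M n)\<close>.\<close>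

lemma convex_log_Ostrowski_exp:
  assumes M: "finite_Ostrowski M" shows "convex_on UNIV (\<lambda>v. log_Ostrowski M (exp v))"
proof (rule convex_onI)
  fix t x y :: real assume t: "0 < t" "t < 1"
  show "log_Ostrowski M (exp ((1 - t) *\<^sub>R x + t *\<^sub>R y)) \<le> (1 - t) * log_Ostrowski M (exp x) + t * log_Ostrowski M (exp y)"
  proof (rule log_Ostrowski_le[OF M])
    fix n
    have "(1 - t) * (real n * x - ln (M n)) \<le> (1 - t) * log_Ostrowski M (exp x)"
      using log_Ostrowski_ge[OF M, of "exp x" n] t by (intro mult_left_mono) auto
    moreover have "t * (real n * y - ln (M n)) \<le> t * log_Ostrowski M (exp y)"
      using log_Ostrowski_ge[OF M, of "exp y" n] t by (intro mult_left_mono) auto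
    ultimately show "real n * ln (exp ((1 - t) *\<^sub>R x + t *\<^sub>R y)) - ln (M n) \<le> (1 - t) * log_Ostrowski M (exp x) + t * log_Ostrowski M (exp y)"
      by (simp add: algebra_simps)
  qed simp
qed simp

lemma convex_power_nonneg:
  fixes a b t :: real
  assumes "0 \<le> t" "t \<le> 1" "0 \<le> a" "0 \<le> b"
  shows "((1 - t) * a + t * b) ^ n \<le> (1 - t) * a ^ n + t * b ^ n"
proof -
  have "convex_on {0::real..} (\<lambda>x. x ^ n)"
    using convex_power_odd[of n] convex_on_subset[OF convex_power_even[of n], of "{0..}"] by (cases "even n") auto
  from convex_onD[OF this assms(1,2), of a b] show ?thesis using assms by simp
qed

text \<open>Continuity comes from convexity: \<open>Ostrowski M \<bar>r\<bar>\<close> is a supremum of the convex functions \<open>\<bar>r\<bar> ^ n / M n\<close>.\<close>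

lemma weight_log_Ostrowski:
  assumes M: "finite_Ostrowski M" shows "weight (log_Ostrowski M)"
proof -
  have conv: "convex_on UNIV (\<lambda>r. Ostrowski M \<bar>r\<bar>)"
  proof (rule convex_onI)
    fix t x y :: real assume t: "0 < t" "t < 1"
    show "Ostrowski M \<bar>(1 - t) *\<^sub>R x + t *\<^sub>R y\<bar> \<le> (1 - t) * Ostrowski M \<bar>x\<bar> + t * Ostrowski M \<bar>y\<bar>"
    proof (rule Ostrowski_le)
      fix n
      have "\<bar>(1 - t) * x + t * y\<bar> \<le> \<bar>(1 - t) * x\<bar> + \<bar>t * y\<bar>" by (rule abs_triangle_ineq)
      also have "\<dots> = (1 - t) * \<bar>x\<bar> + t * \<bar>y\<bar>" using t by (simp add: abs_mult)
      finally have "\<bar>(1 - t) *\<^sub>R x + t *\<^sub>R y\<bar> ^ n \<le> ((1 - t) * \<bar>x\<bar> + t * \<bar>y\<bar>) ^ n" by (intro power_mono) auto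
      also have "\<dots> \<le> (1 - t) * \<bar>x\<bar> ^ n + t * \<bar>y\<bar> ^ n" using t by (intro convex_power_nonneg) auto
      finally have "\<bar>(1 - t) *\<^sub>R x + t *\<^sub>R y\<bar> ^ n / M n \<le> ((1 - t) * \<bar>x\<bar> ^ n + t * \<bar>y\<bar> ^ n) / M n"
        using finite_Ostrowski_pos[OF M, of n] by (intro divide_right_mono) auto
      also have "\<dots> = (1 - t) * (\<bar>x\<bar> ^ n / M n) + t * (\<bar>y\<bar> ^ n / M n)" by (simp add: add_divide_distrib)
      also have "\<dots> \<le> (1 - t) * Ostrowski M \<bar>x\<bar> + t * Ostrowski M \<bar>y\<bar>"
        using t by (intro add_mono mult_left_mono Ostrowski_ge[OF M]) auto
      finally show "\<bar>(1 - t) *\<^sub>R x + t *\<^sub>R y\<bar> ^ n / M n \<le> (1 - t) * Ostrowski M \<bar>x\<bar> + t * Ostrowski M \<bar>y\<bar>" .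
    qed
  qed simp
  have "continuous_on UNIV (\<lambda>r. Ostrowski M \<bar>r\<bar>)" by (rule convex_on_continuous[OF open_UNIV conv])
  then have "continuous_on UNIV (\<lambda>r. ln (Ostrowski M \<bar>r\<bar>))"
    by (intro continuous_on_ln) (use Ostrowski_pos[OF M] in \<open>auto simp: less_imp_neq[symmetric]\<close>)
  moreover have "mono_on {0..} (log_Ostrowski M)"
  proof (rule mono_onI)
    fix r s :: real assume rs: "r \<in> {0..}" "s \<in> {0..}" "r \<le> s"
    have "Ostrowski M r \<le> Ostrowski M s"
    proof (rule Ostrowski_le)
      fix n
      have "r ^ n / M n \<le> s ^ n / M n" using rs finite_Ostrowski_pos[OF M, of n] by (intro divide_right_mono power_mono) auto
      also have "\<dots> \<le> Ostrowski M s" by (rule Ostrowski_ge[OF M]) (use rs in auto)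
      finally show "r ^ n / M n \<le> Ostrowski M s" .
    qed
    then show "log_Ostrowski M r \<le> log_Ostrowski M s"
      using Ostrowski_pos[OF M, of r] rs by (simp add: log_Ostrowski_def)
  qed
  ultimately show ?thesis unfolding weight_def by (simp add: log_Ostrowski_def[abs_def])
qed

text \<open>Convexity in \<open>ln t\<close> gives the existence of the right derivative and places the graph above the right tangent.\<close>

lemma log_Ostrowski_right_slope:
  assumes M: "finite_Ostrowski M" and y: "y > 0"
  shows "t \<ge> y \<Longrightarrow> log_Ostrowski M t \<ge> log_Ostrowski M y + y * right_deriv (log_Ostrowski M) y * ln (t / y)"
    and "right_deriv (log_Ostrowski M) y \<ge> 0"
proof -
  let ?\<phi> = "log_Ostrowski M"
  define f where "f = (\<lambda>v. ?\<phi> (exp v))"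
  have fl: "f (ln t) = ?\<phi> t" if "t > 0" for t using that by (simp add: f_def)
  obtain n where n: "((\<lambda>w. (f w - f (ln y)) / (w - ln y)) \<longlongrightarrow> n) (at_right (ln y))"
      "\<And>w. w \<ge> ln y \<Longrightarrow> f w \<ge> f (ln y) + n * (w - ln y)"
    using convex_right_slope[OF convex_log_Ostrowski_exp[OF M], of "ln y"] unfolding f_def by blast
  have fd: "(f has_vector_derivative n) (at (ln y) within {ln y..})"
    unfolding at_within_Ici_at_right has_real_derivative_iff_has_vector_derivative[symmetric] has_field_derivative_iff by (rule n(1))
  have ld: "(ln has_vector_derivative 1 / y) (at y within {y..})"
    using y by (auto intro!: has_vector_derivative_at_within simp: has_real_derivative_iff_has_vector_derivative[symmetric] intro!: derivative_eq_intros)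
  have "((f \<circ> ln) has_vector_derivative (1 / y) *\<^sub>R n) (at y within {y..})"
    by (rule vector_diff_chain_within[OF ld], rule has_vector_derivative_within_subset[OF fd]) (use y in auto)
  then have "(?\<phi> has_vector_derivative (1 / y) *\<^sub>R n) (at y within {y..})"
    by (rule has_vector_derivative_transform[rotated 2]) (use y fl in auto)
  then have "(?\<phi> has_vector_derivative (1 / y) *\<^sub>R n) (at_right y)" by (simp only: at_within_Ici_at_right)
  then have rd: "right_deriv ?\<phi> y = n / y" unfolding right_deriv_def by (subst vector_derivative_within) auto
  show "t \<ge> y \<Longrightarrow> ?\<phi> t \<ge> ?\<phi> y + y * right_deriv ?\<phi> y * ln (t / y)"
    using n(2)[of "ln t"] y fl[of t] fl[of y] unfolding rd by (simp add: ln_div)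
  have "n \<ge> 0"
  proof (rule tendsto_lowerbound[OF n(1)])
    show "\<forall>\<^sub>F w in at_right (ln y). 0 \<le> (f w - f (ln y)) / (w - ln y)"
      unfolding eventually_at_right_field
    proof (intro exI[of _ "ln y + 1"] conjI allI impI)
      fix w assume w: "w > ln y"
      then have "exp (ln y) \<le> exp w" by simp
      then have "f (ln y) \<le> f w" unfolding f_def using weight_mono[OF weight_log_Ostrowski[OF M], of "exp (ln y)" "exp w"] by simp
      then show "0 \<le> (f w - f (ln y)) / (w - ln y)" using w by simp
    qed simp
  qed simp
  then show "right_deriv ?\<phi> y \<ge> 0" unfolding rd using y by simp
qed

text \<open>Passing from \<open>M n\<close> to \<open>M (n + 2)\<close> absorbs a factor \<open>z\<^sup>2\<close> in estimates of Laplace transforms, which makes them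
integrable along horizontal lines at the cost of a logarithm.\<close>

lemma log_Ostrowski_shift:
  assumes M: "finite_Ostrowski M"
  shows "finite_Ostrowski (\<lambda>n. M (n + 2))" "\<exists>C. \<forall>t. log_Ostrowski M t \<le> log_Ostrowski (\<lambda>n. M (n + 2)) t + ln (1 + t\<^sup>2) + C"
proof -
  let ?N = "\<lambda>n. M (n + 2)"
  show N: "finite_Ostrowski ?N" unfolding finite_Ostrowski_def
  proof (intro conjI allI impI)
    show "?N n > 0" for n by (rule finite_Ostrowski_pos[OF M])
    fix r :: real assume r: "r \<ge> 0"
    show "bdd_above (range (\<lambda>n. r ^ n / ?N n))" unfolding bdd_above_def
    proof (intro exI ballI)
      fix v assume "v \<in> range (\<lambda>n. r ^ n / ?N n)"
      then obtain n where v: "v = r ^ n / ?N n" by blast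
      have "r ^ n \<le> (max r 1) ^ n" using r by (intro power_mono) auto
      also have "\<dots> \<le> (max r 1) ^ (n + 2)" by (intro power_increasing) auto
      finally have "v \<le> (max r 1) ^ (n + 2) / ?N n" unfolding v using finite_Ostrowski_pos[OF M, of "n+2"] by (intro divide_right_mono) auto
      also have "\<dots> \<le> Ostrowski M (max r 1)" by (rule Ostrowski_ge[OF M]) simp
      finally show "v \<le> Ostrowski M (max r 1)" .
    qed
  qed
  \<comment> \<open>The terms \<open>n = 0\<close> and \<open>n = 1\<close> have no counterpart in the shifted sequence; \<open>1 / M 2\<close> serves as a lower bound for its Ostrowski function.\<close>
  define C where "C = 1 + M 2 / M 0 + M 2 / M 1"
  have Mp: "M 0 > 0" "M 1 > 0" "M 2 > 0" using finite_Ostrowski_pos[OF M] by auto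
  have C: "C \<ge> 1" "C > 0" unfolding C_def using Mp by (auto intro!: add_pos_nonneg divide_nonneg_nonneg simp: add_nonneg_nonneg)
  have "log_Ostrowski M t \<le> log_Ostrowski ?N t + ln (1 + t\<^sup>2) + ln C" for t
  proof -
    let ?r = "\<bar>t\<bar>"
    have T2: "Ostrowski ?N ?r \<ge> 1 / M 2" using Ostrowski_ge[OF N, of ?r 0] by (simp add: numeral_2_eq_2)
    have T2p: "Ostrowski ?N ?r > 0" by (rule Ostrowski_pos[OF N]) simp
    have tp: "1 + t\<^sup>2 > 0" by (simp add: add_pos_nonneg)
    have "Ostrowski M ?r \<le> C * (1 + t\<^sup>2) * Ostrowski ?N ?r"
    proof (rule Ostrowski_le)
      fix n :: nat
      have "n = 0 \<or> n = 1 \<or> n = (n - 2) + 2" by arith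
      then consider "n = 0" | "n = 1" | m where "n = m + 2" by blast
      then show "?r ^ n / M n \<le> C * (1 + t\<^sup>2) * Ostrowski ?N ?r"
      proof cases
        case 1
        have "1 / M 0 = M 2 / M 0 * 1 * (1 / M 2)" using Mp by simp
        also have "\<dots> \<le> C * (1 + t\<^sup>2) * Ostrowski ?N ?r"
          using Mp T2 C by (intro mult_mono) (auto simp: C_def intro!: mult_nonneg_nonneg add_nonneg_nonneg)
        finally show ?thesis using 1 by simp
      next
        case 2
        have "?r \<le> 1 + t\<^sup>2" using zero_le_power2[of "?r - 1/2"] by (simp add: power2_diff power_divide)
        have "?r / M 1 = M 2 / M 1 * ?r * (1 / M 2)" using Mp by simp
        also have "\<dots> \<le> C * (1 + t\<^sup>2) * Ostrowski ?N ?r"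
          using Mp T2 C \<open>?r \<le> 1 + t\<^sup>2\<close> by (intro mult_mono) (auto simp: C_def intro!: mult_nonneg_nonneg add_nonneg_nonneg)
        finally show ?thesis using 2 by simp
      next
        case 3
        have "?r ^ n / M n = t\<^sup>2 * (?r ^ m / M (m + 2))" using 3 by (simp add: power_add power2_eq_square)
        also have "\<dots> \<le> (1 + t\<^sup>2) * Ostrowski ?N ?r"
          using Ostrowski_ge[OF N, of ?r m] finite_Ostrowski_pos[OF M, of "m+2"] by (intro mult_mono) auto
        also have "\<dots> \<le> C * ((1 + t\<^sup>2) * Ostrowski ?N ?r)"
          using C T2p tp mult_right_mono[of 1 C "(1 + t\<^sup>2) * Ostrowski ?N ?r"] by simp
        finally show ?thesis by (simp add: mult.assoc)
      qed
    qed
    then have "ln (Ostrowski M ?r) \<le> ln (C * (1 + t\<^sup>2) * Ostrowski ?N ?r)"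
      using Ostrowski_pos[OF M, of ?r] by (intro ln_mono) auto
    also have "\<dots> = ln C + ln (1 + t\<^sup>2) + ln (Ostrowski ?N ?r)" using C tp T2p by (simp add: ln_mult)
    finally show ?thesis by (simp add: log_Ostrowski_def)
  qed
  then show "\<exists>C. \<forall>t. log_Ostrowski M t \<le> log_Ostrowski ?N t + ln (1 + t\<^sup>2) + C" by blast
qed

lemma log_integrable_ln: "log_integrable (\<lambda>t. ln (1 + t\<^sup>2))"
proof -
  let ?F = "\<lambda>t::real. - (ln (1 + t) + 1) / (1 + t)" and ?f = "\<lambda>t::real. ln (1 + t) / (1 + t)\<^sup>2"
  have d: "(?F has_real_derivative ?f t) (at t)" if t: "t \<ge> 0" for t
  proof -
    have l: "((\<lambda>t. - (ln (1 + t) + 1)) has_real_derivative - (1 / (1 + t))) (at t)"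
      using t by (auto intro!: derivative_eq_intros)
    have o: "((\<lambda>t. 1 + t) has_real_derivative 1) (at t)" by (auto intro!: derivative_eq_intros)
    have "(?F has_real_derivative (- (1 / (1 + t)) * (1 + t) - - (ln (1 + t) + 1) * 1) / ((1 + t) * (1 + t))) (at t)"
      by (rule DERIV_divide[OF l o]) (use t in simp)
    moreover have "- (1 / (1 + t)) * (1 + t) = - 1" using t by simp
    ultimately show ?thesis by (simp add: power2_eq_square)
  qed
  have m: "?f \<in> borel_measurable borel" by measurable
  have lim: "(?F \<longlongrightarrow> 0) at_top" by real_asymp
  have i0: "set_integrable lborel {0..} ?f"
    by (rule set_integral_FTC_atLeast_nonneg(1)[OF m d _ lim]) simp_all
  have "set_integrable lborel {0..} (\<lambda>t::real. ln (1 + t\<^sup>2) / (1 + t\<^sup>2))"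
  proof (rule set_integrable_bound[where f = "\<lambda>t::real. 4 * ?f t"])
    show "set_integrable lborel {0..} (\<lambda>t::real. 4 * ?f t)"
      using i0 by (intro set_integrable_mult_right) auto
    have "(\<lambda>t::real. ln (1 + t\<^sup>2) / (1 + t\<^sup>2)) \<in> borel_measurable borel" by measurable
    then show "set_borel_measurable lborel {0..} (\<lambda>t::real. ln (1 + t\<^sup>2) / (1 + t\<^sup>2))"
      unfolding set_borel_measurable_def by (intro borel_measurable_scaleR) auto
    show "AE t in lborel. (t::real) \<in> {0..} \<longrightarrow> norm (ln (1 + t\<^sup>2) / (1 + t\<^sup>2)) \<le> norm (4 * ?f t)"
    proof (intro AE_I2 impI)
      fix t :: real assume "t \<in> {0..}"
      then have t: "t \<ge> 0" by simp
      have p: "1 + t\<^sup>2 > 0" by (simp add: add_pos_nonneg)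
      have q: "(1 + t)\<^sup>2 > 0" using t by simp
      have "ln (1 + t\<^sup>2) \<le> ln ((1 + t)\<^sup>2)"
        by (rule ln_mono[OF _ p]) (use t in \<open>simp add: power2_sum\<close>)
      also have "\<dots> = 2 * ln (1 + t)" using t by (simp add: ln_realpow)
      finally have l: "ln (1 + t\<^sup>2) \<le> 2 * ln (1 + t)" .
      have "(1 + t)\<^sup>2 \<le> 2 * (1 + t\<^sup>2)" using zero_le_power2[of "1 - t"] by (simp add: power2_eq_square algebra_simps)
      then have "2 / (2 * (1 + t\<^sup>2)) \<le> 2 / (1 + t)\<^sup>2" by (rule divide_left_mono) (intro mult_pos_pos p q zero_less_numeral zero_le_numeral)+
      moreover have "2 / (2 * w) = 1 / w" for w :: real by simp
      ultimately have "1 / (1 + t\<^sup>2) \<le> 2 / (1 + t)\<^sup>2" by (simp only:)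
      then have "ln (1 + t\<^sup>2) * (1 / (1 + t\<^sup>2)) \<le> 2 * ln (1 + t) * (2 / (1 + t)\<^sup>2)"
        using l t p by (intro mult_mono) auto
      then have "ln (1 + t\<^sup>2) / (1 + t\<^sup>2) \<le> 4 * ?f t" by simp
      moreover have "ln (1 + t\<^sup>2) / (1 + t\<^sup>2) \<ge> 0" using p by simp
      ultimately show "norm (ln (1 + t\<^sup>2) / (1 + t\<^sup>2)) \<le> norm (4 * ?f t)" by (simp only: real_norm_def)
    qed
  qed
  then show ?thesis unfolding log_integrable_def by (intro even_integral_lborel(1)) auto
qed

lemma poisson_ln_bound:
  "\<exists>C. \<forall>y>0. poisson (\<lambda>t. ln (1 + t\<^sup>2)) 0 y \<le> 2 * ln (1 + y) + C"
proof -
  let ?l = "\<lambda>u::real. ln (1 + u\<^sup>2)"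
  have il: "integrable lborel (\<lambda>u. ?l u / (1 + u\<^sup>2))" using log_integrable_ln by (simp add: log_integrable_def)
  define K where "K = (\<integral>u. ?l u / (1 + u\<^sup>2) \<partial>lborel) / pi"
  have "poisson ?l 0 y \<le> 2 * ln (1 + y) + K" if y: "y > 0" for y
  proof -
    have eq: "poisson ?l 0 y = (\<integral>u. ?l (y * u) / (1 + u\<^sup>2) \<partial>lborel) / pi" using poisson_affine[OF y, of ?l 0] by simp
    have "(\<integral>u. ?l (y * u) / (1 + u\<^sup>2) \<partial>lborel) \<le> (\<integral>u. 2 * ln (1 + y) * (1 / (1 + u\<^sup>2)) + ?l u / (1 + u\<^sup>2) \<partial>lborel)"
    proof (rule integral_mono')
      show "integrable lborel (\<lambda>u. 2 * ln (1 + y) * (1 / (1 + u\<^sup>2)) + ?l u / (1 + u\<^sup>2))"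
        by (intro Bochner_Integration.integrable_add integrable_mult_right integrable_cauchy il)
      fix u :: real
      have p: "1 + u\<^sup>2 > 0" by (simp add: add_pos_nonneg)
      have "1 + (y * u)\<^sup>2 \<le> (1 + y)\<^sup>2 * (1 + u\<^sup>2)"
      proof -
        have "0 \<le> y\<^sup>2 + 2 * y + (1 + 2 * y) * u\<^sup>2" using y by simp
        then show ?thesis by (simp add: power2_eq_square algebra_simps)
      qed
      then have "?l (y * u) \<le> ln ((1 + y)\<^sup>2 * (1 + u\<^sup>2))" by (intro ln_mono) (auto simp: add_pos_nonneg)
      also have "\<dots> = 2 * ln (1 + y) + ?l u" using y p by (simp add: ln_mult ln_realpow)
      finally have "?l (y * u) / (1 + u\<^sup>2) \<le> (2 * ln (1 + y) + ?l u) / (1 + u\<^sup>2)" using p by (intro divide_right_mono) auto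
      then show "?l (y * u) / (1 + u\<^sup>2) \<le> 2 * ln (1 + y) * (1 / (1 + u\<^sup>2)) + ?l u / (1 + u\<^sup>2)"
        by (simp add: add_divide_distrib)
      show "0 \<le> 2 * ln (1 + y) * (1 / (1 + u\<^sup>2)) + ?l u / (1 + u\<^sup>2)"
        using y p by (intro add_nonneg_nonneg mult_nonneg_nonneg divide_nonneg_nonneg) auto
    qed
    moreover have "(\<integral>u. 2 * ln (1 + y) * (1 / (1 + u\<^sup>2)) + ?l u / (1 + u\<^sup>2) \<partial>lborel)
        = (\<integral>u. 2 * ln (1 + y) * (1 / (1 + u\<^sup>2)) \<partial>lborel) + (\<integral>u. ?l u / (1 + u\<^sup>2) \<partial>lborel)"
      by (intro Bochner_Integration.integral_add integrable_mult_right integrable_cauchy il)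
    moreover have "(\<integral>u. 2 * ln (1 + y) * (1 / (1 + u\<^sup>2)) \<partial>lborel) = 2 * ln (1 + y) * pi"
      by (subst Bochner_Integration.integral_mult_right_zero) (simp only: integral_cauchy)
    moreover have "(\<integral>u. ?l u / (1 + u\<^sup>2) \<partial>lborel) = K * pi" unfolding K_def by simp
    ultimately have "(\<integral>u. ?l (y * u) / (1 + u\<^sup>2) \<partial>lborel) \<le> (2 * ln (1 + y) + K) * pi"
      by (simp only: distrib_right)
    then show ?thesis unfolding eq by (simp only: pos_divide_le_eq pi_gt_zero)
  qed
  then show ?thesis by blast
qed

section \<open>Laplace transforms and Fourier inversion\<close>

lemma nth_vderiv_0: "nth_vderiv 0 g = g" by (simp add: nth_vderiv_def)

lemma nth_vderiv_Suc: "nth_vderiv (Suc n) g = (\<lambda>t. vector_derivative (nth_vderiv n g) (at t))"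
  by (simp add: nth_vderiv_def)

lemma smooth_fun_derivative:
  "smooth_fun g \<Longrightarrow> (nth_vderiv n g has_vector_derivative nth_vderiv (Suc n) g x) (at x)"
  unfolding smooth_fun_def nth_vderiv_Suc by (simp add: vector_derivative_works[symmetric])

lemma smooth_fun_continuous: "smooth_fun g \<Longrightarrow> continuous_on UNIV (nth_vderiv n g)"
  unfolding continuous_on_eq_continuous_at[OF open_UNIV]
  by (intro ballI has_vector_derivative_continuous[OF smooth_fun_derivative])

text \<open>How iterated derivatives are computed below: a sequence of functions in which each is the derivative of the previous
one consists of the iterated derivatives of the first.\<close>

lemma nth_vderiv_eqI:
  assumes D0: "D 0 = g" and D: "\<And>n x. (D n has_vector_derivative D (Suc n) x) (at x)"
  shows "nth_vderiv n g = D n"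
proof (induction n)
  case 0
  then show ?case by (simp add: nth_vderiv_0 D0)
next
  case (Suc n)
  show ?case unfolding nth_vderiv_Suc Suc.IH using D[of n] by (auto intro: vector_derivative_at)
qed

lemma smooth_funI:
  assumes D0: "D 0 = g" and D: "\<And>n x. (D n has_vector_derivative D (Suc n) x) (at x)"
  shows "smooth_fun g"
  unfolding smooth_fun_def nth_vderiv_eqI[of D, OF D0 D]
  using D by (auto intro: differentiableI_vector)

text \<open>Translations and the reflection preserve the class, so a flat point may be moved to \<open>0\<close> with the function nonzero
somewhere to its right.\<close>

lemma DC_class_affine:
  assumes g: "g \<in> DC_class M" and c: "\<bar>c\<bar> = 1"
  shows "(\<lambda>x. g (a + c * x)) \<in> DC_class M" "nth_vderiv n (\<lambda>x. g (a + c * x)) = (\<lambda>x. of_real c ^ n * nth_vderiv n g (a + c * x))"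
proof -
  have sm: "smooth_fun g" using g by (simp add: DC_class_def)
  define D where "D = (\<lambda>n x. of_real c ^ n * nth_vderiv n g (a + c * x))"
  have D0: "D 0 = (\<lambda>x. g (a + c * x))" by (simp add: D_def nth_vderiv_0)
  have D: "(D n has_vector_derivative D (Suc n) x) (at x)" for n x
  proof -
    have "((\<lambda>x. a + c * x) has_vector_derivative c) (at x)" by (auto intro!: derivative_eq_intros)
    from vector_diff_chain_at[OF this smooth_fun_derivative[OF sm]]
    have "((\<lambda>x. nth_vderiv n g (a + c * x)) has_vector_derivative c *\<^sub>R nth_vderiv (Suc n) g (a + c * x)) (at x)"
      by (simp add: comp_def)
    from has_vector_derivative_mult_right[OF this, of "of_real c ^ n"]
    show ?thesis by (simp add: D_def scaleR_conv_of_real mult.assoc mult.left_commute)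
  qed
  have e: "nth_vderiv n (\<lambda>x. g (a + c * x)) = D n" for n by (rule nth_vderiv_eqI[of D, OF D0 D])
  then show "nth_vderiv n (\<lambda>x. g (a + c * x)) = (\<lambda>x. of_real c ^ n * nth_vderiv n g (a + c * x))" by (simp add: D_def)
  have "smooth_fun (\<lambda>x. g (a + c * x))" by (rule smooth_funI[of D, OF D0 D])
  then show "(\<lambda>x. g (a + c * x)) \<in> DC_class M"
    using g c by (simp add: DC_class_def e) (simp add: D_def norm_mult norm_power)
qed

text \<open>In the variable of the upper half-plane: \<open>laplace f (\<xi> + \<i> * \<eta>)\<close> is the Fourier transform of \<open>f x * exp (- \<eta> * x)\<close> on the
positive half-line.\<close>

definition laplace :: "(real \<Rightarrow> complex) \<Rightarrow> complex \<Rightarrow> complex" where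
  "laplace f z = (LINT x:{0..}|lborel. f x * exp (\<i> * z * of_real x))"

lemma exp_decay_integral:
  assumes y: "y > 0"
  shows "set_integrable lborel {0..} (\<lambda>x::real. exp (- (y * x)))" "(LINT x:{0..}|lborel. exp (- (y * x))) = 1 / y"
proof -
  have d: "((\<lambda>x. - exp (- (y * x)) / y) has_real_derivative exp (- (y * x))) (at x)" for x
    using y by (auto intro!: derivative_eq_intros)
  have m: "(\<lambda>x::real. exp (- (y * x))) \<in> borel_measurable borel" by measurable
  have lim: "((\<lambda>x. - exp (- (y * x)) / y) \<longlongrightarrow> 0) at_top" using y by real_asymp
  show "set_integrable lborel {0..} (\<lambda>x::real. exp (- (y * x)))"
    by (rule set_integral_FTC_atLeast_nonneg(1)[OF m d _ lim]) simp
  show "(LINT x:{0..}|lborel. exp (- (y * x))) = 1 / y"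
    using set_integral_FTC_atLeast_nonneg(2)[OF m d _ lim, of 0] by simp
qed

lemma norm_laplace_kernel: "norm (exp (\<i> * z * of_real x)) = exp (- (Im z * x))"
  by (simp add: norm_exp_eq_Re)

lemma laplace_integrable:
  assumes f: "f \<in> borel_measurable borel" "\<And>x. norm (f x) \<le> B" and z: "Im z > 0"
  shows "set_integrable lborel {0..} (\<lambda>x. f x * exp (\<i> * z * of_real x))"
proof (rule set_integrable_bound)
  show "set_integrable lborel {0..} (\<lambda>x. B * exp (- (Im z * x)))"
    using exp_decay_integral(1)[OF z] by (intro set_integrable_mult_right) auto
  have [measurable]: "f \<in> borel_measurable borel" by (rule f)
  have [measurable]: "(\<lambda>x::real. exp (\<i> * z * of_real x)) \<in> borel_measurable borel"
    by (intro borel_measurable_continuous_onI continuous_intros)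
  have "(\<lambda>x. f x * exp (\<i> * z * of_real x)) \<in> borel_measurable borel" by measurable
  then show "set_borel_measurable lborel {0..} (\<lambda>x. f x * exp (\<i> * z * of_real x))"
    unfolding set_borel_measurable_def by (intro borel_measurable_scaleR) auto
  have "norm (f x * exp (\<i> * z * of_real x)) \<le> norm (B * exp (- (Im z * x)))" for x
  proof -
    have "norm (f x * exp (\<i> * z * of_real x)) = norm (f x) * exp (- (Im z * x))"
      by (simp only: norm_mult norm_laplace_kernel)
    also have "\<dots> \<le> B * exp (- (Im z * x))" by (intro mult_right_mono f) auto
    finally show ?thesis by simp
  qed
  then show "AE x in lborel. x \<in> {0..} \<longrightarrow> norm (f x * exp (\<i> * z * of_real x)) \<le> norm (B * exp (- (Im z * x)))" by simp
qed

lemma laplace_bound: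
  assumes f: "f \<in> borel_measurable borel" "\<And>x. norm (f x) \<le> B" and z: "Im z > 0"
  shows "norm (laplace f z) \<le> B / Im z"
proof -
  have i: "set_integrable lborel {0..} (\<lambda>x. B * exp (- (Im z * x)))"
    using exp_decay_integral(1)[OF z] by (intro set_integrable_mult_right) auto
  have "norm (laplace f z) \<le> (\<integral>x. indicator {0..} x *\<^sub>R (B * exp (- (Im z * x))) \<partial>lborel)"
    unfolding laplace_def set_lebesgue_integral_def
  proof (rule order_trans[OF integral_norm_bound], rule integral_mono)
    show "integrable lborel (\<lambda>x. norm (indicator {0..} x *\<^sub>R (f x * exp (\<i> * z * of_real x))))"
      using laplace_integrable[OF f z] unfolding set_integrable_def by (rule integrable_norm)
    show "integrable lborel (\<lambda>x. indicator {0..} x *\<^sub>R (B * exp (- (Im z * x))))"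
      using i unfolding set_integrable_def .
    fix x :: real
    have "norm (f x * exp (\<i> * z * of_real x)) \<le> B * exp (- (Im z * x))"
      by (simp only: norm_mult norm_laplace_kernel) (intro mult_right_mono f, simp)
    then show "norm (indicator {0..} x *\<^sub>R (f x * exp (\<i> * z * of_real x))) \<le> indicator {0..} x *\<^sub>R (B * exp (- (Im z * x)))"
      by (cases "x \<in> {0..}") simp_all
  qed
  also have "\<dots> = B * (1 / Im z)"
    using exp_decay_integral(2)[OF z] unfolding set_lebesgue_integral_def[symmetric] set_integral_mult_right by simp
  finally show ?thesis by simp
qed

text \<open>Integration by parts; the boundary term at \<open>0\<close> is \<open>f 0\<close>.\<close>

lemma laplace_derivative:
  assumes F: "\<And>x. (f has_vector_derivative f' x) (at x)" and f': "continuous_on UNIV f'"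
    and b: "\<And>x. norm (f x) \<le> B" "\<And>x. norm (f' x) \<le> B'" and f0: "f 0 = 0" and z: "Im z > 0"
  shows "laplace f' z = - (\<i> * z) * laplace f z"
proof -
  have cf: "continuous_on UNIV f" unfolding continuous_on_eq_continuous_at[OF open_UNIV]
    by (intro ballI has_vector_derivative_continuous[OF F])
  have m: "f \<in> borel_measurable borel" "f' \<in> borel_measurable borel"
    by (intro borel_measurable_continuous_onI cf f')+
  let ?e = "\<lambda>x::real. exp (\<i> * z * of_real x)"
  have i1: "set_integrable lborel {0..} (\<lambda>x. f' x * ?e x)" by (rule laplace_integrable[OF m(2) b(2) z])
  have i2: "set_integrable lborel {0..} (\<lambda>x. (\<i> * z) * (f x * ?e x))"
    using laplace_integrable[OF m(1) b(1) z] by (intro set_integrable_mult_right) auto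
  have "(LINT x:{0..}|lborel. f' x * ?e x + (\<i> * z) * (f x * ?e x)) = 0 - f 0 * ?e 0"
  proof (rule set_integral_FTC_atLeast)
    show "set_integrable lborel {0..} (\<lambda>x. f' x * ?e x + (\<i> * z) * (f x * ?e x))"
      using i1 i2 by (rule set_integral_add(1))
    show "((\<lambda>x. f x * ?e x) has_vector_derivative f' x * ?e x + (\<i> * z) * (f x * ?e x)) (at x)" for x
    proof -
      have "(?e has_vector_derivative (\<i> * z) * ?e x) (at x)"
      proof -
        have "((\<lambda>w. exp (\<i> * z * w)) has_field_derivative (\<i> * z) * ?e x) (at (of_real x))"
          by (auto intro!: derivative_eq_intros)
        then have "((\<lambda>w. exp (\<i> * z * w)) \<circ> of_real has_vector_derivative 1 * ((\<i> * z) * ?e x)) (at x)"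
          by (intro field_vector_diff_chain_at has_vector_derivative_of_real) (auto intro!: derivative_eq_intros)
        then show ?thesis by (simp add: comp_def)
      qed
      from has_vector_derivative_mult[OF F this]
      show ?thesis by (simp add: mult.commute mult.left_commute add.commute)
    qed
    show "continuous_on {0..} (\<lambda>x. f' x * ?e x + (\<i> * z) * (f x * ?e x))"
      by (intro continuous_intros continuous_on_subset[OF cf] continuous_on_subset[OF f']) auto
    have dec: "((\<lambda>x. B * exp (- (Im z * x))) \<longlongrightarrow> 0) at_top" using z by real_asymp
    show "((\<lambda>x. f x * ?e x) \<longlongrightarrow> 0) at_top"
    proof (rule tendsto_norm_zero_cancel, rule tendsto_sandwich[OF _ _ tendsto_const dec])
      show "\<forall>\<^sub>F x in at_top. norm (f x * ?e x) \<le> B * exp (- (Im z * x))"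
        by (intro always_eventually allI) (simp only: norm_mult norm_laplace_kernel, intro mult_right_mono b, simp)
    qed simp
  qed
  then have "(LINT x:{0..}|lborel. f' x * ?e x) + (LINT x:{0..}|lborel. (\<i> * z) * (f x * ?e x)) = 0"
    unfolding set_integral_add(2)[OF i1 i2] using f0 by simp
  then have "laplace f' z + (\<i> * z) * laplace f z = 0" unfolding laplace_def set_integral_mult_right .
  then show ?thesis by (simp add: eq_neg_iff_add_eq_0)
qed

lemma laplace_holomorphic:
  assumes f: "f \<in> borel_measurable borel" "\<And>x. norm (f x) \<le> B"
  shows "laplace f holomorphic_on {z. Im z > 0}"
  unfolding laplace_def set_lebesgue_integral_def
proof (rule holomorphic_parameter_integral(1))
  show "open {z. Im z > 0}" by (rule open_halfspace_Im_gt)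
  show "(\<lambda>z. indicator {0..} x *\<^sub>R (f x * exp (\<i> * z * complex_of_real x))) holomorphic_on {z. 0 < Im z}" for x
    unfolding scaleR_conv_of_real by (intro holomorphic_intros)
  show "(\<lambda>x. indicator {0..} x *\<^sub>R (f x * exp (\<i> * z * complex_of_real x))) \<in> borel_measurable lborel" if "z \<in> {z. 0 < Im z}" for z
    using laplace_integrable[OF f, of z] that by (auto simp: set_integrable_def)
  fix z assume z: "z \<in> {z. 0 < Im z}"
  define r where "r = Im z / 2"
  have r: "r > 0" using z by (simp add: r_def)
  have w: "Im w \<ge> r" if "w \<in> cball z r" for w
  proof -
    have "\<bar>Im (z - w)\<bar> \<le> r" using that abs_Im_le_cmod[of "z - w"] by (simp add: dist_norm)
    then show "Im w \<ge> r" unfolding r_def minus_complex.sel by linarith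
  qed
  have B0: "B \<ge> 0" using f(2)[of 0] norm_ge_zero order_trans by blast
  show "\<exists>r>0. \<exists>K. cball z r \<subseteq> {z. 0 < Im z} \<and> integrable lborel K \<and>
         (\<forall>x. \<forall>w\<in>cball z r. norm (indicator {0..} x *\<^sub>R (f x * exp (\<i> * w * complex_of_real x))) \<le> K x)"
  proof (intro exI[of _ r] conjI exI[of _ "\<lambda>x. indicator {0..} x *\<^sub>R (B * exp (- (r * x)))"] allI ballI)
    show "cball z r \<subseteq> {z. 0 < Im z}" using w r by fastforce
    have "set_integrable lborel {0..} (\<lambda>x. B * exp (- (r * x)))"
      using exp_decay_integral(1)[OF r] by (intro set_integrable_mult_right) auto
    then show "integrable lborel (\<lambda>x. indicator {0..} x *\<^sub>R (B * exp (- (r * x))))" by (simp add: set_integrable_def)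
    fix x :: real and w assume wb: "w \<in> cball z r"
    show "norm (indicator {0..} x *\<^sub>R (f x * exp (\<i> * w * complex_of_real x))) \<le> indicator {0..} x *\<^sub>R (B * exp (- (r * x)))"
    proof (cases "x \<ge> 0")
      case True
      have "r * x \<le> Im w * x" using w[OF wb] True by (intro mult_right_mono) auto
      then have "norm (f x) * exp (- (Im w * x)) \<le> B * exp (- (r * x))" using B0 by (intro mult_mono f) auto
      then have "norm (f x * exp (\<i> * w * complex_of_real x)) \<le> B * exp (- (r * x))"
        by (simp only: norm_mult norm_laplace_kernel)
      then show ?thesis using True by simp
    qed simp
  qed (rule r)
qed

lemma normal_density_fourier:
  "(\<integral>v. std_normal_density v *\<^sub>R iexp (v * t) \<partial>lborel) = of_real (exp (- t\<^sup>2 / 2))"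
proof -
  have "char std_normal_distribution t = (\<integral>v. std_normal_density v *\<^sub>R iexp (t * v) \<partial>lborel)"
    unfolding char_def by (subst integral_density) auto
  then show ?thesis by (simp add: char_std_normal_distribution mult.commute)
qed

text \<open>Fourier inversion with Gaussian summation. Only the resulting inequality is proved, so the Fourier transform enters
only through its majorant \<open>W\<close>. By Fubini, the average of \<open>f\<close> against a Gaussian of width \<open>1 / k\<close> about \<open>s\<close> equals
a Gaussian-weighted integral of the Fourier transform, for every \<open>k\<close>.\<close>

lemma fourier_inversion_bound:
  fixes f :: "real \<Rightarrow> complex"
  assumes f: "integrable lborel f" and B: "\<And>x. norm (f x) \<le> B" and cont: "isCont f s"
    and W: "integrable lborel W" and fW: "\<And>\<xi>. norm (\<integral>x. f x * iexp (\<xi> * x) \<partial>lborel) \<le> W \<xi>"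
  shows "norm (f s) \<le> (\<integral>\<xi>. W \<xi> \<partial>lborel) / (2 * pi)"
proof -
  have fm[measurable]: "f \<in> borel_measurable borel" using f by auto
  have Wm[measurable]: "W \<in> borel_measurable borel" using W by auto
  have W0: "W \<xi> \<ge> 0" for \<xi> using fW[of \<xi>] norm_ge_zero order_trans by blast
  let ?N = "std_normal_density"
  have N0: "?N v \<ge> 0" for v by (simp add: normal_density_nonneg)
  have Ni: "integrable lborel ?N" by (rule integrable_normal_density) simp
  have Nle: "?N v \<le> 1 / sqrt (2 * pi)" for v
    unfolding std_normal_density_def by (simp add: divide_right_mono)
  have key: "norm (\<integral>w. ?N w *\<^sub>R f (s + w / k) \<partial>lborel) \<le> (\<integral>\<xi>. W \<xi> \<partial>lborel) / (2 * pi)" if k: "k > 0" for k :: real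
  proof -
    \<comment> \<open>Both orders of integration of \<open>h\<close> are evaluated: over \<open>v\<close> by the Fourier transform of the Gaussian, over \<open>x\<close> by that of \<open>f\<close>.\<close>
    define h where "h = (\<lambda>x v. f x * (?N v *\<^sub>R iexp (v * (k * (x - s)))))"
    have hm: "case_prod h \<in> borel_measurable (lborel \<Otimes>\<^sub>M lborel)"
      unfolding h_def by measurable
    have hn: "norm (h x v) = norm (f x) * ?N v" for x v using N0[of v] by (simp add: h_def norm_mult)
    have ih: "integrable (lborel \<Otimes>\<^sub>M lborel) (case_prod h)"
    proof (rule lborel_pair.Fubini_integrable[OF hm])
      have "(\<lambda>x. \<integral>v. norm (case_prod h (x, v)) \<partial>lborel) = (\<lambda>x. norm (f x) * (\<integral>v. ?N v \<partial>lborel))"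
        by (simp add: hn)
      then show "integrable lborel (\<lambda>x. \<integral>v. norm (case_prod h (x, v)) \<partial>lborel)" using f by simp
      show "AE x in lborel. integrable lborel (\<lambda>v. case_prod h (x, v))"
      proof (rule AE_I2)
        fix x
        have "integrable lborel (\<lambda>v. norm (f x) * ?N v)" using Ni by simp
        then show "integrable lborel (\<lambda>v. case_prod h (x, v))"
        proof (rule Bochner_Integration.integrable_bound)
          show "(\<lambda>v. case_prod h (x, v)) \<in> borel_measurable lborel" unfolding h_def prod.case by measurable
          show "AE v in lborel. norm (case_prod h (x, v)) \<le> norm (norm (f x) * ?N v)"
            using N0 by (simp add: hn abs_mult)
        qed
      qed
    qed
    have swap: "(\<integral>v. (\<integral>x. h x v \<partial>lborel) \<partial>lborel) = (\<integral>x. (\<integral>v. h x v \<partial>lborel) \<partial>lborel)"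
      by (rule lborel_pair.Fubini_integral[OF ih])
    have right: "(\<integral>v. h x v \<partial>lborel) = f x * of_real (exp (- (k * (x - s))\<^sup>2 / 2))" for x
      unfolding h_def by (subst Bochner_Integration.integral_mult_right_zero) (simp only: normal_density_fourier)
    have "(\<integral>x. f x * of_real (exp (- (k * (x - s))\<^sup>2 / 2)) \<partial>lborel)
        = \<bar>1 / k\<bar> *\<^sub>R (\<integral>w. f (s + 1 / k * w) * of_real (exp (- (k * (s + 1 / k * w - s))\<^sup>2 / 2)) \<partial>lborel)"
      by (rule lborel_integral_real_affine) (use k in simp)
    moreover have "(\<lambda>w. f (s + 1 / k * w) * of_real (exp (- (k * (s + 1 / k * w - s))\<^sup>2 / 2)))
        = (\<lambda>w. sqrt (2 * pi) *\<^sub>R (?N w *\<^sub>R f (s + w / k)))"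
    proof
      fix w
      have e1: "k * (s + 1 / k * w - s) = w" using k by simp
      have e2: "exp (- w\<^sup>2 / 2) = sqrt (2 * pi) * ?N w" unfolding std_normal_density_def by simp
      show "f (s + 1 / k * w) * of_real (exp (- (k * (s + 1 / k * w - s))\<^sup>2 / 2)) = sqrt (2 * pi) *\<^sub>R (?N w *\<^sub>R f (s + w / k))"
        unfolding e1 e2 by (simp add: scaleR_conv_of_real mult.commute)
    qed
    moreover have "(\<integral>w. sqrt (2 * pi) *\<^sub>R (?N w *\<^sub>R f (s + w / k)) \<partial>lborel)
        = sqrt (2 * pi) *\<^sub>R (\<integral>w. ?N w *\<^sub>R f (s + w / k) \<partial>lborel)"
      by (rule Bochner_Integration.integral_scaleR_right)
    ultimately have val: "(\<integral>x. f x * of_real (exp (- (k * (x - s))\<^sup>2 / 2)) \<partial>lborel)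
        = (1 / k * sqrt (2 * pi)) *\<^sub>R (\<integral>w. ?N w *\<^sub>R f (s + w / k) \<partial>lborel)"
      using k by (simp only: scaleR_scaleR) simp
    have left: "norm (\<integral>x. h x v \<partial>lborel) \<le> W (0 + k * v) * (1 / sqrt (2 * pi))" for v
    proof -
      have "h x v = (?N v *\<^sub>R iexp (- (v * k * s))) * (f x * iexp (k * v * x))" for x
      proof -
        have "iexp (v * (k * (x - s))) = iexp (- (v * k * s)) * iexp (k * v * x)"
          by (simp add: exp_add[symmetric] algebra_simps)
        then show ?thesis unfolding h_def by (simp add: mult.commute mult.left_commute)
      qed
      then have "(\<integral>x. h x v \<partial>lborel) = (?N v *\<^sub>R iexp (- (v * k * s))) * (\<integral>x. f x * iexp (k * v * x) \<partial>lborel)"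
        by (simp only: Bochner_Integration.integral_mult_right_zero)
      then have "norm (\<integral>x. h x v \<partial>lborel) = ?N v * norm (\<integral>x. f x * iexp (k * v * x) \<partial>lborel)"
        using N0[of v] by (simp add: norm_mult)
      moreover have "?N v * norm (\<integral>x. f x * iexp (k * v * x) \<partial>lborel) \<le> (1 / sqrt (2 * pi)) * W (k * v)"
        by (intro mult_mono Nle fW) auto
      ultimately show ?thesis by (simp add: mult.commute)
    qed
    have kW: "(\<integral>v. W (0 + k * v) * (1 / sqrt (2 * pi)) \<partial>lborel) = (\<integral>\<xi>. W \<xi> \<partial>lborel) / k * (1 / sqrt (2 * pi))"
      using lborel_integral_real_affine[of k W 0] k by simp
    have ihx: "integrable lborel (\<lambda>v. \<integral>x. h x v \<partial>lborel)"
      by (rule lborel_pair.integrable_snd) (use ih in simp)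
    have "norm (\<integral>v. (\<integral>x. h x v \<partial>lborel) \<partial>lborel) \<le> (\<integral>v. W (0 + k * v) * (1 / sqrt (2 * pi)) \<partial>lborel)"
    proof (rule order_trans[OF integral_norm_bound], rule integral_mono)
      show "integrable lborel (\<lambda>v. norm (\<integral>x. h x v \<partial>lborel))" by (rule integrable_norm[OF ihx])
      show "integrable lborel (\<lambda>v. W (0 + k * v) * (1 / sqrt (2 * pi)))"
        using lborel_integrable_real_affine[OF W, of k 0] k by (intro integrable_mult_left) auto
    qed (rule left)
    then have "norm ((1 / k * sqrt (2 * pi)) *\<^sub>R (\<integral>w. ?N w *\<^sub>R f (s + w / k) \<partial>lborel)) \<le> (\<integral>\<xi>. W \<xi> \<partial>lborel) / k * (1 / sqrt (2 * pi))"
      unfolding swap right val kW .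
    then have "1 / k * (sqrt (2 * pi) * norm (\<integral>w. ?N w *\<^sub>R f (s + w / k) \<partial>lborel)) \<le> 1 / k * ((\<integral>\<xi>. W \<xi> \<partial>lborel) / sqrt (2 * pi))"
      using k by simp
    then have "sqrt (2 * pi) * norm (\<integral>w. ?N w *\<^sub>R f (s + w / k) \<partial>lborel) \<le> (\<integral>\<xi>. W \<xi> \<partial>lborel) / sqrt (2 * pi)"
      using k by (simp only: mult_le_cancel_left_pos zero_less_divide_1_iff)
    then have "sqrt (2 * pi) * (sqrt (2 * pi) * norm (\<integral>w. ?N w *\<^sub>R f (s + w / k) \<partial>lborel)) \<le> sqrt (2 * pi) * ((\<integral>\<xi>. W \<xi> \<partial>lborel) / sqrt (2 * pi))"
      by (intro mult_left_mono) auto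
    then have "2 * pi * norm (\<integral>w. ?N w *\<^sub>R f (s + w / k) \<partial>lborel) \<le> (\<integral>\<xi>. W \<xi> \<partial>lborel)"
      by (simp add: mult.assoc[symmetric])
    then show ?thesis by (simp add: pos_le_divide_eq mult.commute)
  qed
  have lim: "(\<lambda>n. \<integral>w. ?N w *\<^sub>R f (s + w / real (Suc n)) \<partial>lborel) \<longlonglongrightarrow> (\<integral>w. ?N w *\<^sub>R f s \<partial>lborel)"
  proof (rule integral_dominated_convergence[where w = "\<lambda>w. B * ?N w"])
    show "integrable lborel (\<lambda>w. B * ?N w)" using Ni by simp
    show "AE w in lborel. (\<lambda>n. ?N w *\<^sub>R f (s + w / real (Suc n))) \<longlonglongrightarrow> ?N w *\<^sub>R f s"
    proof (intro AE_I2 tendsto_scaleR tendsto_const)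
      fix w :: real
      have "(\<lambda>n. s + w * (1 / real (Suc n))) \<longlonglongrightarrow> s + w * 0"
        by (intro tendsto_intros LIMSEQ_Suc[OF lim_1_over_n])
      then have "(\<lambda>n. s + w / real (Suc n)) \<longlonglongrightarrow> s" by simp
      from isCont_tendsto_compose[OF cont this] show "(\<lambda>n. f (s + w / real (Suc n))) \<longlonglongrightarrow> f s" .
    qed
    have "?N w * norm (f (s + w / real (Suc n))) \<le> ?N w * B" for w n by (intro mult_left_mono B N0)
    then show "AE w in lborel. norm (?N w *\<^sub>R f (s + w / real (Suc n))) \<le> B * ?N w" for n
      using N0 by (auto simp: mult.commute)
  qed measurable
  have "(\<integral>w. ?N w *\<^sub>R f s \<partial>lborel) = f s"
    using Ni by simp
  with lim have "(\<lambda>n. norm (\<integral>w. ?N w *\<^sub>R f (s + w / real (Suc n)) \<partial>lborel)) \<longlonglongrightarrow> norm (f s)"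
    by (auto intro: tendsto_norm)
  then show ?thesis by (rule LIMSEQ_le_const2) (use key in auto)
qed

section \<open>The upper bound for flat functions\<close>

lemma DC_class_smooth: "g \<in> DC_class M \<Longrightarrow> smooth_fun g" by (simp add: DC_class_def)
lemma DC_class_bound: "g \<in> DC_class M \<Longrightarrow> norm (nth_vderiv n g x) \<le> M n" by (simp add: DC_class_def)

lemma DC_class_measurable: "g \<in> DC_class M \<Longrightarrow> nth_vderiv n g \<in> borel_measurable borel"
  by (intro borel_measurable_continuous_onI smooth_fun_continuous DC_class_smooth)

lemma DC_class_function: assumes "g \<in> DC_class M"
  shows "g \<in> borel_measurable borel" "norm (g x) \<le> M 0" "continuous_on UNIV g"
  using DC_class_measurable[OF assms, of 0] DC_class_bound[OF assms, of 0 x] smooth_fun_continuous[OF DC_class_smooth[OF assms], of 0]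
  by (simp_all add: nth_vderiv_0)

lemma laplace_nth_vderiv:
  assumes g: "g \<in> DC_class M" and flat: "flat_at g 0" and z: "Im z > 0"
  shows "laplace (nth_vderiv n g) z = (- (\<i> * z)) ^ n * laplace g z"
proof (induction n)
  case 0
  then show ?case by (simp add: nth_vderiv_0)
next
  case (Suc n)
  have "laplace (nth_vderiv (Suc n) g) z = - (\<i> * z) * laplace (nth_vderiv n g) z"
  proof (rule laplace_derivative)
    show "(nth_vderiv n g has_vector_derivative nth_vderiv (Suc n) g x) (at x)" for x
      by (rule smooth_fun_derivative[OF DC_class_smooth[OF g]])
    show "continuous_on UNIV (nth_vderiv (Suc n) g)" by (rule smooth_fun_continuous[OF DC_class_smooth[OF g]])
    show "nth_vderiv n g 0 = 0" using flat by (simp add: flat_at_def)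
    show "norm (nth_vderiv n g x) \<le> M n" for x by (rule DC_class_bound[OF g])
    show "norm (nth_vderiv (Suc n) g x) \<le> M (Suc n)" for x by (rule DC_class_bound[OF g])
  qed (rule z)
  then show ?case unfolding Suc.IH by simp
qed

lemma laplace_class_bound:
  assumes g: "g \<in> DC_class M" and flat: "flat_at g 0" and z: "Im z > 0"
  shows "norm z ^ n * norm (laplace g z) \<le> M n / Im z"
proof -
  have "norm (laplace (nth_vderiv n g) z) \<le> M n / Im z"
    by (rule laplace_bound[OF DC_class_measurable[OF g] DC_class_bound[OF g] z])
  then show ?thesis unfolding laplace_nth_vderiv[OF g flat z] by (simp add: norm_mult norm_power)
qed

lemma laplace_inversion_bound:
  assumes g: "g \<in> DC_class M" and \<eta>: "\<eta> > 0" and s: "s > 0" and W: "integrable lborel W"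
    and le: "\<And>x. norm (laplace g (Complex x \<eta>)) \<le> W x"
  shows "norm (g s) \<le> exp (\<eta> * s) * ((\<integral>x. W x \<partial>lborel) / (2 * pi))"
proof -
  define f where "f = (\<lambda>x. indicator {0..} x *\<^sub>R (g x * of_real (exp (- (\<eta> * x)))))"
  have kern: "exp (\<i> * Complex \<xi> \<eta> * of_real x) = iexp (\<xi> * x) * of_real (exp (- (\<eta> * x)))" for \<xi> x
  proof -
    have "\<i> * Complex \<xi> \<eta> * of_real x = \<i> * of_real (\<xi> * x) + of_real (- (\<eta> * x))"
      by (simp add: complex_eq_iff)
    then show ?thesis by (simp only: exp_add exp_of_real)
  qed
  have tr: "(\<integral>x. f x * iexp (\<xi> * x) \<partial>lborel) = laplace g (Complex \<xi> \<eta>)" for \<xi>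
    unfolding laplace_def set_lebesgue_integral_def f_def
    by (intro Bochner_Integration.integral_cong refl) (simp only: kern, simp add: mult.commute mult.left_commute)
  have fi: "integrable lborel f"
  proof -
    have "set_integrable lborel {0..} (\<lambda>x. g x * exp (\<i> * Complex 0 \<eta> * of_real x))"
      by (rule laplace_integrable[OF DC_class_function(1,2)[OF g]]) (use \<eta> in simp)
    then show ?thesis unfolding set_integrable_def f_def kern by simp
  qed
  have M0: "M 0 \<ge> 0" using DC_class_function(2)[OF g, of 0] norm_ge_zero order_trans by blast
  have fb: "norm (f x) \<le> M 0" for x
  proof (cases "x \<ge> 0")
    case True
    have "norm (g x) * exp (- (\<eta> * x)) \<le> M 0 * 1"
      using True \<eta> M0 by (intro mult_mono DC_class_function(2)[OF g]) auto
    then show ?thesis using True by (simp add: f_def norm_mult)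
  qed (simp add: f_def M0)
  have "continuous_on {0<..} f"
  proof (rule continuous_on_cong[THEN iffD1, OF refl])
    show "continuous_on {0<..} (\<lambda>x. g x * of_real (exp (- (\<eta> * x))))"
      by (intro continuous_intros continuous_on_subset[OF DC_class_function(3)[OF g]]) auto
  qed (simp add: f_def)
  then have cont: "isCont f s" using s by (simp add: continuous_on_eq_continuous_at)
  have "norm (f s) \<le> (\<integral>x. W x \<partial>lborel) / (2 * pi)"
    by (rule fourier_inversion_bound[OF fi fb cont W]) (simp only: tr le)
  then have "exp (\<eta> * s) * (norm (g s) * exp (- (\<eta> * s))) \<le> exp (\<eta> * s) * ((\<integral>x. W x \<partial>lborel) / (2 * pi))"
    using s by (intro mult_left_mono) (simp_all add: f_def norm_mult)
  moreover have "exp (\<eta> * s) * (norm (g s) * exp (- (\<eta> * s))) = norm (g s)" by (simp add: exp_minus field_simps)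
  ultimately show ?thesis by simp
qed

text \<open>If the transform vanished on a line, the inversion bound with majorant \<open>0\<close> would give \<open>g s = 0\<close>.\<close>

lemma laplace_not_zero_on_line:
  assumes g: "g \<in> DC_class M" and s: "s > 0" "g s \<noteq> 0" and \<eta>: "\<eta> > 0"
  obtains x where "laplace g (Complex x \<eta>) \<noteq> 0"
proof -
  have "\<exists>x. laplace g (Complex x \<eta>) \<noteq> 0"
  proof (rule ccontr)
    assume "\<not> (\<exists>x. laplace g (Complex x \<eta>) \<noteq> 0)"
    then have "norm (laplace g (Complex x \<eta>)) \<le> 0" for x by simp
    from laplace_inversion_bound[OF g \<eta> s(1) _ this] s(2) show False by simp
  qed
  with that show ?thesis by blast
qed

lemma non_quasianalytic_witness:
  assumes "non_quasianalytic M"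
  obtains g s where "g \<in> DC_class M" "flat_at g 0" "s > 0" "g s \<noteq> 0"
proof -
  obtain g x a where g: "g \<in> DC_class M" "g x \<noteq> 0" "flat_at g a" using assms unfolding non_quasianalytic_def by blast
  \<comment> \<open>The sign reflects the function if it is nonzero only to the left of the flat point.\<close>
  define c where "c = sgn (x - a)"
  have "g a = 0" using g(3) unfolding flat_at_def by (metis nth_vderiv_0)
  then have "x \<noteq> a" using g(2) by auto
  then have c: "\<bar>c\<bar> = 1" by (simp add: c_def abs_sgn_eq)
  let ?h = "\<lambda>x. g (a + c * x)"
  have "flat_at ?h 0" unfolding flat_at_def using g(3) DC_class_affine(2)[OF g(1) c] by (simp add: flat_at_def)
  moreover have "a + c * \<bar>x - a\<bar> = x" unfolding c_def using sgn_mult_abs[of "x - a"] by simp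
  ultimately show ?thesis using that[of ?h "\<bar>x - a\<bar>"] DC_class_affine(1)[OF g(1) c, of a] g(2) \<open>x \<noteq> a\<close> by simp
qed

text \<open>At a point \<open>z\<close> with \<open>\<bar>z\<bar> \<ge> r\<close> and \<open>Im z \<ge> 1\<close> where the Laplace transform \<open>L\<close> of a flat function does not vanish,
\<open>r ^ n / M n \<le> 1 / \<bar>L z\<bar>\<close> for all \<open>n\<close>.\<close>

lemma non_quasianalytic_finite_Ostrowski:
  assumes pos: "\<And>n. M n > 0" and nqa: "non_quasianalytic M"
  shows "finite_Ostrowski M"
  unfolding finite_Ostrowski_def
proof (intro conjI allI impI pos)
  fix r :: real assume r: "r \<ge> 0"
  obtain g s where g: "g \<in> DC_class M" "flat_at g 0" "s > 0" "g s \<noteq> 0" by (rule non_quasianalytic_witness[OF nqa])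
  obtain x where x: "laplace g (Complex x (r + 1)) \<noteq> 0"
    using laplace_not_zero_on_line[OF g(1,3,4), of "r + 1"] r by (metis add_nonneg_pos zero_less_one)
  define z where "z = Complex x (r + 1)"
  have z: "Im z > 0" "Im z \<ge> 1" "norm z \<ge> r" using r abs_Im_le_cmod[of z] by (auto simp: z_def)
  have L: "norm (laplace g z) > 0" using x by (simp add: z_def)
  show "bdd_above (range (\<lambda>n. r ^ n / M n))" unfolding bdd_above_def
  proof (intro exI ballI)
    fix v assume "v \<in> range (\<lambda>n. r ^ n / M n)"
    then obtain n where v: "v = r ^ n / M n" by blast
    have "r ^ n * norm (laplace g z) \<le> norm z ^ n * norm (laplace g z)" using z r by (intro mult_right_mono power_mono) auto
    also have "\<dots> \<le> M n / Im z" by (rule laplace_class_bound[OF g(1,2) z(1)])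
    also have "\<dots> \<le> M n / 1" using z pos[of n] by (intro divide_left_mono) auto
    finally have "r ^ n \<le> M n / norm (laplace g z)" using L by (simp add: pos_le_divide_eq)
    then have "r ^ n / M n \<le> (M n / norm (laplace g z)) / M n" using pos[of n] by (intro divide_right_mono) auto
    then show "v \<le> 1 / norm (laplace g z)" unfolding v using pos[of n] by simp
  qed
qed

text \<open>Minimising the bound \<open>N n / \<bar>z\<bar> ^ n\<close> over \<open>n\<close> gives the Ostrowski function.\<close>

lemma laplace_Ostrowski_bound:
  assumes N: "finite_Ostrowski N" and le: "\<And>n. norm z ^ n * L \<le> N n" and L: "L \<ge> 0"
  shows "L \<le> exp (- log_Ostrowski N (Re z))"
proof (cases "L = 0")
  case False
  with L have L: "L > 0" by simp
  have "Ostrowski N (norm z) \<le> 1 / L"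
  proof (rule Ostrowski_le)
    fix n
    have "norm z ^ n \<le> N n / L" using le[of n] L by (simp add: pos_le_divide_eq)
    then have "norm z ^ n / N n \<le> (N n / L) / N n" using finite_Ostrowski_pos[OF N, of n] by (intro divide_right_mono) auto
    then show "norm z ^ n / N n \<le> 1 / L" using finite_Ostrowski_pos[OF N, of n] by simp
  qed
  then have "ln (Ostrowski N (norm z)) \<le> ln (1 / L)" using Ostrowski_pos[OF N, of "norm z"] by (intro ln_mono) auto
  then have "log_Ostrowski N (norm z) \<le> - ln L" using L by (simp add: log_Ostrowski_def ln_div)
  moreover have "log_Ostrowski N (Re z) \<le> log_Ostrowski N (norm z)"
    by (rule weight_mono[OF weight_log_Ostrowski[OF N]]) (use abs_Re_le_cmod[of z] in simp)
  ultimately have "ln L \<le> - log_Ostrowski N (Re z)" by simp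
  then have "exp (ln L) \<le> exp (- log_Ostrowski N (Re z))" by simp
  then show ?thesis using L by simp
qed simp

lemma laplace_shift_holomorphic:
  assumes g: "g \<in> DC_class M"
  shows "(\<lambda>z. (z + \<i>) ^ k * laplace g (z + \<i>)) holomorphic_on {z. Im z > 0}"
proof -
  have "(laplace g \<circ> (\<lambda>z. z + \<i>)) holomorphic_on {z. Im z > 0}"
    by (rule holomorphic_on_compose_gen[OF _ laplace_holomorphic[OF DC_class_function(1,2)[OF g]]]) (auto intro!: holomorphic_intros)
  then show ?thesis by (intro holomorphic_intros) (simp add: comp_def)
qed

text \<open>Shifting by \<open>\<i>\<close> removes the factor \<open>1 / Im z\<close>, and the power \<open>k\<close> is paid for by shifting the sequence.\<close>

lemma laplace_shift_bound:
  assumes g: "g \<in> DC_class M" "flat_at g 0" and N: "finite_Ostrowski (\<lambda>n. M (n + k))" and M: "\<And>n. M n > 0" and z: "Im z > 0"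
  shows "norm ((z + \<i>) ^ k * laplace g (z + \<i>)) \<le> exp (- log_Ostrowski (\<lambda>n. M (n + k)) (Re z))"
proof -
  have "norm ((z + \<i>) ^ k * laplace g (z + \<i>)) \<le> exp (- log_Ostrowski (\<lambda>n. M (n + k)) (Re (z + \<i>)))"
  proof (rule laplace_Ostrowski_bound[OF N])
    fix n
    have z1: "Im (z + \<i>) > 0" "Im (z + \<i>) \<ge> 1" using z by auto
    have "norm (z + \<i>) ^ n * norm ((z + \<i>) ^ k * laplace g (z + \<i>)) = norm (z + \<i>) ^ (n + k) * norm (laplace g (z + \<i>))"
      by (simp add: norm_mult norm_power power_add)
    also have "\<dots> \<le> M (n + k) / Im (z + \<i>)" by (rule laplace_class_bound[OF g z1(1)])
    also have "\<dots> \<le> M (n + k) / 1" using z1 M[of "n + k"] by (intro divide_left_mono) auto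
    finally show "norm (z + \<i>) ^ n * norm ((z + \<i>) ^ k * laplace g (z + \<i>)) \<le> M (n + k)" by simp
  qed simp
  then show ?thesis by simp
qed

text \<open>One half of the Denjoy--Carleman theorem in Ostrowski's form: a nonzero flat function forces the
logarithmic integral to converge.\<close>

lemma non_quasianalytic_log_integrable:
  assumes pos: "\<And>n. M n > 0" and nqa: "non_quasianalytic M" and N: "finite_Ostrowski (\<lambda>n. M (n + k))"
  shows "log_integrable (log_Ostrowski (\<lambda>n. M (n + k)))"
proof -
  obtain g s where g: "g \<in> DC_class M" "flat_at g 0" "s > 0" "g s \<noteq> 0" by (rule non_quasianalytic_witness[OF nqa])
  have two: "(2::real) > 0" by simp
  obtain x where x: "laplace g (Complex x 2) \<noteq> 0" by (rule laplace_not_zero_on_line[OF g(1,3,4) two])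
  have e: "Complex x 1 + \<i> = Complex x 2" by (simp add: complex_eq_iff)
  have "Complex x 2 \<noteq> 0" by (simp add: complex_eq_iff)
  then have nz: "(Complex x 1 + \<i>) ^ k * laplace g (Complex x 1 + \<i>) \<noteq> 0" unfolding e using x by simp
  show ?thesis
    by (rule log_integrable_if_majorized[OF weight_log_Ostrowski[OF N] laplace_shift_holomorphic[OF g(1)]
        laplace_shift_bound[OF g(1,2) N pos] _ nz]) auto
qed

lemma inverse_sq_sum_integral:
  assumes "y > 0" shows "integrable lborel (\<lambda>x::real. 1 / (x\<^sup>2 + y\<^sup>2))" "(\<integral>x. 1 / (x\<^sup>2 + y\<^sup>2) \<partial>lborel) = pi / y"
proof -
  have e: "(\<lambda>x. 1 / (x\<^sup>2 + y\<^sup>2)) = (\<lambda>x. pi / y * poisson_kernel 0 y x)" using assms by (auto simp: poisson_kernel_def)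
  show "integrable lborel (\<lambda>x::real. 1 / (x\<^sup>2 + y\<^sup>2))" unfolding e using poisson_kernel_integral(1)[OF assms, of 0] by simp
  show "(\<integral>x. 1 / (x\<^sup>2 + y\<^sup>2) \<partial>lborel) = pi / y"
    unfolding e Bochner_Integration.integral_mult_right_zero poisson_kernel_integral(2)[OF assms] by simp
qed

text \<open>The majorization applied to \<open>(z + \<i>)\<^sup>2 * L (z + \<i>)\<close> and the sequence \<open>M (n + 2)\<close>, followed by Fourier inversion on the line
\<open>Im z = y + 1\<close>. The factor \<open>y + 1\<close> collects \<open>(y + 1)\<^sup>2\<close>, from comparing the two weights, and the integral
\<open>\<pi> / (y + 1)\<close> of \<open>1 / (x\<^sup>2 + (y + 1)\<^sup>2)\<close>.\<close>

lemma flat_function_upper_bound: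
  assumes pos: "\<And>n. M n > 0" and nqa: "non_quasianalytic M"
  shows "\<exists>C>0. \<forall>s>0. \<forall>y>0. \<forall>g\<in>DC_class M. flat_at g 0 \<longrightarrow>
     norm (g s) \<le> C * (y + 1) * exp s * exp (- (poisson (log_Ostrowski M) 0 y - y * s))"
proof -
  let ?N = "\<lambda>n. M (n + 2)"
  let ?\<phi> = "log_Ostrowski M" and ?\<psi> = "log_Ostrowski ?N"
  have M: "finite_Ostrowski M" by (rule non_quasianalytic_finite_Ostrowski[OF pos nqa])
  have N: "finite_Ostrowski ?N" by (rule log_Ostrowski_shift(1)[OF M])
  have i\<phi>: "log_integrable ?\<phi>" using non_quasianalytic_log_integrable[OF pos nqa, of 0] M by simp
  have i\<psi>: "log_integrable ?\<psi>" by (rule non_quasianalytic_log_integrable[OF pos nqa N])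
  obtain C1 where C1: "\<And>t. ?\<phi> t \<le> ?\<psi> t + ln (1 + t\<^sup>2) + C1" using log_Ostrowski_shift(2)[OF M] by blast
  obtain C2 where C2: "\<And>y. y > 0 \<Longrightarrow> poisson (\<lambda>t. ln (1 + t\<^sup>2)) 0 y \<le> 2 * ln (1 + y) + C2" using poisson_ln_bound by blast
  have cmp: "poisson ?\<phi> 0 y - 2 * ln (1 + y) - (C1 + C2) \<le> poisson ?\<psi> 0 y" if y: "y > 0" for y
  proof -
    have il: "log_integrable (\<lambda>t. ?\<psi> t + ln (1 + t\<^sup>2))" by (intro log_integrable_add i\<psi> log_integrable_ln)
    have "poisson ?\<phi> 0 y \<le> poisson (\<lambda>t. (?\<psi> t + ln (1 + t\<^sup>2)) + C1) 0 y"
      by (rule poisson_mono[OF i\<phi> log_integrable_add[OF il log_integrable_const] y C1])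
    also have "\<dots> = poisson ?\<psi> 0 y + poisson (\<lambda>t. ln (1 + t\<^sup>2)) 0 y + C1"
      using poisson_integrable[OF i\<psi> y, of 0] poisson_integrable[OF log_integrable_ln y, of 0] poisson_kernel_integral(1)[OF y, of 0]
      by (simp add: poisson_def distrib_right poisson_kernel_integral(2)[OF y])
    finally show ?thesis using C2[OF y] by simp
  qed
  define C where "C = exp (C1 + C2) / 2"
  have "norm (g s) \<le> C * (y + 1) * exp s * exp (- (poisson ?\<phi> 0 y - y * s))"
    if s: "s > 0" and y: "y > 0" and g: "g \<in> DC_class M" "flat_at g 0" for s y g
  proof -
    define \<eta> where "\<eta> = y + 1"
    have \<eta>: "\<eta> > 0" using y by (simp add: \<eta>_def)
    define K where "K = exp (- poisson ?\<phi> 0 y) * \<eta>\<^sup>2 * exp (C1 + C2)"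
    have bound: "norm (laplace g (Complex x \<eta>)) \<le> K * (1 / (x\<^sup>2 + \<eta>\<^sup>2))" for x
    proof -
      let ?z = "Complex x y"
      have z: "Im ?z > 0" using y by simp
      have e: "?z + \<i> = Complex x \<eta>" by (simp add: complex_eq_iff \<eta>_def)
      have "norm ((?z + \<i>) ^ 2 * laplace g (?z + \<i>)) \<le> exp (- poisson ?\<psi> (Re ?z) (Im ?z))"
        by (rule majorization[OF weight_log_Ostrowski[OF N] i\<psi> laplace_shift_holomorphic[OF g(1)] laplace_shift_bound[OF g N pos] z])
      also have "\<dots> \<le> exp (- (poisson ?\<phi> 0 y - 2 * ln (1 + y) - (C1 + C2)))"
        using poisson_ge_axis[OF weight_log_Ostrowski[OF N] i\<psi> y, of x] cmp[OF y] by simp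
      also have "\<dots> = exp (- poisson ?\<phi> 0 y + (2 * ln \<eta> + (C1 + C2)))" by (simp add: \<eta>_def add.commute)
      also have "\<dots> = exp (- poisson ?\<phi> 0 y) * (exp (2 * ln \<eta>) * exp (C1 + C2))" by (simp only: exp_add)
      also have "exp (2 * ln \<eta>) = \<eta>\<^sup>2" using \<eta> exp_of_nat_mult[of 2 "ln \<eta>"] by simp
      finally have "norm (Complex x \<eta>) ^ 2 * norm (laplace g (Complex x \<eta>)) \<le> K"
        unfolding e norm_mult norm_power K_def by (simp only: mult.assoc)
      moreover have "norm (Complex x \<eta>) ^ 2 = x\<^sup>2 + \<eta>\<^sup>2" by (simp add: cmod_power2)
      ultimately have "norm (laplace g (Complex x \<eta>)) * (x\<^sup>2 + \<eta>\<^sup>2) \<le> K" by (simp only: mult.commute)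
      then have "norm (laplace g (Complex x \<eta>)) \<le> K / (x\<^sup>2 + \<eta>\<^sup>2)"
        using sq_sum_pos[OF \<eta>, of x] by (simp only: pos_le_divide_eq)
      then show ?thesis by simp
    qed
    have "norm (g s) \<le> exp (\<eta> * s) * ((\<integral>x. K * (1 / (x\<^sup>2 + \<eta>\<^sup>2)) \<partial>lborel) / (2 * pi))"
      by (rule laplace_inversion_bound[OF g(1) \<eta> s integrable_mult_right[OF inverse_sq_sum_integral(1)[OF \<eta>]] bound])
    moreover have "(\<integral>x. K * (1 / (x\<^sup>2 + \<eta>\<^sup>2)) \<partial>lborel) = K * (pi / \<eta>)"
      by (simp only: Bochner_Integration.integral_mult_right_zero inverse_sq_sum_integral(2)[OF \<eta>])
    moreover have "exp (\<eta> * s) * (K * (pi / \<eta>) / (2 * pi)) = C * (y + 1) * exp s * exp (- (poisson ?\<phi> 0 y - y * s))"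
    proof -
      have "exp (\<eta> * s) = exp s * exp (y * s)" by (simp add: \<eta>_def exp_add[symmetric] algebra_simps)
      moreover have "exp (- (poisson ?\<phi> 0 y - y * s)) = exp (- poisson ?\<phi> 0 y) * exp (y * s)" by (simp add: exp_add[symmetric])
      moreover have "K * (pi / \<eta>) / (2 * pi) = exp (- poisson ?\<phi> 0 y) * \<eta> * C"
        using \<eta> by (simp add: K_def C_def power2_eq_square)
      ultimately show ?thesis by (simp add: \<eta>_def mult.commute mult.left_commute)
    qed
    ultimately show ?thesis by simp
  qed
  moreover have "C > 0" by (simp add: C_def)
  ultimately show ?thesis by blast
qed

section \<open>A nearly extremal flat function\<close>

text \<open>A primitive of \<open>H\<close> exists because the half-plane is convex. It turns the integrals over long segments at the two heights
into differences of boundary values, and the decay of \<open>H\<close> makes the values at corresponding end points agree in the limit.\<close>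

lemma contour_shift:
  assumes hol: "H holomorphic_on {z. Im z > -1}" and Y: "Y \<ge> 0"
    and bd: "\<And>z. 0 \<le> Im z \<Longrightarrow> Im z \<le> Y \<Longrightarrow> norm (H z) \<le> C / (1 + (Re z)\<^sup>2)"
  shows "(\<integral>x. H (of_real x) \<partial>lborel) = (\<integral>x. H (Complex x Y) \<partial>lborel)"
proof -
  let ?S = "{z. Im z > -1}"
  have oS: "open ?S" by (rule open_halfspace_Im_gt)
  have cS: "convex ?S" by (rule convex_halfspace_Im_gt)
  obtain P where P: "\<And>z. z \<in> ?S \<Longrightarrow> (P has_field_derivative H z) (at z within ?S)"
    using holomorphic_convex_primitive'[OF cS oS hol] by blast
  then have P: "(P has_field_derivative H z) (at z)" if "z \<in> ?S" for z
    using that at_within_open[OF that oS] by metis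
  have contH: "continuous_on ?S H" by (rule holomorphic_on_imp_continuous_on[OF hol])
  have lim: "((\<lambda>n. P (Complex (real n) y) - P (Complex (- real n) y)) \<longlonglongrightarrow> (\<integral>x. H (Complex x y) \<partial>lborel))"
    if y: "0 \<le> y" "y \<le> Y" for y
  proof -
    have cx: "continuous_on UNIV (\<lambda>x. H (Complex x y))"
      by (rule continuous_on_compose2[OF contH]) (use y in \<open>auto simp: Complex_eq intro!: continuous_intros\<close>)
    have fin: "(\<integral>x. indicator {- real n..real n} x *\<^sub>R H (Complex x y) \<partial>lborel) = P (Complex (real n) y) - P (Complex (- real n) y)" for n
    proof (rule integral_FTC_atLeastAtMost)
      show "((\<lambda>x. P (Complex x y)) has_vector_derivative H (Complex x y)) (at x within {- real n..real n})" for x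
      proof -
        have d: "((\<lambda>x. Complex x y) has_vector_derivative 1) (at x)"
          unfolding Complex_eq by (auto intro!: derivative_eq_intros)
        have "(P has_field_derivative H (Complex x y)) (at (Complex x y))" by (rule P) (use y in simp)
        from field_vector_diff_chain_at[OF d this]
        have "((\<lambda>x. P (Complex x y)) has_vector_derivative H (Complex x y)) (at x)" by (simp add: comp_def)
        then show ?thesis by (rule has_vector_derivative_at_within)
      qed
      show "continuous_on {- real n..real n} (\<lambda>x. H (Complex x y))" by (rule continuous_on_subset[OF cx]) simp
    qed simp
    have "(\<lambda>n. \<integral>x. indicator {- real n..real n} x *\<^sub>R H (Complex x y) \<partial>lborel) \<longlonglongrightarrow> (\<integral>x. H (Complex x y) \<partial>lborel)"
    proof (rule integral_dominated_convergence[where w = "\<lambda>x. C * (1 / (1 + x\<^sup>2))"])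
      have m: "(\<lambda>x. H (Complex x y)) \<in> borel_measurable borel" by (rule borel_measurable_continuous_onI[OF cx])
      then show "(\<lambda>x. H (Complex x y)) \<in> borel_measurable lborel" by simp
      show "(\<lambda>x. indicator {- real n..real n} x *\<^sub>R H (Complex x y)) \<in> borel_measurable lborel" for n
        using m by (intro borel_measurable_scaleR) auto
      show "integrable lborel (\<lambda>x. C * (1 / (1 + x\<^sup>2)))" by (intro integrable_mult_right integrable_cauchy)
      have b: "norm (H (Complex x y)) \<le> C * (1 / (1 + x\<^sup>2))" for x using bd[of "Complex x y"] y by simp
      show "AE x in lborel. norm (indicator {- real n..real n} x *\<^sub>R H (Complex x y)) \<le> C * (1 / (1 + x\<^sup>2))" for n
      proof (rule AE_I2)
        fix x
        show "norm (indicator {- real n..real n} x *\<^sub>R H (Complex x y)) \<le> C * (1 / (1 + x\<^sup>2))"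
          using b[of x] order_trans[OF norm_ge_zero b[of x]] by (cases "x \<in> {- real n..real n}") simp_all
      qed
      show "AE x in lborel. (\<lambda>n. indicator {- real n..real n} x *\<^sub>R H (Complex x y)) \<longlonglongrightarrow> H (Complex x y)"
      proof (rule AE_I2)
        fix x :: real
        obtain n where "\<bar>x\<bar> < real n" using reals_Archimedean2 by blast
        then have "\<forall>\<^sub>F i in sequentially. indicator {- real i..real i} x *\<^sub>R H (Complex x y) = H (Complex x y)"
          unfolding eventually_sequentially by (intro exI[of _ n]) (auto simp: indicator_def)
        then show "(\<lambda>n. indicator {- real n..real n} x *\<^sub>R H (Complex x y)) \<longlonglongrightarrow> H (Complex x y)"
          by (rule tendsto_eventually)
      qed
    qed
    then show ?thesis unfolding fin .
  qed
  have side: "(\<lambda>n. P (Complex (c * real n) Y) - P (Complex (c * real n) 0)) \<longlonglongrightarrow> 0" if c: "\<bar>c\<bar> = 1" for c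
  proof (rule tendsto_norm_zero_cancel, rule tendsto_sandwich[OF _ _ tendsto_const])
    show "(\<lambda>n. C / (1 + (real n)\<^sup>2) * Y) \<longlonglongrightarrow> 0" by real_asymp
    show "\<forall>\<^sub>F n in sequentially. norm (P (Complex (c * real n) Y) - P (Complex (c * real n) 0)) \<le> C / (1 + (real n)\<^sup>2) * Y"
    proof (intro always_eventually allI)
      fix n
      let ?T = "{z. Re z = c * real n} \<inter> ({z. Im z \<ge> 0} \<inter> {z. Im z \<le> Y})"
      have cT: "convex ?T"
        by (intro convex_Int convex_halfspace_Im_ge convex_halfspace_Im_le) (simp add: convex_def, metis scaleR_left_distrib real_scaleR_def mult.commute mult.right_neutral distrib_left)
      have "norm (P (Complex (c * real n) Y) - P (Complex (c * real n) 0)) \<le> C / (1 + (real n)\<^sup>2) * norm (Complex (c * real n) Y - Complex (c * real n) 0)"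
      proof (rule field_differentiable_bound[OF cT])
        fix z assume z: "z \<in> ?T"
        show "(P has_field_derivative H z) (at z within ?T)" by (rule has_field_derivative_at_within[OF P]) (use z in auto)
        have "(Re z)\<^sup>2 = (real n)\<^sup>2"
        proof -
          have "\<bar>Re z\<bar> = real n" using z c by (simp add: abs_mult)
          then show ?thesis by (metis power2_abs)
        qed
        then show "norm (H z) \<le> C / (1 + (real n)\<^sup>2)" using bd[of z] z by auto
      qed (use Y in auto)
      also have "norm (Complex (c * real n) Y - Complex (c * real n) 0) = Y"
        using Y by (simp add: cmod_def)
      finally show "norm (P (Complex (c * real n) Y) - P (Complex (c * real n) 0)) \<le> C / (1 + (real n)\<^sup>2) * Y" .
    qed
  qed simp
  have "(\<lambda>n. (P (Complex (real n) 0) - P (Complex (- real n) 0)) + (P (Complex (1 * real n) Y) - P (Complex (1 * real n) 0))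
      - (P (Complex (- 1 * real n) Y) - P (Complex (- 1 * real n) 0))) \<longlonglongrightarrow> (\<integral>x. H (Complex x 0) \<partial>lborel) + 0 - 0"
    using Y by (intro tendsto_diff tendsto_add lim side) auto
  moreover have "(P (Complex (real n) 0) - P (Complex (- real n) 0)) + (P (Complex (1 * real n) Y) - P (Complex (1 * real n) 0))
      - (P (Complex (- 1 * real n) Y) - P (Complex (- 1 * real n) 0)) = P (Complex (real n) Y) - P (Complex (- real n) Y)" for n by simp
  ultimately have "(\<lambda>n. P (Complex (real n) Y) - P (Complex (- real n) Y)) \<longlonglongrightarrow> (\<integral>x. H (Complex x 0) \<partial>lborel)" by simp
  moreover have "(\<lambda>n. P (Complex (real n) Y) - P (Complex (- real n) Y)) \<longlonglongrightarrow> (\<integral>x. H (Complex x Y) \<partial>lborel)"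
    using Y by (intro lim) auto
  ultimately have "(\<integral>x. H (Complex x 0) \<partial>lborel) = (\<integral>x. H (Complex x Y) \<partial>lborel)" by (rule LIMSEQ_unique)
  moreover have "Complex x 0 = of_real x" for x by (simp add: complex_eq_iff)
  ultimately show ?thesis by simp
qed

lemma has_vector_derivative_quadratic:
  fixes D :: "real \<Rightarrow> complex"
  assumes b: "\<And>h. norm (D (x + h) - D x - of_real h * D') \<le> K * h\<^sup>2"
  shows "(D has_vector_derivative D') (at x)"
  unfolding has_vector_derivative_def has_derivative_at
proof (intro conjI)
  show "bounded_linear (\<lambda>h. h *\<^sub>R D')" by (rule bounded_linear_scaleR_left)
  have lim: "((\<lambda>h::real. K * \<bar>h\<bar>) \<longlongrightarrow> 0) (at 0)"
  proof -
    have "((\<lambda>h::real. K * \<bar>h\<bar>) \<longlongrightarrow> K * \<bar>0\<bar>) (at 0)" by (intro tendsto_intros)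
    then show ?thesis by simp
  qed
  show "((\<lambda>h. norm (D (x + h) - D x - h *\<^sub>R D') / norm h) \<longlongrightarrow> 0) (at 0)"
  proof (rule tendsto_sandwich[OF _ _ tendsto_const lim])
    show "\<forall>\<^sub>F h in at 0. norm (D (x + h) - D x - h *\<^sub>R D') / norm h \<le> K * \<bar>h\<bar>"
      unfolding eventually_at
    proof (intro exI[of _ 1] conjI ballI impI)
      fix h :: real assume "h \<noteq> 0 \<and> dist h 0 < 1"
      then have h: "\<bar>h\<bar> > 0" by simp
      have "norm (D (x + h) - D x - h *\<^sub>R D') \<le> K * \<bar>h\<bar> * \<bar>h\<bar>"
        using b[of h] by (simp add: scaleR_conv_of_real power2_eq_square mult.assoc)
      then show "norm (D (x + h) - D x - h *\<^sub>R D') / norm h \<le> K * \<bar>h\<bar>"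
        using h by (simp only: real_norm_def pos_divide_le_eq)
    qed simp
  qed (simp add: eventually_at_filter)
qed

text \<open>The decay factor \<open>(z + 2 * \<i>)\<^sup>2\<close> makes all integrals below converge. The shift by \<open>\<i>\<close> moves the real line into the domain of
\<open>schwarz \<phi>\<close>, so boundary values of the conjugate Poisson integral never occur.\<close>

definition near_extremal_transform :: "(real \<Rightarrow> real) \<Rightarrow> complex \<Rightarrow> complex" where
  "near_extremal_transform \<phi> z = exp (- schwarz \<phi> (z + \<i>)) / (z + 2 * \<i>)\<^sup>2"

text \<open>The integrand of the inverse Fourier transform after \<open>n\<close> differentiations in \<open>x\<close>. The factor \<open>2 / pi\<close> is chosen so that the
bound for the \<open>n\<close>-th derivative is exactly \<open>M n\<close>: the integral of \<open>1 / (\<xi>\<^sup>2 + 4)\<close> is \<open>pi / 2\<close>.\<close>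

definition near_extremal_integrand :: "(real \<Rightarrow> real) \<Rightarrow> nat \<Rightarrow> real \<Rightarrow> complex \<Rightarrow> complex" where
  "near_extremal_integrand \<phi> n x z = of_real (2 / pi) * (- (\<i> * z)) ^ n * exp (- (\<i> * of_real x * z)) * near_extremal_transform \<phi> z"

definition near_extremal :: "(real \<Rightarrow> real) \<Rightarrow> nat \<Rightarrow> real \<Rightarrow> complex" where
  "near_extremal \<phi> n x = (\<integral>\<xi>. near_extremal_integrand \<phi> n x (of_real \<xi>) \<partial>lborel)"

lemma near_extremal_transform_holomorphic:
  assumes "log_integrable \<phi>" shows "near_extremal_transform \<phi> holomorphic_on {z. Im z > -1}"
proof -
  have "(schwarz \<phi> \<circ> (\<lambda>z. z + \<i>)) holomorphic_on {z. Im z > -1}"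
    by (rule holomorphic_on_compose_gen[OF _ schwarz_holomorphic[OF assms]]) (auto intro!: holomorphic_intros)
  then have s: "(\<lambda>z. schwarz \<phi> (z + \<i>)) holomorphic_on {z. Im z > -1}" by (simp add: comp_def)
  have nz: "z + 2 * \<i> \<noteq> 0" if "Im z > -1" for z using that by (auto simp: complex_eq_iff)
  show ?thesis unfolding near_extremal_transform_def[abs_def] by (intro holomorphic_intros s) (use nz in auto)
qed

lemma near_extremal_integrand_holomorphic:
  assumes "log_integrable \<phi>" shows "near_extremal_integrand \<phi> n x holomorphic_on {z. Im z > -1}"
  unfolding near_extremal_integrand_def[abs_def] by (intro holomorphic_intros near_extremal_transform_holomorphic[OF assms])

lemma norm_near_extremal_transform:
  assumes w: "weight \<phi>" and \<phi>: "log_integrable \<phi>" and z: "Im z \<ge> 0"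
  shows "norm (near_extremal_transform \<phi> z) = exp (- poisson \<phi> (Re z) (Im z + 1)) / ((Re z)\<^sup>2 + (Im z + 2)\<^sup>2)"
proof -
  have "Re (schwarz \<phi> (z + \<i>)) = poisson \<phi> (Re (z + \<i>)) (Im (z + \<i>))"
    by (rule Re_schwarz[OF \<phi> weight_even[OF w]]) (use z in simp)
  moreover have "(norm (z + 2 * \<i>))\<^sup>2 = (Re z)\<^sup>2 + (Im z + 2)\<^sup>2" by (simp add: cmod_power2)
  ultimately show ?thesis by (simp add: near_extremal_transform_def norm_divide norm_power)
qed

lemma norm_near_extremal_integrand_le:
  assumes w: "weight \<phi>" and \<phi>: "log_integrable \<phi>" and m: "m > 0" and t: "\<And>t. t \<ge> 0 \<Longrightarrow> t ^ n \<le> m * exp (\<phi> t)" and z: "Im z \<ge> 0"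
  shows "norm (near_extremal_integrand \<phi> n x z) \<le> 2 / pi * m * exp (x * Im z) * (1 / ((Re z)\<^sup>2 + (Im z + 2)\<^sup>2))"
proof -
  have zi: "Im (z + \<i>) > 0" using z by simp
  have "(norm z)\<^sup>2 \<le> (norm (z + \<i>))\<^sup>2" unfolding cmod_power2 using z by (simp add: power2_eq_square algebra_simps)
  then have "norm z \<le> norm (z + \<i>)" by (rule power2_le_imp_le) simp
  then have "norm z ^ n \<le> norm (z + \<i>) ^ n" by (intro power_mono) auto
  also have "\<dots> \<le> m * exp (poisson \<phi> (Re (z + \<i>)) (Im (z + \<i>)))" by (rule power_le_exp_poisson[OF w \<phi> m t zi])
  finally have "norm z ^ n * exp (- poisson \<phi> (Re z) (Im z + 1)) \<le> m * exp (poisson \<phi> (Re z) (Im z + 1)) * exp (- poisson \<phi> (Re z) (Im z + 1))"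
    by (intro mult_right_mono) auto
  also have "\<dots> = m" by (simp add: exp_minus)
  finally have le: "norm z ^ n * exp (- poisson \<phi> (Re z) (Im z + 1)) \<le> m" .
  define q where "q = 1 / ((Re z)\<^sup>2 + (Im z + 2)\<^sup>2)"
  have q: "q \<ge> 0" unfolding q_def by simp
  have "norm (near_extremal_integrand \<phi> n x z) = 2 / pi * norm z ^ n * exp (x * Im z) * (exp (- poisson \<phi> (Re z) (Im z + 1)) * q)"
    unfolding near_extremal_integrand_def norm_mult norm_near_extremal_transform[OF w \<phi> z] q_def
    by (simp add: norm_power norm_exp_eq_Re norm_mult norm_divide)
  also have "\<dots> = 2 / pi * (norm z ^ n * exp (- poisson \<phi> (Re z) (Im z + 1))) * exp (x * Im z) * q" by simp
  also have "\<dots> \<le> 2 / pi * m * exp (x * Im z) * q"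
    by (intro mult_right_mono mult_left_mono le q) auto
  finally show ?thesis by (simp only: q_def)
qed

lemma near_extremal_integrand_line_integrable:
  assumes w: "weight \<phi>" and \<phi>: "log_integrable \<phi>" and m: "m > 0" and t: "\<And>t. t \<ge> 0 \<Longrightarrow> t ^ n \<le> m * exp (\<phi> t)" and y: "y \<ge> 0"
  shows "integrable lborel (\<lambda>\<xi>. near_extremal_integrand \<phi> n x (Complex \<xi> y))"
    and "norm (\<integral>\<xi>. near_extremal_integrand \<phi> n x (Complex \<xi> y) \<partial>lborel) \<le> 2 * m * exp (x * y) / (y + 2)"
proof -
  have y2: "y + 2 > 0" using y by simp
  let ?W = "\<lambda>\<xi>. 2 / pi * m * exp (x * y) * (1 / (\<xi>\<^sup>2 + (y + 2)\<^sup>2))"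
  have b: "norm (near_extremal_integrand \<phi> n x (Complex \<xi> y)) \<le> ?W \<xi>" for \<xi>
    using norm_near_extremal_integrand_le[OF w \<phi> m t, of "Complex \<xi> y" x] y by simp
  have iW: "integrable lborel ?W" by (intro integrable_mult_right inverse_sq_sum_integral(1)[OF y2])
  have "continuous_on UNIV (\<lambda>\<xi>. near_extremal_integrand \<phi> n x (Complex \<xi> y))"
    by (rule continuous_on_compose2[OF holomorphic_on_imp_continuous_on[OF near_extremal_integrand_holomorphic[OF \<phi>]]])
       (use y in \<open>auto simp: Complex_eq intro!: continuous_intros\<close>)
  then have meas: "(\<lambda>\<xi>. near_extremal_integrand \<phi> n x (Complex \<xi> y)) \<in> borel_measurable lborel"
    by (simp add: borel_measurable_continuous_onI)
  show int: "integrable lborel (\<lambda>\<xi>. near_extremal_integrand \<phi> n x (Complex \<xi> y))"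
    by (rule Bochner_Integration.integrable_bound[OF iW meas]) (use order_trans[OF b abs_ge_self] in auto)
  have "norm (\<integral>\<xi>. near_extremal_integrand \<phi> n x (Complex \<xi> y) \<partial>lborel) \<le> (\<integral>\<xi>. ?W \<xi> \<partial>lborel)"
    by (rule order_trans[OF integral_norm_bound], rule integral_mono[OF integrable_norm[OF int] iW b])
  moreover have "(\<integral>\<xi>. ?W \<xi> \<partial>lborel) = 2 / pi * m * exp (x * y) * (pi / (y + 2))"
    by (simp only: Bochner_Integration.integral_mult_right_zero inverse_sq_sum_integral(2)[OF y2])
  ultimately show "norm (\<integral>\<xi>. near_extremal_integrand \<phi> n x (Complex \<xi> y) \<partial>lborel) \<le> 2 * m * exp (x * y) / (y + 2)" by simp
qed

lemma Complex_zero_eq_of_real: "Complex \<xi> 0 = of_real \<xi>" by (simp add: complex_eq_iff)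

lemma near_extremal_shift:
  assumes w: "weight \<phi>" and \<phi>: "log_integrable \<phi>" and m: "m > 0" and t: "\<And>t. t \<ge> 0 \<Longrightarrow> t ^ n \<le> m * exp (\<phi> t)" and y: "y \<ge> 0"
  shows "near_extremal \<phi> n x = (\<integral>\<xi>. near_extremal_integrand \<phi> n x (Complex \<xi> y) \<partial>lborel)"
  unfolding near_extremal_def
proof (rule contour_shift[OF near_extremal_integrand_holomorphic[OF \<phi>] y])
  fix z assume z: "0 \<le> Im z" "Im z \<le> y"
  have "x * Im z \<le> \<bar>x\<bar> * y" using z by (metis abs_ge_self abs_mult abs_of_nonneg mult_mono abs_ge_zero order_trans)
  then have e: "exp (x * Im z) \<le> exp (\<bar>x\<bar> * y)" by simp
  have "1 + (Re z)\<^sup>2 \<le> (Re z)\<^sup>2 + (Im z + 2)\<^sup>2"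
  proof -
    have "1 \<le> (Im z + 2)\<^sup>2" using z by (intro one_le_power) simp
    then show ?thesis by simp
  qed
  then have q: "1 / ((Re z)\<^sup>2 + (Im z + 2)\<^sup>2) \<le> 1 / (1 + (Re z)\<^sup>2)"
    by (intro divide_left_mono mult_pos_pos) (auto simp: add_pos_nonneg intro: less_le_trans[of 0 "1 + (Re z)\<^sup>2"])
  have "norm (near_extremal_integrand \<phi> n x z) \<le> 2 / pi * m * exp (x * Im z) * (1 / ((Re z)\<^sup>2 + (Im z + 2)\<^sup>2))"
    by (rule norm_near_extremal_integrand_le[OF w \<phi> m t z(1)])
  also have "\<dots> \<le> 2 / pi * m * exp (\<bar>x\<bar> * y) * (1 / (1 + (Re z)\<^sup>2))"
    using m by (intro mult_mono mult_left_mono e q) auto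
  finally show "norm (near_extremal_integrand \<phi> n x z) \<le> (2 / pi * m * exp (\<bar>x\<bar> * y)) / (1 + (Re z)\<^sup>2)" by simp
qed

text \<open>The bound is read off on the real line. At \<open>x = 0\<close> the integral may be moved to any height \<open>y\<close>, where it is \<open>O(1 / (y + 2))\<close>.\<close>

lemma near_extremal_bounds:
  assumes w: "weight \<phi>" and \<phi>: "log_integrable \<phi>" and m: "m > 0" and t: "\<And>t. t \<ge> 0 \<Longrightarrow> t ^ n \<le> m * exp (\<phi> t)"
  shows "norm (near_extremal \<phi> n x) \<le> m" "near_extremal \<phi> n 0 = 0"
proof -
  show "norm (near_extremal \<phi> n x) \<le> m"
    using near_extremal_integrand_line_integrable(2)[OF w \<phi> m t, of 0 x] unfolding near_extremal_def Complex_zero_eq_of_real by simp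
  have "norm (near_extremal \<phi> n 0) \<le> 2 * m / (real k + 2)" for k :: nat
    using near_extremal_integrand_line_integrable(2)[OF w \<phi> m t, of "real k" 0] near_extremal_shift[OF w \<phi> m t, of "real k" 0] by simp
  moreover have "(\<lambda>k. 2 * m / (real k + 2)) \<longlonglongrightarrow> 0" by real_asymp
  ultimately have "norm (near_extremal \<phi> n 0) \<le> 0" by (intro LIMSEQ_le_const[of "\<lambda>k. 2 * m / (real k + 2)"]) auto
  then show "near_extremal \<phi> n 0 = 0" by simp
qed

text \<open>The second-order remainder of the exponential costs a factor \<open>\<xi>\<^sup>2\<close>, which the integrand with index \<open>n + 2\<close> absorbs.\<close>

lemma near_extremal_derivative:
  assumes w: "weight \<phi>" and \<phi>: "log_integrable \<phi>" and m: "\<And>n. m n > 0" and t: "\<And>n t. t \<ge> 0 \<Longrightarrow> t ^ n \<le> m n * exp (\<phi> t)"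
  shows "(near_extremal \<phi> n has_vector_derivative near_extremal \<phi> (Suc n) x) (at x)"
proof (rule has_vector_derivative_quadratic)
  fix h :: real
  have int: "integrable lborel (\<lambda>\<xi>. near_extremal_integrand \<phi> k u (of_real \<xi>))" for k u
    using near_extremal_integrand_line_integrable(1)[OF w \<phi> m t order_refl, of k u] unfolding Complex_zero_eq_of_real .
  let ?d = "\<lambda>\<xi>. near_extremal_integrand \<phi> n (x + h) (of_real \<xi>) - near_extremal_integrand \<phi> n x (of_real \<xi>) - of_real h * near_extremal_integrand \<phi> (Suc n) x (of_real \<xi>)"
  define K where "K = (\<integral>\<xi>. norm (near_extremal_integrand \<phi> (n + 2) 0 (of_real \<xi>)) \<partial>lborel)"
  have eq: "near_extremal \<phi> n (x + h) - near_extremal \<phi> n x - of_real h * near_extremal \<phi> (Suc n) x = (\<integral>\<xi>. ?d \<xi> \<partial>lborel)"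
    unfolding near_extremal_def
    using Bochner_Integration.integral_diff[OF Bochner_Integration.integrable_diff[OF int int] integrable_mult_right[OF int]]
      Bochner_Integration.integral_diff[OF int int] by (simp add: Bochner_Integration.integral_mult_right_zero)
  have pt: "norm (?d \<xi>) \<le> h\<^sup>2 * norm (near_extremal_integrand \<phi> (n + 2) 0 (of_real \<xi>))" for \<xi>
  proof -
    define c where "c = of_real (2 / pi) * (- (\<i> * of_real \<xi>)) ^ n * near_extremal_transform \<phi> (of_real \<xi>)"
    define E where "E = exp (- (\<i> * of_real x * of_real \<xi>))"
    have nE: "norm E = 1" by (simp add: E_def norm_exp_eq_Re)
    have h1: "near_extremal_integrand \<phi> n x (of_real \<xi>) = c * E" by (simp add: near_extremal_integrand_def c_def E_def)
    have h2: "near_extremal_integrand \<phi> n (x + h) (of_real \<xi>) = c * E * iexp (- (h * \<xi>))"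
    proof -
      have "exp (- (\<i> * of_real (x + h) * of_real \<xi>)) = E * iexp (- (h * \<xi>))"
        unfolding E_def by (simp add: exp_add[symmetric] algebra_simps)
      then show ?thesis by (simp add: near_extremal_integrand_def c_def)
    qed
    have h3: "of_real h * near_extremal_integrand \<phi> (Suc n) x (of_real \<xi>) = c * E * (\<i> * of_real (- (h * \<xi>)))"
      by (simp add: near_extremal_integrand_def c_def E_def)
    have "?d \<xi> = c * E * (iexp (- (h * \<xi>)) - (1 + \<i> * of_real (- (h * \<xi>))))"
      unfolding h1 h2 h3 by (simp add: algebra_simps)
    then have "norm (?d \<xi>) = norm c * norm (iexp (- (h * \<xi>)) - (1 + \<i> * of_real (- (h * \<xi>))))"
      by (simp add: norm_mult nE)
    also have "norm (iexp (- (h * \<xi>)) - (1 + \<i> * of_real (- (h * \<xi>)))) \<le> (h * \<xi>)\<^sup>2 / 2"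
      using iexp_approx1[of "- (h * \<xi>)" 1] by (simp add: power2_eq_square)
    finally have "norm (?d \<xi>) \<le> norm c * ((h * \<xi>)\<^sup>2 / 2)" by (simp add: mult_left_mono)
    also have "\<dots> \<le> norm c * (h * \<xi>)\<^sup>2" by (intro mult_left_mono) auto
    also have "\<dots> = h\<^sup>2 * norm (near_extremal_integrand \<phi> (n + 2) 0 (of_real \<xi>))"
      by (simp add: near_extremal_integrand_def c_def norm_mult norm_divide norm_power power_mult_distrib power_add power2_eq_square)
    finally show ?thesis .
  qed
  have "norm (\<integral>\<xi>. ?d \<xi> \<partial>lborel) \<le> (\<integral>\<xi>. h\<^sup>2 * norm (near_extremal_integrand \<phi> (n + 2) 0 (of_real \<xi>)) \<partial>lborel)"
  proof (rule order_trans[OF integral_norm_bound], rule integral_mono[OF _ _ pt])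
    show "integrable lborel (\<lambda>\<xi>. norm (?d \<xi>))"
      by (intro integrable_norm Bochner_Integration.integrable_diff integrable_mult_right int)
    show "integrable lborel (\<lambda>\<xi>. h\<^sup>2 * norm (near_extremal_integrand \<phi> (n + 2) 0 (of_real \<xi>)))"
      by (intro integrable_mult_right integrable_norm int)
  qed
  then show "norm (near_extremal \<phi> n (x + h) - near_extremal \<phi> n x - of_real h * near_extremal \<phi> (Suc n) x) \<le> K * h\<^sup>2"
    unfolding eq K_def Bochner_Integration.integral_mult_right_zero by (simp only: mult.commute)
qed

lemma near_extremal_in_class:
  assumes M: "finite_Ostrowski M" and \<phi>: "log_integrable (log_Ostrowski M)"
  shows "near_extremal (log_Ostrowski M) 0 \<in> DC_class M" "flat_at (near_extremal (log_Ostrowski M) 0) 0"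
proof -
  note w = weight_log_Ostrowski[OF M] and m = finite_Ostrowski_pos[OF M] and t = power_le_exp_log_Ostrowski[OF M]
  let ?D = "near_extremal (log_Ostrowski M)"
  have D: "(?D n has_vector_derivative ?D (Suc n) x) (at x)" for n x by (rule near_extremal_derivative[OF w \<phi> m t])
  have e: "nth_vderiv n (?D 0) = ?D n" for n by (rule nth_vderiv_eqI[of ?D, OF refl D])
  have "smooth_fun (?D 0)" by (rule smooth_funI[of ?D, OF refl D])
  then show "?D 0 \<in> DC_class M" using near_extremal_bounds(1)[OF w \<phi> m t] by (simp add: DC_class_def e)
  show "flat_at (?D 0) 0" using near_extremal_bounds(2)[OF w \<phi> m t] by (simp add: flat_at_def e)
qed

section \<open>The saddle point estimate\<close>

lemma inverse_sq_tail:
  fixes a :: real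
  assumes a: "a > 0"
  shows "integrable lborel (\<lambda>x. if \<bar>x\<bar> \<ge> a then 1 / x\<^sup>2 else 0)"
    "(\<integral>x. (if \<bar>x\<bar> \<ge> a then 1 / x\<^sup>2 else 0) \<partial>lborel) = 2 / a"
proof -
  let ?f = "\<lambda>x. if \<bar>x\<bar> \<ge> a then 1 / x\<^sup>2 else 0"
  have d: "((\<lambda>x. - 1 / x) has_real_derivative 1 / x\<^sup>2) (at x)" if "a \<le> x" for x
    using that a by (auto intro!: derivative_eq_intros simp: power2_eq_square)
  have m: "(\<lambda>x::real. 1 / x\<^sup>2) \<in> borel_measurable borel" by measurable
  have lim: "((\<lambda>x::real. - 1 / x) \<longlongrightarrow> 0) at_top" by real_asymp
  have 1: "set_integrable lborel {a..} (\<lambda>x. 1 / x\<^sup>2)" by (rule set_integral_FTC_atLeast_nonneg(1)[OF m d _ lim]) auto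
  have 2: "(LINT x:{a..}|lborel. 1 / x\<^sup>2) = 0 - - 1 / a" by (rule set_integral_FTC_atLeast_nonneg(2)[OF m d _ lim]) auto
  have e: "indicator {0..} x *\<^sub>R ?f x = indicator {a..} x *\<^sub>R (1 / x\<^sup>2)" for x using a by (auto simp: indicator_def)
  have si: "set_integrable lborel {0..} ?f" using 1 unfolding set_integrable_def e .
  have se: "(LINT x:{0..}|lborel. ?f x) = (LINT x:{a..}|lborel. 1 / x\<^sup>2)" unfolding set_lebesgue_integral_def e ..
  have ev: "?f (- x) = ?f x" for x by simp
  show "integrable lborel ?f" by (rule even_integral_lborel(1)[OF ev si])
  show "(\<integral>x. ?f x \<partial>lborel) = 2 / a" unfolding even_integral_lborel(2)[OF ev si] se 2 by simp
qed

lemma re_exp_times_near_one: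
  fixes R W :: complex
  assumes "norm R \<le> 1/16" "norm W \<le> 1" "norm (W - 1) \<le> 1/8"
  shows "Re (exp (- R) * W) \<ge> 3/4"
proof -
  have "norm (exp (- R) - 1) \<le> exp \<bar>Re (- R)\<bar> * norm R" using Taylor_exp[of "- R" 0] by simp
  also have "\<dots> \<le> exp (1 / 2 :: real) * norm R"
    using abs_Re_le_cmod[of "- R"] assms(1) by (intro mult_right_mono) auto
  also have "\<dots> \<le> 2 * (1 / 16)" using assms(1) exp_half_le2 by (intro mult_mono) auto
  finally have e: "norm (exp (- R) - 1) \<le> 1 / 8" by simp
  have "norm (exp (- R) * W - 1) \<le> norm ((exp (- R) - 1) * W) + norm (W - 1)"
    using norm_triangle_ineq[of "(exp (- R) - 1) * W" "W - 1"] by (simp add: algebra_simps)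
  also have "norm ((exp (- R) - 1) * W) \<le> 1 / 8 * 1" unfolding norm_mult using e assms(2) by (intro mult_mono) auto
  finally have "norm (exp (- R) * W - 1) \<le> 1 / 4" using assms(3) by simp
  then have "\<bar>Re (exp (- R) * W - 1)\<bar> \<le> 1 / 4" using abs_Re_le_cmod order_trans by blast
  moreover have "Re (exp (- R) * W - 1) = Re (exp (- R) * W) - 1" by (simp only: minus_complex.sel one_complex.sel)
  moreover have "Y \<ge> 3 / 4" if "\<bar>X\<bar> \<le> 1 / 4" "X = Y - 1" for X Y :: real using that by linarith
  ultimately show ?thesis by blast
qed

lemma inverse_square_near_one:
  fixes a :: real
  assumes a: "\<bar>a\<bar> \<le> 1/64"
  shows "norm (1 / (1 - \<i> * of_real a)\<^sup>2 - 1) \<le> 1/8"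
proof -
  have n: "norm (1 - \<i> * of_real a) \<ge> 1" using complex_Re_le_cmod[of "1 - \<i> * of_real a"] by simp
  then have nz: "1 - \<i> * of_real a \<noteq> 0" by auto
  have "1 / (1 - \<i> * of_real a)\<^sup>2 - 1 = (1 - (1 - \<i> * of_real a)\<^sup>2) / (1 - \<i> * of_real a)\<^sup>2"
    using nz by (simp add: diff_divide_distrib)
  moreover have "1 - (1 - \<i> * of_real a)\<^sup>2 = 2 * \<i> * of_real a + of_real (a\<^sup>2)"
    by (simp add: power2_eq_square algebra_simps)
  moreover have "norm (2 * \<i> * of_real a + of_real (a\<^sup>2)) \<le> 1/8"
  proof -
    have "norm (2 * \<i> * of_real a + complex_of_real (a\<^sup>2)) \<le> norm (2 * \<i> * of_real a) + norm (complex_of_real (a\<^sup>2))"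
      by (rule norm_triangle_ineq)
    moreover have "norm (2 * \<i> * complex_of_real a) = 2 * \<bar>a\<bar>" by (simp add: norm_mult)
    moreover have "norm (complex_of_real (a\<^sup>2)) = \<bar>a\<bar> * \<bar>a\<bar>" unfolding norm_of_real by (simp add: power2_eq_square abs_mult)
    moreover have "\<bar>a\<bar> * \<bar>a\<bar> \<le> 1/64 * 1" using a by (intro mult_mono) auto
    ultimately show ?thesis using a by linarith
  qed
  moreover have "norm (w / (1 - \<i> * of_real a)\<^sup>2) \<le> norm w" for w :: complex
  proof -
    have "norm (1 - \<i> * of_real a) ^ 2 \<ge> 1" using n by (rule one_le_power)
    then show ?thesis unfolding norm_divide norm_power by (intro divide_le_eq[THEN iffD2]) (auto simp: mult_le_cancel_left1)
  qed
  ultimately show ?thesis by (metis order_trans)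
qed

text \<open>With \<open>\<sigma> = 1 / sqrt A\<close>, the range \<open>\<bar>x\<bar> \<le> \<sigma>\<close> contributes at least \<open>3 / 4 * \<sigma>\<close> to the real part, the range up to \<open>384 * \<sigma>\<close> only a
nonnegative amount, and the remaining range at most \<open>96 / (A * 384 * \<sigma>) = \<sigma> / 4\<close> in modulus.\<close>

lemma saddle_point_lower_bound:
  fixes A :: real
  assumes V: "integrable lborel V" and A: "A > 0"
    and center: "\<And>x. \<bar>x\<bar> \<le> 384 / sqrt A \<Longrightarrow> Re (V x) \<ge> 3/4 * exp (- (A * x\<^sup>2 / 2))"
    and tail: "\<And>x. x \<noteq> 0 \<Longrightarrow> norm (V x) \<le> 48 / (A * x\<^sup>2)"
  shows "norm (\<integral>x. V x \<partial>lborel) \<ge> 1 / (2 * sqrt A)"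
proof -
  define L :: real where L: "L = 384"
  define \<sigma> where "\<sigma> = 1 / sqrt A"
  have \<sigma>: "\<sigma> > 0" "A * \<sigma>\<^sup>2 = 1" using A by (simp_all add: \<sigma>_def power_divide)
  have a: "L * \<sigma> > 0" "L * \<sigma> = 384 / sqrt A" using \<sigma> L by (simp_all add: \<sigma>_def)
  \<comment> \<open>An integrable minorant of the real part of \<open>V\<close>; \<open>3 / 8\<close> comes from \<open>exp (- 1 / 2) \<ge> 1 / 2\<close>.\<close>
  let ?low = "\<lambda>x. 3/8 * indicator {- \<sigma>..\<sigma>} x - 48 / A * (if \<bar>x\<bar> \<ge> L * \<sigma> then 1 / x\<^sup>2 else 0)"
  have i1: "integrable lborel (\<lambda>x. 3/8 * indicator {- \<sigma>..\<sigma>} x :: real)"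
    using \<sigma> by (intro integrable_mult_right integrable_real_indicator) auto
  have i2: "integrable lborel (\<lambda>x. 48 / A * (if \<bar>x\<bar> \<ge> L * \<sigma> then 1 / x\<^sup>2 else 0))"
    by (intro integrable_mult_right inverse_sq_tail(1)[OF a(1)])
  have lowI: "(\<integral>x. ?low x \<partial>lborel) = 3/4 * \<sigma> - 48 / A * (2 / (L * \<sigma>))"
    unfolding Bochner_Integration.integral_diff[OF i1 i2] Bochner_Integration.integral_mult_right_zero inverse_sq_tail(2)[OF a(1)]
    using \<sigma> by simp
  have "?low x \<le> Re (V x)" for x
  proof (cases "\<bar>x\<bar> < L * \<sigma>")
    case True
    then have c: "Re (V x) \<ge> 3/4 * exp (- (A * x\<^sup>2 / 2))" using center[of x] a by simp
    show ?thesis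
    proof (cases "x \<in> {- \<sigma>..\<sigma>}")
      case in\<sigma>: True
      have "x\<^sup>2 \<le> \<sigma>\<^sup>2" using in\<sigma> by (simp add: abs_le_square_iff[symmetric] abs_le_iff)
      then have "A * x\<^sup>2 \<le> 1" using \<sigma>(2) A mult_left_mono[of "x\<^sup>2" "\<sigma>\<^sup>2" A] by simp
      then have "exp (- (A * x\<^sup>2 / 2)) \<ge> 1 / 2" using exp_ge_add_one_self[of "- (A * x\<^sup>2 / 2)"] by linarith
      then show ?thesis using c True in\<sigma> by simp
    next
      case False
      have "0 \<le> 3/4 * exp (- (A * x\<^sup>2 / 2))" by simp
      then have "0 \<le> Re (V x)" using c by linarith
      then show ?thesis using True False by simp
    qed
  next
    case False
    then have x: "x \<noteq> 0" "x \<notin> {- \<sigma>..\<sigma>}" using a \<sigma> L by auto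
    have "\<bar>Re (V x)\<bar> \<le> 48 / (A * x\<^sup>2)" using tail[OF x(1)] abs_Re_le_cmod[of "V x"] by linarith
    then show ?thesis using False x by simp
  qed
  then have "(\<integral>x. ?low x \<partial>lborel) \<le> (\<integral>x. Re (V x) \<partial>lborel)"
    by (intro integral_mono Bochner_Integration.integrable_diff i1 i2 integrable_Re V)
  also have "\<dots> = Re (\<integral>x. V x \<partial>lborel)" by (rule integral_Re[OF V])
  also have "\<dots> \<le> norm (\<integral>x. V x \<partial>lborel)" by (rule complex_Re_le_cmod)
  finally have "3/4 * \<sigma> - 48 / A * (2 / (L * \<sigma>)) \<le> norm (\<integral>x. V x \<partial>lborel)" unfolding lowI .
  moreover have "48 / A * (2 / (L * \<sigma>)) = \<sigma> / 4"
  proof -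
    have "A = 1 / \<sigma>\<^sup>2" using \<sigma> A by (simp add: field_simps)
    then show ?thesis using \<sigma>(1) L by (simp add: power2_eq_square)
  qed
  ultimately show ?thesis by (simp add: \<sigma>_def)
qed

lemma exp_minus_le_inverse: "x > 0 \<Longrightarrow> exp (- x) \<le> 1 / (x::real)"
  using le_imp_inverse_le[of x "exp x"] exp_ge_add_one_self[of x] by (simp add: exp_minus inverse_eq_divide)

text \<open>The integral that defines the function is taken on the line through the saddle point, that is, at height \<open>\<eta> - 1\<close> because
the transform contains \<open>F (z + \<i>)\<close>. After the factor \<open>c0\<close> is removed, the integrand is
\<open>V x = exp (- (F (x + \<i> * \<eta>) - p + \<i> * x * s)) * W x\<close> with \<open>W\<close> close to \<open>1\<close> near \<open>x = 0\<close>, and the linear term of \<open>F\<close> cancels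
because \<open>s\<close> is the derivative of \<open>p\<close> at \<open>\<eta>\<close>.\<close>

lemma near_extremal_lower_bound:
  assumes M: "finite_Ostrowski M" and \<phi>: "log_integrable (log_Ostrowski M)" and \<eta>: "\<eta> \<ge> 1"
    and A: "curvature (log_Ostrowski M) \<eta> > 0"
    and wide: "384 / sqrt (curvature (log_Ostrowski M) \<eta>) \<le> \<eta> / 64"
    and cubic: "(384 / sqrt (curvature (log_Ostrowski M) \<eta>)) ^ 3 * remainder (log_Ostrowski M) \<eta> \<le> 1 / 16"
  defines "p \<equiv> poisson (log_Ostrowski M) 0 \<eta>" and "s \<equiv> slope (log_Ostrowski M) \<eta>"
  shows "norm (near_extremal (log_Ostrowski M) 0 s) \<ge> exp (- (p - \<eta> * s)) * exp (- s) / (pi * (\<eta> + 1)\<^sup>2 * sqrt (curvature (log_Ostrowski M) \<eta>))"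
proof -
  let ?\<phi> = "log_Ostrowski M"
  define A where "A = curvature ?\<phi> \<eta>"
  define B where "B = remainder ?\<phi> \<eta>"
  define F where "F = (\<lambda>x. schwarz ?\<phi> (Complex x \<eta>))"
  define W where "W = (\<lambda>x. 1 / (1 - \<i> * complex_of_real (x / (\<eta> + 1)))\<^sup>2)"
  define V where "V = (\<lambda>x. exp (- (F x - of_real p + \<i> * of_real (x * s))) * W x)"
  note w = weight_log_Ostrowski[OF M]
  have A0: "A > 0" using A by (simp add: A_def)
  have \<eta>0: "\<eta> > 0" "\<eta> + 1 > 0" using \<eta> by auto
  have B0: "B \<ge> 0" unfolding B_def remainder_def by (intro integral_nonneg_AE) auto
  define c0 where "c0 = of_real (2 / pi) * complex_of_real (exp ((\<eta> - 1) * s)) * of_real (exp (- p)) * (- 1 / of_real ((\<eta> + 1)\<^sup>2))"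
  have hV: "near_extremal_integrand ?\<phi> 0 s (Complex x (\<eta> - 1)) = c0 * V x" for x
  proof -
    let ?z = "Complex x (\<eta> - 1)"
    have z1: "?z + \<i> = Complex x \<eta>" by (simp add: complex_eq_iff)
    have e1: "exp (- (\<i> * of_real s * ?z)) = of_real (exp ((\<eta> - 1) * s)) * exp (- (\<i> * of_real (x * s)))"
    proof -
      have "- (\<i> * of_real s * ?z) = of_real ((\<eta> - 1) * s) + - (\<i> * of_real (x * s))" by (simp add: complex_eq_iff)
      then show ?thesis by (simp only: exp_add exp_of_real)
    qed
    have e2: "exp (- schwarz ?\<phi> (?z + \<i>)) = of_real (exp (- p)) * exp (- (F x - of_real p))"
    proof -
      have "exp (- F x) = exp (of_real (- p) + - (F x - of_real p))" by simp
      moreover have "schwarz ?\<phi> (?z + \<i>) = F x" unfolding z1 by (simp add: F_def)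
      ultimately show ?thesis by (simp only: exp_add exp_of_real)
    qed
    have z2: "?z + 2 * \<i> = \<i> * of_real (\<eta> + 1) * (1 - \<i> * of_real (x / (\<eta> + 1)))"
      using \<eta>0 by (simp add: complex_eq_iff)
    have e3: "1 / (?z + 2 * \<i>)\<^sup>2 = (- 1 / of_real ((\<eta> + 1)\<^sup>2)) * W x"
      unfolding z2 W_def power_mult_distrib by simp
    have e4: "exp (- (F x - of_real p + \<i> * of_real (x * s))) = exp (- (F x - of_real p)) * exp (- (\<i> * of_real (x * s)))"
      by (simp add: exp_add[symmetric])
    have "near_extremal_integrand ?\<phi> 0 s ?z = of_real (2 / pi) * exp (- (\<i> * of_real s * ?z)) * (exp (- schwarz ?\<phi> (?z + \<i>)) * (1 / (?z + 2 * \<i>)\<^sup>2))"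
      by (simp add: near_extremal_integrand_def near_extremal_transform_def)
    also have "\<dots> = c0 * V x" unfolding e1 e2 e3 V_def e4 c0_def by (simp only: mult.assoc mult.commute mult.left_commute)
    finally show ?thesis .
  qed
  have y0: "\<eta> - 1 \<ge> 0" using \<eta> by simp
  have nc0: "norm c0 = 2 / pi * exp ((\<eta> - 1) * s) * exp (- p) * (1 / (\<eta> + 1)\<^sup>2)"
  proof -
    have "norm (- 1 / complex_of_real ((\<eta> + 1)\<^sup>2)) = 1 / (\<eta> + 1)\<^sup>2" unfolding norm_divide norm_of_real by simp
    then show ?thesis unfolding c0_def norm_mult norm_of_real by simp
  qed
  then have "norm c0 > 0" using \<eta>0 by simp
  then have c0n: "c0 \<noteq> 0" by auto
  have hint: "integrable lborel (\<lambda>x. near_extremal_integrand ?\<phi> 0 s (Complex x (\<eta> - 1)))"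
    by (rule near_extremal_integrand_line_integrable(1)[OF w \<phi> finite_Ostrowski_pos[OF M] power_le_exp_log_Ostrowski[OF M] y0])
  have Vi: "integrable lborel V"
  proof -
    have "integrable lborel (\<lambda>x. (1 / c0) * (c0 * V x))" using hint unfolding hV by (rule integrable_mult_right)
    then show ?thesis using c0n by simp
  qed
  have g: "near_extremal ?\<phi> 0 s = c0 * (\<integral>x. V x \<partial>lborel)"
  proof -
    have "near_extremal ?\<phi> 0 s = (\<integral>x. near_extremal_integrand ?\<phi> 0 s (Complex x (\<eta> - 1)) \<partial>lborel)"
      by (rule near_extremal_shift[OF w \<phi> finite_Ostrowski_pos[OF M] power_le_exp_log_Ostrowski[OF M] y0])
    then show ?thesis unfolding hV Bochner_Integration.integral_mult_right_zero .
  qed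
  have nW: "norm (W x) = (\<eta> + 1)\<^sup>2 / ((\<eta> + 1)\<^sup>2 + x\<^sup>2)" for x
  proof -
    have "(norm (1 - \<i> * complex_of_real (x / (\<eta> + 1))))\<^sup>2 = 1 + (x / (\<eta> + 1))\<^sup>2" by (simp add: cmod_power2)
    also have "\<dots> = ((\<eta> + 1)\<^sup>2 + x\<^sup>2) / (\<eta> + 1)\<^sup>2" using \<eta>0 by (simp add: power_divide add_divide_distrib)
    finally show ?thesis by (simp add: W_def norm_divide norm_power)
  qed
  have W1: "norm (W x) \<le> 1" for x unfolding nW using \<eta>0 by (simp add: divide_le_eq add_pos_nonneg)
  have nV: "norm (V x) = exp (- (poisson ?\<phi> x \<eta> - p)) * norm (W x)" for x
    using Re_schwarz[OF \<phi> weight_even[OF w], of "Complex x \<eta>"] \<eta>0 by (simp add: V_def norm_mult norm_exp_eq_Re F_def)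
  have tail: "norm (V x) \<le> 48 / (A * x\<^sup>2)" if x: "x \<noteq> 0" for x
  proof (cases "\<bar>x\<bar> \<le> \<eta>")
    case True
    define E where "E = poisson ?\<phi> x \<eta> - p"
    have E: "E \<ge> x\<^sup>2 * A / 12" unfolding E_def p_def A_def by (rule poisson_quadratic_growth(1)[OF w \<phi> \<eta>0(1) True])
    have pos: "x\<^sup>2 * A / 12 > 0" using x A0 by simp
    have "exp (- E) \<le> exp (- (x\<^sup>2 * A / 12))" using E by simp
    also have "\<dots> \<le> 1 / (x\<^sup>2 * A / 12)" by (rule exp_minus_le_inverse[OF pos])
    also have "\<dots> = 12 / (A * x\<^sup>2)" by (simp add: mult.commute)
    also have "\<dots> \<le> 48 / (A * x\<^sup>2)" using A0 by (intro divide_right_mono) auto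
    finally have e: "exp (- E) \<le> 48 / (A * x\<^sup>2)" .
    have "exp (- E) * norm (W x) \<le> exp (- E) * 1" by (intro mult_left_mono W1) auto
    then show ?thesis unfolding nV E_def[symmetric] using e by linarith
  next
    case False
    define E where "E = poisson ?\<phi> x \<eta> - p"
    have E: "E \<ge> \<eta>\<^sup>2 * A / 12" unfolding E_def p_def A_def by (rule poisson_quadratic_growth(2)[OF w \<phi> \<eta>0(1)]) (use False in simp)
    have pos: "\<eta>\<^sup>2 * A / 12 > 0" using \<eta>0 A0 by simp
    have "exp (- E) \<le> exp (- (\<eta>\<^sup>2 * A / 12))" using E by simp
    also have "\<dots> \<le> 1 / (\<eta>\<^sup>2 * A / 12)" by (rule exp_minus_le_inverse[OF pos])
    finally have e: "exp (- E) \<le> 12 / (A * \<eta>\<^sup>2)" by (simp add: mult.commute)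
    have "(\<eta> + 1)\<^sup>2 \<le> (2 * \<eta>)\<^sup>2" using \<eta> by (intro power_mono) auto
    then have "(\<eta> + 1)\<^sup>2 \<le> 4 * \<eta>\<^sup>2" by (simp add: power_mult_distrib)
    then have "norm (W x) \<le> 4 * \<eta>\<^sup>2 / x\<^sup>2" unfolding nW using x \<eta>0
      by (intro frac_le) (auto simp: zero_less_power2)
    then have "exp (- E) * norm (W x) \<le> 12 / (A * \<eta>\<^sup>2) * (4 * \<eta>\<^sup>2 / x\<^sup>2)" using A0 by (intro mult_mono e) auto
    also have "\<dots> = 48 / (A * x\<^sup>2)" using \<eta>0 by simp
    finally show ?thesis unfolding nV E_def[symmetric] .
  qed
  have center: "Re (V x) \<ge> 3/4 * exp (- (A * x\<^sup>2 / 2))" if x: "\<bar>x\<bar> \<le> 384 / sqrt A" for x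
  proof -
    have x64: "\<bar>x\<bar> \<le> \<eta> / 64" using x wide unfolding A_def by linarith
    define R where "R = F x - (of_real p - \<i> * of_real (x * s) + of_real (x\<^sup>2 / 2 * A))"
    have "norm R \<le> \<bar>x\<bar> ^ 3 * B"
      unfolding R_def F_def p_def s_def A_def B_def by (rule schwarz_taylor_horizontal[OF \<phi> \<eta>0(1)]) (use x64 \<eta>0 in simp)
    also have "\<dots> \<le> (384 / sqrt A) ^ 3 * B" using x B0 by (intro mult_right_mono power_mono) auto
    also have "\<dots> \<le> 1 / 16" using cubic by (simp only: A_def B_def)
    finally have R: "norm R \<le> 1 / 16" .
    have "\<bar>x / (\<eta> + 1)\<bar> \<le> 1 / 64"
    proof -
      have "\<bar>x\<bar> \<le> 1 / 64 * (\<eta> + 1)" using x64 by simp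
      then show ?thesis using \<eta>0 by (simp add: abs_divide pos_divide_le_eq)
    qed
    then have W2: "norm (W x - 1) \<le> 1 / 8" unfolding W_def by (rule inverse_square_near_one)
    have re: "Re (of_real r * v) = r * Re v" for r v by simp
    have "- (F x - of_real p + \<i> * of_real (x * s)) = of_real (- (A * x\<^sup>2 / 2)) + - R" by (simp add: R_def algebra_simps)
    then have "V x = of_real (exp (- (A * x\<^sup>2 / 2))) * (exp (- R) * W x)"
      unfolding V_def by (simp only: exp_add exp_of_real mult.assoc)
    then have "Re (V x) = exp (- (A * x\<^sup>2 / 2)) * Re (exp (- R) * W x)" by (simp only: re)
    also have "\<dots> \<ge> exp (- (A * x\<^sup>2 / 2)) * (3 / 4)"
      by (rule mult_left_mono[OF re_exp_times_near_one[OF R W1 W2]]) simp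
    finally show ?thesis by (simp only: mult.commute)
  qed
  have "norm (\<integral>x. V x \<partial>lborel) \<ge> 1 / (2 * sqrt A)"
    by (rule saddle_point_lower_bound[OF Vi A0 center tail])
  then have "norm c0 * norm (\<integral>x. V x \<partial>lborel) \<ge> norm c0 * (1 / (2 * sqrt A))" by (rule mult_left_mono) simp
  moreover have "exp ((\<eta> - 1) * s) * exp (- p) = exp (- (p - \<eta> * s)) * exp (- s)"
    by (simp add: exp_add[symmetric] algebra_simps)
  ultimately show ?thesis unfolding g norm_mult nc0 by (simp add: A_def mult.assoc)
qed

section \<open>The growth condition and the Legendre transform\<close>

lemma quartic_tail:
  fixes a :: real
  assumes a: "a > 0"
  shows "set_integrable lborel {a..} (\<lambda>x. 1 / x ^ 4)" "(LINT x:{a..}|lborel. 1 / x ^ 4) = 1 / (3 * a ^ 3)"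
proof -
  have d: "((\<lambda>x. - 1 / (3 * x ^ 3)) has_real_derivative 1 / x ^ 4) (at x)" if "a \<le> x" for x
  proof -
    have x: "x > 0" using that a by simp
    have den: "((\<lambda>x. 3 * x ^ 3) has_real_derivative 9 * x\<^sup>2) (at x)" by (auto intro!: derivative_eq_intros)
    have "((\<lambda>x. - 1 / (3 * x ^ 3)) has_real_derivative (0 * (3 * x ^ 3) - (- 1) * (9 * x\<^sup>2)) / ((3 * x ^ 3) * (3 * x ^ 3))) (at x)"
      by (rule DERIV_divide[OF DERIV_const den]) (use x in simp)
    moreover have "(0 * (3 * x ^ 3) - (- 1) * (9 * x\<^sup>2)) / ((3 * x ^ 3) * (3 * x ^ 3)) = (9 * x\<^sup>2) * 1 / ((9 * x\<^sup>2) * x ^ 4)"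
      by (simp add: power2_eq_square power3_eq_cube power4_eq_xxxx mult.commute mult.left_commute)
    moreover have "\<dots> = 1 / x ^ 4" using x by simp
    ultimately show ?thesis by simp
  qed
  have m: "(\<lambda>x::real. 1 / x ^ 4) \<in> borel_measurable borel" by measurable
  have lim: "((\<lambda>x::real. - 1 / (3 * x ^ 3)) \<longlongrightarrow> 0) at_top" by real_asymp
  show "set_integrable lborel {a..} (\<lambda>x. 1 / x ^ 4)" by (rule set_integral_FTC_atLeast_nonneg(1)[OF m d _ lim]) auto
  show "(LINT x:{a..}|lborel. 1 / x ^ 4) = 1 / (3 * a ^ 3)"
    using set_integral_FTC_atLeast_nonneg(2)[OF m d _ lim, of a] by simp
qed

text \<open>For \<open>\<bar>t\<bar> \<le> y\<close> the weight is at most \<open>\<phi> y\<close>, and \<open>\<phi> y / (3 * y\<^sup>3)\<close> is itself at most the tail integral of \<open>\<phi> t / t\<^sup>4\<close>.\<close>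

lemma remainder_le_quartic_tail:
  assumes w: "weight \<phi>" and \<phi>: "log_integrable \<phi>" and y: "y \<ge> 1" and big: "\<phi> y \<ge> \<bar>\<phi> 0\<bar>"
  shows "remainder \<phi> y \<le> 8 * (LINT t:{y..}|lborel. \<phi> t / t ^ 4)"
    and "(LINT t:{y..}|lborel. \<phi> t / t ^ 4) \<ge> \<phi> y / (3 * y ^ 3)"
proof -
  define J where "J = (LINT t:{y..}|lborel. \<phi> t / t ^ 4)"
  have y0: "y > 0" using y by simp
  have \<phi>y: "\<phi> y \<ge> 0" using big by simp
  have up: "\<phi> t \<ge> \<phi> y" if "\<bar>t\<bar> \<ge> y" for t by (rule weight_mono[OF w]) (use that y0 in simp)
  have low: "\<bar>\<phi> t\<bar> \<le> \<phi> y" if "\<bar>t\<bar> \<le> y" for t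
  proof -
    have "\<phi> t \<le> \<phi> y" by (rule weight_mono[OF w]) (use that y0 in simp)
    moreover have "\<phi> 0 \<le> \<phi> t" by (rule weight_ge0[OF w])
    ultimately show ?thesis using big by linarith
  qed
  define k where "k = (\<lambda>t::real. if \<bar>t\<bar> \<ge> y then 1 / t ^ 4 else 0)"
  have km: "k \<in> borel_measurable borel" unfolding k_def by measurable
  have kb: "norm (k t) \<le> 2 / (1 + t\<^sup>2)" for t
  proof (cases "\<bar>t\<bar> \<ge> y")
    case True
    then have t1: "1 \<le> t\<^sup>2" using y by (metis abs_le_square_iff abs_one abs_ge_self order_trans one_power2)
    have "t ^ 4 = t\<^sup>2 * t\<^sup>2" by (simp add: power2_eq_square power4_eq_xxxx)
    moreover have "t\<^sup>2 * 1 \<le> t\<^sup>2 * t\<^sup>2" using t1 by (intro mult_left_mono) auto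
    ultimately have "1 + t\<^sup>2 \<le> 2 * t ^ 4" using t1 by linarith
    then have "2 / (2 * t ^ 4) \<le> 2 / (1 + t\<^sup>2)"
      by (intro divide_left_mono mult_pos_pos) (auto simp: add_pos_nonneg intro: less_le_trans[of 0 "1 + t\<^sup>2"])
    then show ?thesis using True by (simp add: k_def)
  next
    case False
    then show ?thesis by (simp add: k_def add_nonneg_nonneg)
  qed
  have \<phi>k: "integrable lborel (\<lambda>t. \<phi> t * k t)" using log_integrable_times_kernel[OF \<phi> km kb] by simp
  have ek: "indicator {0..} t *\<^sub>R (\<phi> t * k t) = indicator {y..} t *\<^sub>R (\<phi> t / t ^ 4)" for t
    using y0 by (auto simp: indicator_def k_def)
  have evk: "\<phi> (- t) * k (- t) = \<phi> t * k t" for t by (simp add: weight_even[OF w] k_def)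
  have sik: "set_integrable lborel {0..} (\<lambda>t. \<phi> t * k t)" by (rule integrable_imp_set_integrable[OF \<phi>k]) simp
  have Jk: "(\<integral>t. \<phi> t * k t \<partial>lborel) = 2 * J"
    using even_integral_lborel(2)[OF evk sik] unfolding J_def set_lebesgue_integral_def ek by simp
  have siJ: "set_integrable lborel {y..} (\<lambda>t. \<phi> t / t ^ 4)"
    using sik unfolding set_integrable_def ek .
  have "\<phi> y * (1 / (3 * y ^ 3)) = (LINT t:{y..}|lborel. \<phi> y * (1 / t ^ 4))"
    by (simp only: set_integral_mult_right quartic_tail(2)[OF y0])
  also have "\<dots> \<le> J" unfolding J_def
  proof (rule set_integral_mono[OF _ siJ])
    show "set_integrable lborel {y..} (\<lambda>t. \<phi> y * (1 / t ^ 4))"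
      using quartic_tail(1)[OF y0] by (intro set_integrable_mult_right) auto
    fix t assume "t \<in> {y..}"
    then have "\<phi> y * (1 / t ^ 4) \<le> \<phi> t * (1 / t ^ 4)" using up[of t] y0 by (intro mult_right_mono) auto
    then show "\<phi> y * (1 / t ^ 4) \<le> \<phi> t / t ^ 4" by simp
  qed
  finally have J1: "\<phi> y / (3 * y ^ 3) \<le> J" by simp
  then show "(LINT t:{y..}|lborel. \<phi> t / t ^ 4) \<ge> \<phi> y / (3 * y ^ 3)" by (simp add: J_def)
  let ?g = "\<lambda>t. indicator {-y..y} t * (\<phi> y / y ^ 4) + \<phi> t * k t"
  have gi: "integrable lborel (\<lambda>t. indicator {-y..y} t * (\<phi> y / y ^ 4))"
    using y0 by (intro integrable_mult_left integrable_real_indicator) auto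
  have "remainder \<phi> y \<le> (\<integral>t. ?g t \<partial>lborel)" unfolding remainder_def
  proof (rule integral_mono)
    show "integrable lborel (\<lambda>t. \<bar>\<phi> t\<bar> * (1 / (t\<^sup>2 + y\<^sup>2)\<^sup>2))"
      by (rule kernels_integrable(3)[OF log_integrable_abs[OF \<phi>] y0])
    show "integrable lborel ?g" by (intro Bochner_Integration.integrable_add gi \<phi>k)
    fix t :: real
    have s: "t\<^sup>2 + y\<^sup>2 > 0" by (rule sq_sum_pos[OF y0])
    show "\<bar>\<phi> t\<bar> * (1 / (t\<^sup>2 + y\<^sup>2)\<^sup>2) \<le> ?g t"
    proof (cases "\<bar>t\<bar> \<le> y")
      case True
      have "(y\<^sup>2)\<^sup>2 \<le> (t\<^sup>2 + y\<^sup>2)\<^sup>2" by (intro power_mono) auto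
      then have "1 / (t\<^sup>2 + y\<^sup>2)\<^sup>2 \<le> 1 / (y\<^sup>2)\<^sup>2" using s y0 by (intro divide_left_mono mult_pos_pos zero_less_power) auto
      also have "(y\<^sup>2)\<^sup>2 = y ^ 4" by (simp add: power2_eq_square power4_eq_xxxx)
      finally have "\<bar>\<phi> t\<bar> * (1 / (t\<^sup>2 + y\<^sup>2)\<^sup>2) \<le> \<phi> y * (1 / y ^ 4)" using low[OF True] by (intro mult_mono) auto
      moreover have "\<phi> t * k t \<ge> 0" using up[of t] \<phi>y by (auto simp: k_def)
      ultimately show ?thesis using True by (simp add: abs_le_iff)
    next
      case False
      then have t: "t \<noteq> 0" "\<bar>t\<bar> \<ge> y" using y0 by auto
      have "(t\<^sup>2)\<^sup>2 \<le> (t\<^sup>2 + y\<^sup>2)\<^sup>2" by (intro power_mono) auto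
      moreover have "0 < (t\<^sup>2)\<^sup>2" "0 < (t\<^sup>2 + y\<^sup>2)\<^sup>2" using s t by simp_all
      ultimately have "1 / (t\<^sup>2 + y\<^sup>2)\<^sup>2 \<le> 1 / (t\<^sup>2)\<^sup>2" by (intro divide_left_mono mult_pos_pos) auto
      also have "(t\<^sup>2)\<^sup>2 = t ^ 4" by (simp add: power2_eq_square power4_eq_xxxx)
      finally have "\<bar>\<phi> t\<bar> * (1 / (t\<^sup>2 + y\<^sup>2)\<^sup>2) \<le> \<phi> t * (1 / t ^ 4)" using up[OF t(2)] \<phi>y by (intro mult_mono) auto
      moreover have "indicator {-y..y} t = (0::real)" using False by (auto simp: indicator_def abs_le_iff)
      ultimately show ?thesis using t by (simp add: k_def)
    qed
  qed
  also have "\<dots> = 2 * y * (\<phi> y / y ^ 4) + 2 * J"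
    unfolding Bochner_Integration.integral_add[OF gi \<phi>k] Jk using y0 by simp
  also have "2 * y * (\<phi> y / y ^ 4) = 6 * (\<phi> y / (3 * y ^ 3))" using y0 by (simp add: power3_eq_cube power4_eq_xxxx)
  also have "6 * (\<phi> y / (3 * y ^ 3)) + 2 * J \<le> 8 * J" using J1 by linarith
  finally show "remainder \<phi> y \<le> 8 * (LINT t:{y..}|lborel. \<phi> t / t ^ 4)" by (simp add: J_def)
qed

text \<open>The weight exceeds \<open>n * ln t - ln (M n)\<close> for every \<open>n\<close>.\<close>

lemma log_Ostrowski_superlogarithmic:
  assumes M: "finite_Ostrowski M" shows "\<forall>\<^sub>F t in at_top. log_Ostrowski M t \<ge> K * ln t + c"
proof -
  obtain n where n: "K + 1 \<le> real n" using real_arch_simple by blast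
  have "\<forall>\<^sub>F t::real in at_top. ln t \<ge> \<bar>ln (M n)\<bar> + \<bar>c\<bar>" by real_asymp
  then show ?thesis using eventually_gt_at_top[of 1]
  proof eventually_elim
    case (elim t)
    have "(K + 1) * ln t \<le> real n * ln t" using n elim by (intro mult_right_mono) auto
    then show ?case using log_Ostrowski_ge[OF M, of t n] elim by (simp add: algebra_simps)
  qed
qed

text \<open>Let \<open>J\<close> be \<open>\<eta>\<^sup>3\<close> times the tail integral in the hypothesis and \<open>n\<close> the numerator, so that eventually \<open>n \<ge> K * J powr (2 / 3)\<close>. Then
\<open>sqrt A \<ge> 24576 * J powr (1 / 3) / \<eta>\<close>, where \<open>24576 = 384 * 64\<close>, and the remainder is at most \<open>8 * J / \<eta>\<^sup>3\<close>; the powers of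
\<open>J\<close> and \<open>\<eta>\<close> cancel in the cubic condition. The width condition uses that \<open>J \<ge> 1\<close> eventually.\<close>

lemma growth_gives_saddle:
  assumes M: "finite_Ostrowski M" and \<phi>: "log_integrable (log_Ostrowski M)"
    and growth: "filterlim
      (\<lambda>t. t * right_deriv (log_Ostrowski M) t /
           (t ^ 3 * (LINT \<xi>:{t..}|lborel. log_Ostrowski M \<xi> / \<xi> ^ 4)) powr (2 / 3))
      at_top at_top"
  shows "\<forall>\<^sub>F \<eta> in at_top. curvature (log_Ostrowski M) \<eta> > 0 \<and> 384 / sqrt (curvature (log_Ostrowski M) \<eta>) \<le> \<eta> / 64
    \<and> (384 / sqrt (curvature (log_Ostrowski M) \<eta>)) ^ 3 * remainder (log_Ostrowski M) \<eta> \<le> 1 / 16"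
proof -
  let ?\<phi> = "log_Ostrowski M"
  note w = weight_log_Ostrowski[OF M]
  define K :: real where "K = 25 * 24576\<^sup>2"
  have "\<forall>\<^sub>F t in at_top. ?\<phi> t \<ge> 0 * ln t + (\<bar>?\<phi> 0\<bar> + 3)" by (rule log_Ostrowski_superlogarithmic[OF M])
  moreover have "\<forall>\<^sub>F t in at_top. K \<le> t * right_deriv ?\<phi> t / (t ^ 3 * (LINT \<xi>:{t..}|lborel. ?\<phi> \<xi> / \<xi> ^ 4)) powr (2 / 3)"
    using growth unfolding filterlim_at_top by blast
  ultimately show ?thesis using eventually_ge_at_top[of 1]
  proof eventually_elim
    case (elim \<eta>)
    define J where "J = \<eta> ^ 3 * (LINT \<xi>:{\<eta>..}|lborel. ?\<phi> \<xi> / \<xi> ^ 4)"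
    define n where "n = \<eta> * right_deriv ?\<phi> \<eta>"
    define A where "A = curvature ?\<phi> \<eta>"
    define B where "B = remainder ?\<phi> \<eta>"
    have \<eta>: "\<eta> > 0" "\<eta> \<ge> 1" using elim by auto
    have big: "?\<phi> \<eta> \<ge> \<bar>?\<phi> 0\<bar>" using elim by simp
    note rq = remainder_le_quartic_tail[OF w \<phi> \<eta>(2) big]
    have J1: "J \<ge> 1"
    proof -
      have "1 \<le> ?\<phi> \<eta> / 3" using elim by simp
      also have "\<dots> = \<eta> ^ 3 * (?\<phi> \<eta> / (3 * \<eta> ^ 3))" using \<eta> by simp
      also have "\<dots> \<le> J" unfolding J_def using \<eta> by (intro mult_left_mono rq(2)) auto
      finally show ?thesis .
    qed
    define j where "j = J powr (1 / 3)"
    have j1: "j \<ge> 1" unfolding j_def using J1 by (intro ge_one_powr_ge_zero) auto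
    have j2: "J powr (2 / 3) = j\<^sup>2" unfolding j_def using J1 by (simp add: power2_eq_square powr_add[symmetric])
    have j3: "J = j ^ 3"
    proof -
      have "j ^ 3 = J powr (1/3 + 1/3 + 1/3)" unfolding j_def using J1 by (simp only: power3_eq_cube powr_add)
      then show ?thesis using J1 by simp
    qed
    have "K \<le> n / j\<^sup>2" using elim(2) unfolding J_def[symmetric] n_def[symmetric] j2 .
    then have nK: "K * j\<^sup>2 \<le> n" using j1 by (simp add: pos_le_divide_eq)
    have n0: "n \<ge> 0" unfolding n_def using log_Ostrowski_right_slope(2)[OF M \<eta>(1)] \<eta> by simp
    have An: "A \<ge> n / (25 * \<eta>\<^sup>2)" unfolding A_def
    proof (rule curvature_lower_bound[OF w \<phi> \<eta>(1) n0])
      show "?\<phi> t \<ge> ?\<phi> \<eta> + n * ln (t / \<eta>)" if "t \<ge> \<eta>" for t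
        using log_Ostrowski_right_slope(1)[OF M \<eta>(1) that] unfolding n_def .
    qed
    have "(24576 * j / \<eta>)\<^sup>2 = K * j\<^sup>2 / (25 * \<eta>\<^sup>2)" by (simp add: K_def power_divide power_mult_distrib)
    also have "\<dots> \<le> n / (25 * \<eta>\<^sup>2)" using nK by (intro divide_right_mono) auto
    also have "\<dots> \<le> A" by (rule An)
    finally have sA: "24576 * j / \<eta> \<le> sqrt A" by (rule real_le_rsqrt)
    have pos: "24576 * j / \<eta> > 0" using j1 \<eta> by simp
    have A0: "sqrt A > 0" using sA pos by linarith
    then have A1: "A > 0" by simp
    have "24576 / \<eta> \<le> 24576 * j / \<eta>" using j1 \<eta> by (intro divide_right_mono) auto
    then have "24576 / \<eta> \<le> sqrt A" using sA by linarith
    then have "24576 \<le> sqrt A * \<eta>" using \<eta> by (simp add: pos_divide_le_eq)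
    then have wide: "384 / sqrt A \<le> \<eta> / 64" using A0 by (simp add: pos_divide_le_eq mult.commute)
    have "384 / sqrt A \<le> 384 / (24576 * j / \<eta>)" using sA pos A0 by (intro divide_left_mono mult_pos_pos) auto
    also have "\<dots> = \<eta> / (64 * j)" by simp
    finally have c1: "384 / sqrt A \<le> \<eta> / (64 * j)" .
    have B8: "B \<le> 8 * (J / \<eta> ^ 3)" unfolding B_def J_def using rq(1) \<eta> by simp
    have B0: "B \<ge> 0" unfolding B_def remainder_def by (intro integral_nonneg_AE) auto
    have "(384 / sqrt A) ^ 3 * B \<le> (\<eta> / (64 * j)) ^ 3 * (8 * (J / \<eta> ^ 3))"
      using c1 A0 B0 B8 j1 \<eta> by (intro mult_mono power_mono) auto
    also have "\<dots> = 8 / 64 ^ 3" unfolding j3 using j1 \<eta> by (simp add: power_divide power_mult_distrib)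
    also have "\<dots> \<le> 1 / 16" by simp
    finally have cubic: "(384 / sqrt A) ^ 3 * B \<le> 1 / 16" .
    show ?case using A1 wide cubic by (simp only: A_def B_def)
  qed
qed

lemma poisson_axis_mono:
  assumes w: "weight \<phi>" and \<phi>: "log_integrable \<phi>" and y: "0 < y" "y \<le> y'"
  shows "poisson \<phi> 0 y \<le> poisson \<phi> 0 y'"
proof -
  have int: "integrable lborel (\<lambda>u. \<phi> (y * u) / (1 + u\<^sup>2))" if y: "y > 0" for y
  proof -
    have "integrable lborel (\<lambda>u. \<phi> (0 + y * u) * poisson_kernel 0 y (0 + y * u))"
      by (rule lborel_integrable_real_affine[OF poisson_integrable[OF \<phi> y]]) (use y in simp)
    then have "integrable lborel (\<lambda>u. (pi * y) * (\<phi> (y * u) * poisson_kernel 0 y (y * u)))" by simp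
    moreover have "(pi * y) * (\<phi> (y * u) * poisson_kernel 0 y (y * u)) = \<phi> (y * u) / (1 + u\<^sup>2)" for u
    proof -
      have e: "(y * u)\<^sup>2 + y\<^sup>2 = (y * y) * (1 + u\<^sup>2)" by (simp add: algebra_simps power2_eq_square)
      show ?thesis using y by (simp add: poisson_kernel_def e)
    qed
    ultimately show ?thesis by simp
  qed
  have y': "y' > 0" using y by simp
  have "(\<integral>u. \<phi> (y * u) / (1 + u\<^sup>2) \<partial>lborel) \<le> (\<integral>u. \<phi> (y' * u) / (1 + u\<^sup>2) \<partial>lborel)"
  proof (rule integral_mono[OF int[OF y(1)] int[OF y']])
    fix u :: real
    have "\<phi> (y * u) \<le> \<phi> (y' * u)" by (rule weight_mono[OF w]) (use y in \<open>simp add: abs_mult mult_right_mono\<close>)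
    then show "\<phi> (y * u) / (1 + u\<^sup>2) \<le> \<phi> (y' * u) / (1 + u\<^sup>2)" by (intro divide_right_mono) (auto simp: add_nonneg_nonneg)
  qed
  then show ?thesis using poisson_affine[OF y(1), of \<phi> 0] poisson_affine[OF y', of \<phi> 0] by (simp add: divide_right_mono)
qed

text \<open>Dominated convergence; this is where the supremum in \<open>Q_fun\<close> becomes finite.\<close>

lemma poisson_axis_sublinear:
  assumes \<phi>: "log_integrable \<phi>"
  shows "((\<lambda>y. poisson \<phi> 0 y / y) \<longlongrightarrow> 0) at_top"
proof -
  have m: "\<phi> \<in> borel_measurable borel" by (rule log_integrable_measurable[OF \<phi>])
  have "((\<lambda>y. \<integral>t. \<phi> t / (t\<^sup>2 + y\<^sup>2) \<partial>lborel) \<longlongrightarrow> (\<integral>t. 0 \<partial>(lborel :: real measure))) at_top"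
  proof (rule integral_dominated_convergence_at_top[where w = "\<lambda>t. \<bar>\<phi> t\<bar> / (1 + t\<^sup>2)"])
    show "(\<lambda>t. \<phi> t / (t\<^sup>2 + y\<^sup>2)) \<in> borel_measurable lborel" for y using m by measurable
    show "integrable lborel (\<lambda>t. \<bar>\<phi> t\<bar> / (1 + t\<^sup>2))" using log_integrable_abs[OF \<phi>] by (simp add: log_integrable_def)
    show "AE t in lborel. ((\<lambda>y. \<phi> t / (t\<^sup>2 + y\<^sup>2)) \<longlongrightarrow> 0) at_top" by (intro AE_I2) real_asymp
    show "\<forall>\<^sub>F y in at_top. AE t in lborel. norm (\<phi> t / (t\<^sup>2 + y\<^sup>2)) \<le> \<bar>\<phi> t\<bar> / (1 + t\<^sup>2)"
      using eventually_ge_at_top[of 1]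
    proof eventually_elim
      case (elim y)
      have "1 \<le> y\<^sup>2" using elim by simp
      then have "\<bar>\<phi> t\<bar> / (t\<^sup>2 + y\<^sup>2) \<le> \<bar>\<phi> t\<bar> / (1 + t\<^sup>2)" for t
        using sq_sum_pos[of y t] elim by (intro divide_left_mono mult_pos_pos) (auto simp: add_pos_nonneg)
      moreover have "norm (\<phi> t / (t\<^sup>2 + y\<^sup>2)) = \<bar>\<phi> t\<bar> / (t\<^sup>2 + y\<^sup>2)" for t
        by (simp only: real_norm_def abs_divide abs_of_nonneg[OF add_nonneg_nonneg[OF zero_le_power2[of t] zero_le_power2[of y]]])
      ultimately show ?case by simp
    qed
  qed simp
  then have "((\<lambda>y. (\<integral>t. \<phi> t / (t\<^sup>2 + y\<^sup>2) \<partial>lborel) / pi) \<longlongrightarrow> 0 / pi) at_top" by (intro tendsto_divide) simp_all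
  then have lim: "((\<lambda>y. (\<integral>t. \<phi> t / (t\<^sup>2 + y\<^sup>2) \<partial>lborel) / pi) \<longlongrightarrow> 0) at_top" by simp
  have "\<forall>\<^sub>F y in at_top. (\<integral>t. \<phi> t / (t\<^sup>2 + y\<^sup>2) \<partial>lborel) / pi = poisson \<phi> 0 y / y"
    using eventually_gt_at_top[of 0]
  proof eventually_elim
    case (elim y)
    have e: "\<phi> t * poisson_kernel 0 y t = (y / pi) * (\<phi> t / (t\<^sup>2 + y\<^sup>2))" for t by (simp add: poisson_kernel_def)
    show ?case unfolding poisson_def e Bochner_Integration.integral_mult_right_zero using elim by simp
  qed
  from Lim_transform_eventually[OF lim this] show ?thesis .
qed

lemma Q_fun_eq_SUP:
  assumes \<phi>: "log_integrable (log_Ostrowski M)" and even: "\<And>t. log_Ostrowski M (- t) = log_Ostrowski M t"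
  shows "Q_fun M s = (SUP y\<in>{0<..}. poisson (log_Ostrowski M) 0 y - y * s)"
  unfolding Q_fun_def
proof (rule SUP_cong[OF refl])
  fix y :: real assume "y \<in> {0<..}"
  then have y: "y > 0" by simp
  let ?f = "\<lambda>t. log_Ostrowski M t * poisson_kernel 0 y t"
  have "poisson (log_Ostrowski M) 0 y = 2 *\<^sub>R (LINT t:{0..}|lborel. ?f t)"
    unfolding poisson_def
    by (rule even_integral_lborel(2)[OF _ integrable_imp_set_integrable[OF poisson_integrable[OF \<phi> y]]]) (simp_all add: even poisson_kernel_def)
  also have "(\<lambda>t. ?f t) = (\<lambda>t. (y / pi) * (log_Ostrowski M t / (t\<^sup>2 + y\<^sup>2)))" by (auto simp: poisson_kernel_def)
  finally have "poisson (log_Ostrowski M) 0 y = 2 * ((y / pi) * (LINT t:{0..}|lborel. log_Ostrowski M t / (t\<^sup>2 + y\<^sup>2)))"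
    unfolding set_integral_mult_right by simp
  then show "2 * y / pi * (LINT t:{0..}|lborel. log_Ostrowski M t / (t\<^sup>2 + y\<^sup>2)) - y * s = poisson (log_Ostrowski M) 0 y - y * s"
    by simp
qed

text \<open>For small \<open>s\<close>, the function \<open>p y - y * s\<close> exceeds \<open>p N\<close> somewhere beyond \<open>N\<close>, stays below \<open>p N\<close> on the interval up to \<open>N\<close>
by monotonicity, and is again below it for large \<open>y\<close> by sublinearity. So the maximum is attained beyond \<open>N\<close>, at a
critical point.\<close>

lemma legendre_maximiser:
  assumes w: "weight \<phi>" and \<phi>: "log_integrable \<phi>" and infty: "filterlim \<phi> at_top at_top" and N: "N > 0"
  shows "\<exists>s0>0. \<forall>s. 0 < s \<and> s < s0 \<longrightarrow> (\<exists>\<eta>>N. slope \<phi> \<eta> = s \<and> (\<forall>y>0. poisson \<phi> 0 y - y * s \<le> poisson \<phi> 0 \<eta> - \<eta> * s))"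
proof -
  let ?p = "poisson \<phi> 0"
  have der: "(?p has_real_derivative slope \<phi> y) (at y)" if "y > 0" for y
    by (rule poisson_axis_derivative[OF \<phi> weight_even[OF w] that])
  have slope0: "slope \<phi> y \<ge> 0" if y: "y > 0" for y
  proof (rule ccontr)
    assume "\<not> slope \<phi> y \<ge> 0"
    then have "slope \<phi> y < 0" by simp
    from DERIV_neg_dec_right[OF der[OF y] this] obtain d where d: "d > 0" "\<And>h. h > 0 \<Longrightarrow> h < d \<Longrightarrow> ?p (y + h) < ?p y" by auto
    have "?p (y + d / 2) < ?p y" by (rule d(2)) (use d(1) in auto)
    moreover have "?p y \<le> ?p (y + d / 2)" by (rule poisson_axis_mono[OF w \<phi> y]) (use d(1) in simp)
    ultimately show False by simp
  qed
  define C where "C = 50 * (?p N + 1 + 2 * \<bar>\<phi> 0\<bar>) + \<phi> 0"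
  have "\<forall>\<^sub>F y in at_top. C \<le> \<phi> y" using infty unfolding filterlim_at_top by blast
  then have "\<forall>\<^sub>F y in at_top. C \<le> \<phi> y \<and> y > N" using eventually_gt_at_top[of N] by eventually_elim simp
  then obtain Y0 where Y0: "C \<le> \<phi> Y0" "Y0 > N" using eventually_happens'[OF trivial_limit_at_top_linorder] by blast
  have Y00: "Y0 > 0" using Y0 N by simp
  have pY0: "?p Y0 \<ge> ?p N + 1"
  proof -
    have "(\<phi> Y0 - \<phi> 0) / 50 - 2 * \<bar>\<phi> 0\<bar> \<le> ?p Y0 - Y0 * slope \<phi> Y0" by (rule legendre_value_lower[OF w \<phi> Y00])
    moreover have "Y0 * slope \<phi> Y0 \<ge> 0" using Y00 slope0[OF Y00] by simp
    ultimately show ?thesis using Y0(1) unfolding C_def by (simp add: field_simps)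
  qed
  have "\<exists>\<eta>>N. slope \<phi> \<eta> = s \<and> (\<forall>y>0. ?p y - y * s \<le> ?p \<eta> - \<eta> * s)" if s: "0 < s" "s < 1 / Y0" for s
  proof -
    let ?f = "\<lambda>y. ?p y - y * s"
    have fY0: "?f Y0 > ?p N"
    proof -
      have "Y0 * s < 1" using s Y00 by (simp add: pos_less_divide_eq mult.commute)
      then show ?thesis using pY0 by simp
    qed
    have "\<forall>\<^sub>F y in at_top. ?p y / y < s / 2" by (rule order_tendstoD(2)[OF poisson_axis_sublinear[OF \<phi>]]) (use s in simp)
    then have "\<forall>\<^sub>F y in at_top. ?f y \<le> ?p N"
      using eventually_gt_at_top[of 0] eventually_ge_at_top[of "2 * \<bar>?p N\<bar> / s"]
    proof eventually_elim
      case (elim y)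
      have "?p y < s / 2 * y" using elim by (simp add: pos_divide_less_eq)
      moreover have "2 * \<bar>?p N\<bar> \<le> y * s" using elim s by (simp add: pos_divide_le_eq)
      moreover have "s / 2 * y = y * s / 2" by simp
      ultimately show ?case by linarith
    qed
    then obtain Y where Y: "\<And>y. y \<ge> Y \<Longrightarrow> ?f y \<le> ?p N" by (auto simp: eventually_at_top_linorder)
    define Y1 where "Y1 = max Y (Y0 + 1)"
    have Y1: "\<And>y. y \<ge> Y1 \<Longrightarrow> ?f y \<le> ?p N" "Y1 > Y0" using Y by (auto simp: Y1_def)
    have cont: "continuous_on {N..Y1} ?f"
    proof -
      have "continuous_on {N..Y1} ?p"
        by (rule DERIV_continuous_on, rule has_field_derivative_at_within[OF der]) (use N in auto)
      then show ?thesis by (intro continuous_intros)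
    qed
    have "\<exists>\<eta>\<in>{N..Y1}. \<forall>y\<in>{N..Y1}. ?f y \<le> ?f \<eta>"
      by (rule continuous_attains_sup[OF compact_Icc _ cont]) (use Y0 Y1 in auto)
    then obtain \<eta> where \<eta>: "\<eta> \<in> {N..Y1}" "\<And>y. y \<in> {N..Y1} \<Longrightarrow> ?f y \<le> ?f \<eta>" by blast
    have fe: "?f \<eta> > ?p N" using \<eta>(2)[of Y0] fY0 Y0 Y1 by simp
    have below: "?f y \<le> ?p N" if "0 < y" "y \<le> N" for y
    proof -
      have "?p y \<le> ?p N" by (rule poisson_axis_mono[OF w \<phi> that])
      moreover have "y * s \<ge> 0" using that s by simp
      ultimately show ?thesis by simp
    qed
    have gl: "?f y \<le> ?f \<eta>" if "y > 0" for y
    proof -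
      consider "y \<le> N" | "y \<in> {N..Y1}" | "y \<ge> Y1" by fastforce
      then show ?thesis
      proof cases
        case 1
        then show ?thesis using below[OF that] fe by linarith
      next
        case 2
        then show ?thesis by (rule \<eta>(2))
      next
        case 3
        then show ?thesis using Y1(1)[of y] fe by linarith
      qed
    qed
    have "\<eta> \<noteq> N" using below[OF N order_refl] fe by auto
    then have eN: "\<eta> > N" using \<eta>(1) by simp
    then have e0: "\<eta> > 0" using N by simp
    have "(?f has_real_derivative slope \<phi> \<eta> - s) (at \<eta>)"
      by (rule DERIV_diff[OF der[OF e0]]) (auto intro!: derivative_eq_intros)
    moreover have "\<forall>y. \<bar>\<eta> - y\<bar> < \<eta> \<longrightarrow> ?f y \<le> ?f \<eta>"
    proof (intro allI impI)
      fix y assume "\<bar>\<eta> - y\<bar> < \<eta>"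
      then have "y > 0" by linarith
      then show "?f y \<le> ?f \<eta>" by (rule gl)
    qed
    ultimately have "slope \<phi> \<eta> - s = 0" by (rule DERIV_local_max[OF _ e0])
    then have "slope \<phi> \<eta> = s" by simp
    then show ?thesis using eN gl by blast
  qed
  moreover have "1 / Y0 > 0" using Y00 by simp
  ultimately show ?thesis by blast
qed

text \<open>Both bounds are taken at the maximiser \<open>\<eta>\<close> of \<open>p y - y * s\<close>; all errors are logarithms of powers of \<open>\<eta>\<close>. The curvature enters
the lower bound as \<open>ln A / 2\<close>, which is bounded above because \<open>A\<close> is \<open>O(1 / \<eta>)\<close>.\<close>

lemma flat_extremal_estimate:
  assumes pos: "\<And>n. M n > 0" and nqa: "non_quasianalytic M"
    and growth: "filterlim
      (\<lambda>t. t * right_deriv (log_Ostrowski M) t /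
           (t ^ 3 * (LINT \<xi>:{t..}|lborel. log_Ostrowski M \<xi> / \<xi> ^ 4)) powr (2 / 3))
      at_top at_top"
  shows "\<exists>C. \<forall>N. \<forall>\<^sub>F s in at_right 0. \<exists>\<eta>>N. \<bar>ln (flat_extremal M s) + Q_fun M s\<bar> \<le> 4 * ln \<eta> + C
     \<and> Q_fun M s \<ge> log_Ostrowski M \<eta> / 50 - C"
proof -
  let ?\<phi> = "log_Ostrowski M"
  have M: "finite_Ostrowski M" by (rule non_quasianalytic_finite_Ostrowski[OF pos nqa])
  note w = weight_log_Ostrowski[OF M]
  have \<phi>: "log_integrable ?\<phi>" using non_quasianalytic_log_integrable[OF pos nqa, of 0] M by simp
  let ?p = "poisson ?\<phi> 0"
  obtain C1 where C1: "C1 > 0" "\<And>s y g. s > 0 \<Longrightarrow> y > 0 \<Longrightarrow> g \<in> DC_class M \<Longrightarrow> flat_at g 0 \<Longrightarrow>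
     norm (g s) \<le> C1 * (y + 1) * exp s * exp (- (?p y - y * s))"
    using flat_function_upper_bound[OF pos nqa] by blast
  obtain C2 where C2: "C2 > 0" "\<And>y. y \<ge> 1 \<Longrightarrow> curvature ?\<phi> y \<le> C2 / y" using curvature_upper_bound[OF \<phi>] by blast
  have infty: "filterlim ?\<phi> at_top at_top" unfolding filterlim_at_top
  proof
    fix Z
    have "\<forall>\<^sub>F t in at_top. ?\<phi> t \<ge> 0 * ln t + Z" by (rule log_Ostrowski_superlogarithmic[OF M])
    then show "\<forall>\<^sub>F t in at_top. Z \<le> ?\<phi> t" by simp
  qed
  obtain N0 where N0: "\<And>\<eta>. \<eta> \<ge> N0 \<Longrightarrow> curvature ?\<phi> \<eta> > 0 \<and> 384 / sqrt (curvature ?\<phi> \<eta>) \<le> \<eta> / 64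
    \<and> (384 / sqrt (curvature ?\<phi> \<eta>)) ^ 3 * remainder ?\<phi> \<eta> \<le> 1 / 16"
    using growth_gives_saddle[OF M \<phi> growth] unfolding eventually_at_top_linorder by blast
  define C where "C = \<bar>ln C1\<bar> + \<bar>ln C2\<bar> + ln pi + 1 + 3 * \<bar>?\<phi> 0\<bar>"
  have lnpi: "ln pi \<ge> 0" using pi_gt3 by simp
  have main: "\<exists>s0>0. \<forall>s. 0 < s \<and> s < s0 \<longrightarrow> (\<exists>\<eta>>N. \<bar>ln (flat_extremal M s) + Q_fun M s\<bar> \<le> 4 * ln \<eta> + C
     \<and> Q_fun M s \<ge> ?\<phi> \<eta> / 50 - C)" for N
  proof -
    \<comment> \<open>\<open>\<eta> > 2\<close> gives \<open>\<eta> + 1 \<le> \<eta>\<^sup>2\<close>, which replaces \<open>ln (\<eta> + 1)\<close> by \<open>2 * ln \<eta>\<close>.\<close>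
    define N1 where "N1 = max N (max N0 2)"
    have N1: "N1 > 0" by (simp add: N1_def)
    obtain s0 where s0: "s0 > 0" "\<And>s. 0 < s \<Longrightarrow> s < s0 \<Longrightarrow>
        \<exists>\<eta>>N1. slope ?\<phi> \<eta> = s \<and> (\<forall>y>0. ?p y - y * s \<le> ?p \<eta> - \<eta> * s)"
      using legendre_maximiser[OF w \<phi> infty N1] by blast
    have "\<exists>\<eta>>N. \<bar>ln (flat_extremal M s) + Q_fun M s\<bar> \<le> 4 * ln \<eta> + C \<and> Q_fun M s \<ge> ?\<phi> \<eta> / 50 - C"
      if s: "0 < s" "s < min s0 1" for s
    proof -
      obtain \<eta> where \<eta>: "\<eta> > N1" "slope ?\<phi> \<eta> = s" "\<And>y. y > 0 \<Longrightarrow> ?p y - y * s \<le> ?p \<eta> - \<eta> * s"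
        using s0(2)[of s] s by auto
      have e: "\<eta> > N" "\<eta> > N0" "\<eta> > 2" "\<eta> \<ge> N0" "\<eta> \<ge> 1" "\<eta> > 0" using \<eta>(1) by (auto simp: N1_def)
      have Q: "Q_fun M s = ?p \<eta> - \<eta> * s"
        unfolding Q_fun_eq_SUP[OF \<phi> weight_even[OF w]]
        by (rule cSup_eq_maximum) (use \<eta>(3) e in auto)
      have Qlow: "Q_fun M s \<ge> ?\<phi> \<eta> / 50 - C"
        using legendre_value_lower[OF w \<phi> e(6)] lnpi unfolding Q \<eta>(2) C_def diff_divide_distrib by linarith
      define D where "D = {g \<in> DC_class M. flat_at g 0}"
      have up: "norm (g s) \<le> C1 * (\<eta> + 1) * exp s * exp (- Q_fun M s)" if "g \<in> D" for g
        using C1(2)[OF s(1) e(6)] that unfolding Q D_def by blast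
      let ?g = "near_extremal ?\<phi> 0"
      have gD: "?g \<in> D" unfolding D_def using near_extremal_in_class[OF M \<phi>] by simp
      define A where "A = curvature ?\<phi> \<eta>"
      have A0: "A > 0" using N0[OF e(4)] by (simp add: A_def)
      define b where "b = exp (- Q_fun M s) * exp (- s) / (pi * (\<eta> + 1)\<^sup>2 * sqrt A)"
      have low: "b \<le> norm (?g s)"
        using near_extremal_lower_bound[OF M \<phi> e(5)] N0[OF e(4)] unfolding b_def Q A_def \<eta>(2) by blast
      have fe: "flat_extremal M s = (SUP g\<in>D. norm (g s))" by (simp add: flat_extremal_def D_def)
      have up': "flat_extremal M s \<le> C1 * (\<eta> + 1) * exp s * exp (- Q_fun M s)"
        unfolding fe by (rule cSUP_least) (use gD up in auto)
      have bdd: "bdd_above ((\<lambda>g. norm (g s)) ` D)" unfolding bdd_above_def using up by auto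
      have "norm (?g s) \<le> flat_extremal M s" unfolding fe by (rule cSUP_upper[OF gD bdd])
      then have low': "b \<le> flat_extremal M s" using low by simp
      have b0: "b > 0" unfolding b_def using A0 e by simp
      have lnb: "ln b = - Q_fun M s - s - (ln pi + 2 * ln (\<eta> + 1) + ln A / 2)"
        unfolding b_def using A0 e by (simp add: ln_div ln_mult ln_realpow ln_sqrt)
      have "ln (flat_extremal M s) \<le> ln (C1 * (\<eta> + 1) * exp s * exp (- Q_fun M s))"
        using b0 low' up' by (intro ln_mono) auto
      also have "\<dots> = ln C1 + ln (\<eta> + 1) + s - Q_fun M s" using C1(1) e by (simp add: ln_mult)
      finally have U: "ln (flat_extremal M s) + Q_fun M s \<le> ln C1 + ln (\<eta> + 1) + s" by simp
      have "ln b \<le> ln (flat_extremal M s)" using b0 low' by (intro ln_mono) auto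
      then have L: "ln (flat_extremal M s) + Q_fun M s \<ge> - s - (ln pi + 2 * ln (\<eta> + 1) + ln A / 2)" unfolding lnb by simp
      have "A \<le> C2 / \<eta>" unfolding A_def by (rule C2(2)[OF e(5)])
      also have "\<dots> \<le> C2 / 1" using C2(1) e by (intro divide_left_mono) auto
      finally have lnA: "ln A \<le> ln C2" using A0 by (intro ln_mono) auto
      have "\<eta> + 1 \<le> \<eta> ^ 2"
      proof -
        have "\<eta> * 2 \<le> \<eta> * \<eta>" using e by (intro mult_left_mono) auto
        then show ?thesis using e unfolding power2_eq_square by linarith
      qed
      then have "ln (\<eta> + 1) \<le> ln (\<eta> ^ 2)" using e by (intro ln_mono) auto
      then have ln1: "ln (\<eta> + 1) \<le> 2 * ln \<eta>" using e by (simp add: ln_realpow)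
      have ln0: "ln \<eta> \<ge> 0" "ln (\<eta> + 1) \<ge> 0" using e by auto
      have "\<bar>ln (flat_extremal M s) + Q_fun M s\<bar> \<le> 4 * ln \<eta> + C"
        unfolding abs_le_iff C_def using U L lnA ln1 ln0 lnpi s by (intro conjI) linarith+
      then show ?thesis using Qlow e(1) by blast
    qed
    then show ?thesis using s0(1) by (intro exI[of _ "min s0 1"]) auto
  qed
  show ?thesis
  proof (intro exI[of _ C] allI)
    fix N
    obtain s0 where s0: "s0 > 0" "\<And>s. 0 < s \<Longrightarrow> s < s0 \<Longrightarrow> \<exists>\<eta>>N. \<bar>ln (flat_extremal M s) + Q_fun M s\<bar> \<le> 4 * ln \<eta> + C
       \<and> Q_fun M s \<ge> ?\<phi> \<eta> / 50 - C" using main[of N] by blast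
    show "\<forall>\<^sub>F s in at_right 0. \<exists>\<eta>>N. \<bar>ln (flat_extremal M s) + Q_fun M s\<bar> \<le> 4 * ln \<eta> + C \<and> Q_fun M s \<ge> ?\<phi> \<eta> / 50 - C"
      unfolding eventually_at_right_field using s0 by (intro exI[of _ s0]) auto
  qed
qed

theorem theorem2p1:
  fixes M :: "nat \<Rightarrow> real"
  assumes pos: "\<And>n. M n > 0"
    and nqa: "non_quasianalytic M"
    and growth: "filterlim
      (\<lambda>t. t * right_deriv (log_Ostrowski M) t /
           (t ^ 3 * (LINT \<xi>:{t..}|lborel. log_Ostrowski M \<xi> / \<xi> ^ 4)) powr (2 / 3))
      at_top at_top"
  shows "(\<exists>\<epsilon>\<in>o[at_right 0](\<lambda>_. 1). \<forall>\<^sub>F s in at_right 0.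
            ln (flat_extremal M s) = - (1 + \<epsilon> s) * Q_fun M s) \<and>
         (Liminf at_top (\<lambda>t. ereal (ln (log_Ostrowski M t) / ln t)) > 0 \<longrightarrow>
           (\<lambda>s. ln (flat_extremal M s) - (- Q_fun M s)) \<in> O[at_right 0](\<lambda>s. ln (Q_fun M s)))"
proof -
  let ?\<phi> = "log_Ostrowski M" and ?d = "\<lambda>s. ln (flat_extremal M s)" and ?Q = "Q_fun M"
  have M: "finite_Ostrowski M" by (rule non_quasianalytic_finite_Ostrowski[OF pos nqa])
  obtain C where C: "\<And>N. \<forall>\<^sub>F s in at_right 0. \<exists>\<eta>>N. \<bar>?d s + ?Q s\<bar> \<le> 4 * ln \<eta> + C \<and> ?Q s \<ge> ?\<phi> \<eta> / 50 - C"
    using flat_extremal_estimate[OF pos nqa growth] by blast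
  have rel: "\<forall>\<^sub>F s in at_right 0. \<bar>?d s + ?Q s\<bar> \<le> e * ?Q s \<and> ?Q s > 0" if e: "e > 0" for e
  proof -
    have "\<forall>\<^sub>F t in at_top. ?\<phi> t \<ge> (200 / e) * ln t + 50 * (\<bar>C\<bar> / e + C + 1)"
      by (rule log_Ostrowski_superlogarithmic[OF M])
    then obtain N where N: "\<And>t. t \<ge> N \<Longrightarrow> ?\<phi> t \<ge> (200 / e) * ln t + 50 * (\<bar>C\<bar> / e + C + 1)"
      unfolding eventually_at_top_linorder by blast
    show ?thesis using C[of "max N 1"]
    proof eventually_elim
      case (elim s)
      then obtain \<eta> where \<eta>: "\<eta> > max N 1" "\<bar>?d s + ?Q s\<bar> \<le> 4 * ln \<eta> + C" "?Q s \<ge> ?\<phi> \<eta> / 50 - C" by blast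
      have ln0: "ln \<eta> \<ge> 0" using \<eta>(1) by simp
      have "?\<phi> \<eta> / 50 \<ge> ((200 / e) * ln \<eta> + 50 * (\<bar>C\<bar> / e + C + 1)) / 50"
        using N[of \<eta>] \<eta>(1) by (intro divide_right_mono) auto
      moreover have "((200 / e) * ln \<eta> + 50 * (\<bar>C\<bar> / e + C + 1)) / 50 = (4 * ln \<eta> + \<bar>C\<bar>) / e + C + 1"
        by (simp add: add_divide_distrib)
      ultimately have Q: "?Q s \<ge> (4 * ln \<eta> + \<bar>C\<bar>) / e + 1" using \<eta>(3) by linarith
      have nn: "(4 * ln \<eta> + \<bar>C\<bar>) / e \<ge> 0" using ln0 e by simp
      have "4 * ln \<eta> + C \<le> e * ((4 * ln \<eta> + \<bar>C\<bar>) / e)" using e by simp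
      also have "\<dots> \<le> e * ?Q s" using Q e by (intro mult_left_mono) auto
      finally have "\<bar>?d s + ?Q s\<bar> \<le> e * ?Q s" using \<eta>(2) by linarith
      moreover have "?Q s > 0" using Q nn by linarith
      ultimately show ?case by blast
    qed
  qed
  have first: "\<exists>\<epsilon>\<in>o[at_right 0](\<lambda>_. 1). \<forall>\<^sub>F s in at_right 0. ?d s = - (1 + \<epsilon> s) * ?Q s"
  proof (intro bexI)
    let ?\<epsilon> = "\<lambda>s. - (?d s + ?Q s) / ?Q s"
    have one: "(1::real) > 0" by simp
    show "\<forall>\<^sub>F s in at_right 0. ?d s = - (1 + ?\<epsilon> s) * ?Q s"
      using rel[OF one]
    proof eventually_elim
      case (elim s)
      then have "?Q s > 0" by blast
      then show ?case by (simp add: field_simps)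
    qed
    show "?\<epsilon> \<in> o[at_right 0](\<lambda>_. 1)"
    proof (rule landau_o.smallI)
      fix c :: real assume c: "c > 0"
      show "\<forall>\<^sub>F s in at_right 0. norm (?\<epsilon> s) \<le> c * norm (1::real)"
        using rel[OF c]
      proof eventually_elim
        case (elim s)
        then have Q: "?Q s > 0" and b: "\<bar>?d s + ?Q s\<bar> \<le> c * ?Q s" by blast+
        have "norm (?\<epsilon> s) = \<bar>?d s + ?Q s\<bar> / ?Q s"
          unfolding real_norm_def abs_divide abs_minus_cancel using Q by simp
        also have "\<dots> \<le> c" using b Q by (simp add: pos_divide_le_eq)
        finally show ?case by simp
      qed
    qed
  qed
  have second: "(\<lambda>s. ?d s - (- ?Q s)) \<in> O[at_right 0](\<lambda>s. ln (?Q s))"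
    if lim: "Liminf at_top (\<lambda>t. ereal (ln (?\<phi> t) / ln t)) > 0"
  proof -
    obtain a :: real where a: "a > 0" "\<forall>\<^sub>F t in at_top. ereal a < ereal (ln (?\<phi> t) / ln t)"
    proof -
      obtain b where b: "0 < b" "b < Liminf at_top (\<lambda>t. ereal (ln (?\<phi> t) / ln t))" using lim dense by blast
      then obtain a where a: "b = ereal a" by (cases b) auto
      show thesis by (rule that[of a]) (use b a less_LiminfD[OF b(2)] in auto)
    qed
    have "\<forall>\<^sub>F t in at_top. ?\<phi> t \<ge> 0 * ln t + 1" by (rule log_Ostrowski_superlogarithmic[OF M])
    moreover have "\<forall>\<^sub>F t::real in at_top. t powr a / 50 - C \<ge> t powr (a / 2)" using a(1) by real_asymp
    moreover have "\<forall>\<^sub>F t::real in at_top. ln t \<ge> \<bar>C\<bar>" by real_asymp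
    ultimately have "\<forall>\<^sub>F t in at_top. ?\<phi> t / 50 - C \<ge> t powr (a / 2) \<and> 4 * ln t + C \<le> 5 * ln t \<and> t > 1"
      using a(2) eventually_gt_at_top[of 1]
    proof eventually_elim
      case (elim t)
      have "ln t > 0" using elim by simp
      then have "a * ln t \<le> ln (?\<phi> t)" using elim by (simp add: pos_less_divide_eq)
      then have "exp (a * ln t) \<le> exp (ln (?\<phi> t))" by simp
      then have "t powr a \<le> ?\<phi> t" using elim by (simp add: powr_def)
      then have "t powr a / 50 - C \<le> ?\<phi> t / 50 - C" by simp
      then show ?case using elim by linarith
    qed
    then obtain N where N: "\<And>t. t \<ge> N \<Longrightarrow> ?\<phi> t / 50 - C \<ge> t powr (a / 2) \<and> 4 * ln t + C \<le> 5 * ln t \<and> t > 1"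
      unfolding eventually_at_top_linorder by blast
    show ?thesis
    proof (rule bigoI[where c = "10 / a"])
      show "\<forall>\<^sub>F s in at_right 0. norm (?d s - - ?Q s) \<le> 10 / a * norm (ln (?Q s))"
        using C[of N]
      proof eventually_elim
        case (elim s)
        then obtain \<eta> where \<eta>: "\<eta> > N" "\<bar>?d s + ?Q s\<bar> \<le> 4 * ln \<eta> + C" "?Q s \<ge> ?\<phi> \<eta> / 50 - C" by blast
        have n: "?\<phi> \<eta> / 50 - C \<ge> \<eta> powr (a / 2)" "4 * ln \<eta> + C \<le> 5 * ln \<eta>" "\<eta> > 1" using N[of \<eta>] \<eta>(1) by auto
        have "\<eta> powr (a / 2) \<le> ?Q s" using n(1) \<eta>(3) by linarith
        then have "ln (\<eta> powr (a / 2)) \<le> ln (?Q s)" using n(3) by (intro ln_mono) auto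
        then have l: "a / 2 * ln \<eta> \<le> ln (?Q s)" using n(3) by (simp add: ln_powr)
        have "10 / a * (a / 2 * ln \<eta>) \<le> 10 / a * ln (?Q s)" using a(1) by (intro mult_left_mono l) auto
        then have "5 * ln \<eta> \<le> 10 / a * ln (?Q s)" using a(1) by simp
        moreover have "10 / a * ln (?Q s) \<le> 10 / a * \<bar>ln (?Q s)\<bar>" using a(1) by (intro mult_left_mono) auto
        ultimately have "\<bar>?d s + ?Q s\<bar> \<le> 10 / a * \<bar>ln (?Q s)\<bar>" using \<eta>(2) n(2) by linarith
        then show ?case by simp
      qed
    qed
  qed
  show ?thesis using first second by blast
qed

end
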